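(* Let $M=(M,d,E)$ be a model of $\mathsf{MSE}$ and let $r\in\{s(\gamma):\gamma\in\mathrm{Ord}^M\}$. Let $t=r$ if $d$ is an ultrametric and let $t=\tfrac12 r$ otherwise. Then for any real $u<t$ there is an ordinal $\alpha\in\mathrm{Ord}^M$ with $u\le s(\alpha)<r$ such that for every $\beta\in\mathrm{Ord}^M$, if $s(\beta)\ge r$, then $\beta<\alpha$. In particular, if $d$ is an ultrametric, then $\{s(\alpha):\alpha\in\mathrm{Ord}^M\}$ is dense in $(0,1]$ and $\{\alpha\in\mathrm{Ord}^M: s(\alpha)<1\}$ has no least element.
   Context: Metric set structures. For a metric space $(M,d)$ with $[0,1]$-valued metric and $A,B\subseteq M$, $d_{\mathrm H}(A,B)$ is the $[0,1]$-valued Hausdorff distance: the least $t\in[0,1]$ such that for every $r>t$ each point of $A$ is at distance $<r$ from some point of $B$ and vice versa; by convention $d_{\mathrm H}(\varnothing,\varnothing)=0$ and $d_{\mathrm H}(\varnothing,A)=1$ for $A\neq\varnothing$. A metric set structure is a triple $(M,d,E)$ with $(M,d)$ a (nonempty) complete metric space, $d$ $[0,1]$-valued, and $E\subseteq M^2$ a closed binary relation with $d(a,b)=d_{\mathrm H}(\{x:x\,E\,a\},\{x:x\,E\,b\})$ for all $a,b\in M$. Elements of $M$ are called sets, and $x\,E\,y$ is read "$x$ is an element of $y$". Formulas are the smallest collection of expressions containing $1$ and $d(x,y)$ ($x,y$ variables) and closed under $\varphi+\psi$, $\max(\varphi,\psi)$, $\min(\varphi,\psi)$, $r\cdot\varphi$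 ($r\in\mathbb R$), $\sup_x\varphi$, $\inf_x\varphi$, $\sup_{x E y}\varphi$, $\inf_{x E y}\varphi$. Put $v(1)=v(d(x,y))=1$, $v(\varphi+\psi)=v(\varphi)+v(\psi)$, $v(\max(\varphi,\psi))=v(\min(\varphi,\psi))=\max(v(\varphi),v(\psi))$, $v(r\varphi)=|r|v(\varphi)$, and quantifiers do not change $v$. The real value $\varphi^M(\bar a)$ is defined in the obvious way (bounded quantifiers range over $\{x: x\,E\,a\}$), except that if $a$ has no elements then $\sup_{xEa}\varphi$ has value $-v(\varphi)$ and $\inf_{xEa}\varphi$ has value $v(\varphi)$. $(M,d,E)$ is a model of $\mathsf{MSE}$ if it is a metric set structure satisfying excision: for every formula $\varphi(x,\bar y)$, reals $r<s$ and $\bar a\in M$ there is $b\in M$ such that for all $c\in M$: $\varphi^M(c,\bar a)\le r$ implies $c\,E\,b$, and $c\,E\,b$ implies $\varphi^M(c,\bar a)<s$. Ordinals. Write $a\sqsubseteq b$ if every $E$-element of $a$ is an $E$-element of $b$. In a model of $\mathsf{MSE}$, finite sets $\{a_0,\dots,a_{n-1}\}$, the empty set $\varnothing$, ordered pairs $\langle a,b\rangle=\{\{\{a\},\varnothing\},\{\{b\}\}\}$ and products $a\times b=\{\langle x,y\rangle: x\,E\,a,\ y\,E\,b\}$ exist as (unique) elements of $M$. A set $a$ is $r$-discrete ($r>0$) if any two distinct elements of $a$ are at distance $\ge r$; it is uniformly discrete if it is $r$-discrete for some $r>0$. A chain is a set $a$ such that for all $b,c\,E\,a$, $b\sqsubseteq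 c$ or $c\sqsubseteq b$. Uniformly discrete chains $a,b$ are order-isomorphic if there is $f\in M$ with $f\sqsubseteq a\times b$ that is the graph of a bijection from the elements of $a$ to the elements of $b$ preserving and reflecting $\sqsubseteq$; $\mathrm{otp}(a)$ is the order-isomorphism class of $a$. A uniformly discrete chain $a$ is well-ordered if every $b\in M$ with $b\sqsubseteq a$ and $b\ne\varnothing$ has a $\sqsubseteq$-least element. $\mathrm{Ord}^M$, the class of ordinals of $M$, is the collection of order types of uniformly discrete well-ordered chains of $M$. For ordinals, $\alpha\le\beta$ means that any $a$ with $\mathrm{otp}(a)=\alpha$ is order-isomorphic to an initial segment of any $b$ with $\mathrm{otp}(b)=\beta$; $\alpha<\beta$ means $\alpha\le\beta$ and $\alpha\ne\beta$. This is a linear order. For $\alpha\in\mathrm{Ord}^M$, $s(\alpha)=\sup\{r>0:\text{there is an }r\text{-discrete well-ordered chain }x\in M\text{ with }\mathrm{otp}(x)=\alpha,\ r\le 1\}$ (a number in $(0,1]$; chains with at most one element have $s=1$). *)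

theory Defs
  imports "HOL-Analysis.Analysis"
begin

text \<open>Variables are natural numbers. In \<open>BSup x y p\<close> and \<open>BInf x y p\<close>, i.e.
  \<open>sup\<close> and \<open>inf\<close> over \<open>x E y\<close>, the variable \<open>x\<close> is bound and \<open>y\<close> is free (even if
  the two names coincide, in which case \<open>y\<close> refers to the outer variable).\<close>

datatype fm =
    One
  | Dist nat nat
  | Plus fm fm
  | MaxF fm fm
  | MinF fm fm
  | Scale real fm
  | SupF nat fm
  | InfF nat fm
  | BSup nat nat fm
  | BInf nat nat fm

primrec fbound :: "fm \<Rightarrow> real" where
  "fbound One = 1"
| "fbound (Dist x y) = 1"
| "fbound (Plus p q) = fbound p + fbound q"
| "fbound (MaxF p q) = max (fbound p) (fbound q)"
| "fbound (MinF p q) = max (fbound p) (fbound q)"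
| "fbound (Scale c p) = \<bar>c\<bar> * fbound p"
| "fbound (SupF x p) = fbound p"
| "fbound (InfF x p) = fbound p"
| "fbound (BSup x y p) = fbound p"
| "fbound (BInf x y p) = fbound p"

text \<open>This locale carries no assumptions, so that all notions below are plain functions of
  the data \<open>M\<close>, \<open>d\<close>, \<open>E\<close>.\<close>

locale set_structure =
  fixes M :: "'a set" and d :: "'a \<Rightarrow> 'a \<Rightarrow> real" and E :: "('a \<times> 'a) set"
begin

definition hausdorff :: "'a set \<Rightarrow> 'a set \<Rightarrow> real" where
  "hausdorff A B =
    (if A = {} \<and> B = {} then 0
     else if A = {} \<or> B = {} then 1
     else (LEAST t. 0 \<le> t \<and> t \<le> 1 \<and>
             (\<forall>r>t. (\<forall>a\<in>A. \<exists>b\<in>B. d a b < r) \<and> (\<forall>b\<in>B. \<exists>a\<in>A. d b a < r))))"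

definition elts :: "'a \<Rightarrow> 'a set" where
  "elts a = {x \<in> M. (x, a) \<in> E}"

definition ultrametric :: bool where
  "ultrametric \<longleftrightarrow> (\<forall>x\<in>M. \<forall>y\<in>M. \<forall>z\<in>M. d x z \<le> max (d x y) (d y z))"

primrec fval :: "fm \<Rightarrow> (nat \<Rightarrow> 'a) \<Rightarrow> real" where
  "fval One e = 1"
| "fval (Dist x y) e = d (e x) (e y)"
| "fval (Plus p q) e = fval p e + fval q e"
| "fval (MaxF p q) e = max (fval p e) (fval q e)"
| "fval (MinF p q) e = min (fval p e) (fval q e)"
| "fval (Scale c p) e = c * fval p e"
| "fval (SupF x p) e = (SUP a\<in>M. fval p (e(x := a)))"
| "fval (InfF x p) e = (INF a\<in>M. fval p (e(x := a)))"
| "fval (BSup x y p) e =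
    (if elts (e y) = {} then - fbound p else (SUP a\<in>elts (e y). fval p (e(x := a))))"
| "fval (BInf x y p) e =
    (if elts (e y) = {} then fbound p else (INF a\<in>elts (e y). fval p (e(x := a))))"

definition subset_rel :: "'a \<Rightarrow> 'a \<Rightarrow> bool"  (infix "\<sqsubseteq>" 50) where
  "a \<sqsubseteq> b \<longleftrightarrow> elts a \<subseteq> elts b"

text \<open>The element of \<open>M\<close> whose elements are exactly those of \<open>A\<close>; it is unique when it
  exists. Only used for collections \<open>A\<close> for which it exists in every model of MSE.\<close>

definition the_set :: "'a set \<Rightarrow> 'a" where
  "the_set A = (THE b. b \<in> M \<and> elts b = A)"

definition emptyset :: 'a where
  "emptyset = the_set {}"

definition pair :: "'a \<Rightarrow> 'a \<Rightarrow> 'a" where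
  "pair a b = the_set {the_set {the_set {a}, emptyset}, the_set {the_set {b}}}"

definition product :: "'a \<Rightarrow> 'a \<Rightarrow> 'a" where
  "product a b = the_set {pair x y | x y. x \<in> elts a \<and> y \<in> elts b}"

definition discrete :: "real \<Rightarrow> 'a \<Rightarrow> bool" where
  "discrete r a \<longleftrightarrow> (\<forall>x\<in>elts a. \<forall>y\<in>elts a. x \<noteq> y \<longrightarrow> r \<le> d x y)"

definition uniformly_discrete :: "'a \<Rightarrow> bool" where
  "uniformly_discrete a \<longleftrightarrow> (\<exists>r>0. discrete r a)"

definition chain :: "'a \<Rightarrow> bool" where
  "chain a \<longleftrightarrow> a \<in> M \<and> (\<forall>b\<in>elts a. \<forall>c\<in>elts a. b \<sqsubseteq> c \<or> c \<sqsubseteq> b)"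

definition ud_chain :: "'a \<Rightarrow> bool" where
  "ud_chain a \<longleftrightarrow> chain a \<and> uniformly_discrete a"

definition order_iso :: "'a \<Rightarrow> 'a \<Rightarrow> bool" where
  "order_iso a b \<longleftrightarrow> ud_chain a \<and> ud_chain b \<and>
    (\<exists>f\<in>M. f \<sqsubseteq> product a b \<and>
      (\<exists>g. elts f = {pair x (g x) | x. x \<in> elts a} \<and>
           bij_betw g (elts a) (elts b) \<and>
           (\<forall>x\<in>elts a. \<forall>y\<in>elts a. x \<sqsubseteq> y \<longleftrightarrow> g x \<sqsubseteq> g y)))"

definition otp :: "'a \<Rightarrow> 'a set" where
  "otp a = {b. order_iso a b}"

definition wo_chain :: "'a \<Rightarrow> bool" where
  "wo_chain a \<longleftrightarrow> ud_chain a \<and>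
    (\<forall>b\<in>M. b \<sqsubseteq> a \<and> b \<noteq> emptyset \<longrightarrow> (\<exists>x\<in>elts b. \<forall>y\<in>elts b. x \<sqsubseteq> y))"

definition Ord :: "'a set set" where
  "Ord = otp ` {a. wo_chain a}"

definition initial_segment :: "'a \<Rightarrow> 'a \<Rightarrow> bool" where
  "initial_segment c b \<longleftrightarrow> c \<in> M \<and> c \<sqsubseteq> b \<and>
    (\<forall>x\<in>elts c. \<forall>y\<in>elts b. y \<sqsubseteq> x \<longrightarrow> y \<in> elts c)"

definition ord_le :: "'a set \<Rightarrow> 'a set \<Rightarrow> bool" where
  "ord_le \<alpha> \<beta> \<longleftrightarrow>
    (\<forall>a b. wo_chain a \<and> otp a = \<alpha> \<and> wo_chain b \<and> otp b = \<beta> \<longrightarrow>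
       (\<exists>c. initial_segment c b \<and> order_iso a c))"

definition ord_less :: "'a set \<Rightarrow> 'a set \<Rightarrow> bool" where
  "ord_less \<alpha> \<beta> \<longleftrightarrow> ord_le \<alpha> \<beta> \<and> \<alpha> \<noteq> \<beta>"

definition sep :: "'a set \<Rightarrow> real" where
  "sep \<alpha> = Sup {r. 0 < r \<and> r \<le> 1 \<and> (\<exists>x. wo_chain x \<and> discrete r x \<and> otp x = \<alpha>)}"

end

locale metric_set_structure = Metric_space M d + set_structure M d E
  for M :: "'a set" and d and E +
  assumes nonempty: "M \<noteq> {}"
    and complete: "mcomplete"
    and dist_le_1: "\<lbrakk>x \<in> M; y \<in> M\<rbrakk> \<Longrightarrow> d x y \<le> 1"
    and mem_subset: "E \<subseteq> M \<times> M"
    and mem_closed: "closedin (prod_topology mtopology mtopology) E"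
    and dist_eq_hausdorff: "\<lbrakk>a \<in> M; b \<in> M\<rbrakk> \<Longrightarrow> d a b = hausdorff (elts a) (elts b)"

text \<open>In excision, the parameters of a formula are given by an assignment \<open>e\<close> of all
  variables, and \<open>x\<close> is the distinguished variable.\<close>

locale mse_model = metric_set_structure +
  assumes excision:
    "\<lbrakk>\<And>i. e i \<in> M; r < s\<rbrakk> \<Longrightarrow>
      \<exists>b\<in>M. \<forall>c\<in>M. (fval p (e(x := c)) \<le> r \<longrightarrow> c \<in> elts b) \<and>
                    (c \<in> elts b \<longrightarrow> fval p (e(x := c)) < s)"

end

theory Submission
  imports Defs
begin

text \<open>
The theorem is a quantitative form of the Burali-Forti paradox. Fix \<open>r'\<close> slightly below \<open>r\<close>. Every
ordinal \<open>\<beta>\<close> with \<open>sep \<beta> \<ge> r\<close> is the type of an \<open>r'\<close>-discrete well-ordered chain. One collects these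
chains in a single set, orders them by type, and obtains a well-ordered chain that is longer than
all of them (\<open>type_chain_dominates\<close>). The paradox disappears because the new chain is less discrete than
the chains that went into it; the theorem measures the loss.

Excision provides the collecting set only approximately. Let \<open>h\<close> be a small tolerance. There is a
set \<open>b\<close> that contains all \<open>r'\<close>-discrete well-ordered chains and whose members are all well-ordered
up to \<open>h\<close> (\<open>approx_chains\<close>): between their elements the excess, which is the one-sided Hausdorff
distance, is either below \<open>h\<close> or above a much larger bound. On such sets inclusion up to \<open>h\<close> is a
sharp condition: a formula expresses it with the two values 0 and 1. Sharp conditions are closed under
quantification over sets. For them approximate comprehension becomes exact, since a class
whose distance function is definable is a limit of sets given by excision (\<open>exact_comprehension\<close>).

To compare types inside the model one uses the union of all partial isomorphisms between initial
segments. Their graphs are coded by members of the model, and a code that satisfies the defining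
conditions up to an error 1/3 can be corrected to one that satisfies them exactly. So the existential
quantifier over codes is sharp as well (\<open>max_iso_sharp\<close>), and the classical proofs of comparability of
well-orders (\<open>max_iso_total\<close>) and of the well-foundedness of types (\<open>type_le_least\<close>) go through.

The loss of discreteness is governed by \<open>near_type_le\<close>. Members of \<open>b\<close> at distance below \<open>u\<close> have the same
type, because the pairing of their nearby elements distorts inclusion by about \<open>2 * u\<close>, or by about \<open>u\<close> if
the metric is an ultrametric, and this is less than the gap \<open>r'\<close>. Hence the sets
\<open>lower p\<close> of members of type at most that of \<open>p\<close> form a \<open>u\<close>-discrete well-ordered chain. An
\<open>r'\<close>-discrete well-ordered chain \<open>a\<close> is isomorphic to its proper initial segment below
\<open>lower a\<close>, by sending \<open>x\<close> to the class of the segment of \<open>a\<close> below \<open>x\<close>.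

The dominating ordinal exists for every real \<open>r\<close> in $(0,1]$ (\<open>dominating_ordinal\<close>). For
ultrametrics this gives the density of the values of \<open>sep\<close>. There is no least ordinal \<open>\<alpha>\<close> with \<open>sep \<alpha> < 1\<close>
because \<open>sep\<close> is antitone while some ordinal has its value strictly between \<open>sep \<alpha>\<close> and 1.
\<close>

section \<open>Infima and suprema in the unit interval\<close>

text \<open>The values 1 and 0 are adjoined so that an infimum over the empty set is 1, a supremum over the
empty set is 0, and all values stay in $[0,1]$. With these conventions the interpretation of the
bounded quantifiers depends only on the values of a formula, not on its syntactic bound.\<close>
definition binf :: "'b set \<Rightarrow> ('b \<Rightarrow> real) \<Rightarrow> real" where
  "binf A f = Inf (insert 1 (f ` A))"

definition bsup :: "'b set \<Rightarrow> ('b \<Rightarrow> real) \<Rightarrow> real" where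
  "bsup A f = Sup (insert 0 (f ` A))"

lemma binf_le_1: "(\<And>x. x \<in> A \<Longrightarrow> 0 \<le> f x) \<Longrightarrow> binf A f \<le> 1"
  unfolding binf_def by (rule cInf_lower) (auto intro!: bdd_belowI[of _ 0])

lemma binf_lower: "(\<And>x. x \<in> A \<Longrightarrow> 0 \<le> f x) \<Longrightarrow> x \<in> A \<Longrightarrow> binf A f \<le> f x"
  unfolding binf_def by (rule cInf_lower) (auto intro!: bdd_belowI[of _ 0])

lemma binf_greatest: "(\<And>x. x \<in> A \<Longrightarrow> v \<le> f x) \<Longrightarrow> v \<le> 1 \<Longrightarrow> v \<le> binf A f"
  unfolding binf_def by (rule cInf_greatest) auto

lemma binf_lessD: "binf A f < v \<Longrightarrow> v \<le> 1 \<Longrightarrow> \<exists>x\<in>A. f x < v"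
  using binf_greatest[of A v f] by (meson linorder_not_less)

lemma bsup_ge_0: "(\<And>x. x \<in> A \<Longrightarrow> f x \<le> 1) \<Longrightarrow> 0 \<le> bsup A f"
  unfolding bsup_def by (rule cSup_upper) (auto intro!: bdd_aboveI[of _ 1])

lemma bsup_upper: "(\<And>x. x \<in> A \<Longrightarrow> f x \<le> 1) \<Longrightarrow> x \<in> A \<Longrightarrow> f x \<le> bsup A f"
  unfolding bsup_def by (rule cSup_upper) (auto intro!: bdd_aboveI[of _ 1])

lemma bsup_least: "(\<And>x. x \<in> A \<Longrightarrow> f x \<le> v) \<Longrightarrow> 0 \<le> v \<Longrightarrow> bsup A f \<le> v"
  unfolding bsup_def by (rule cSup_least) auto

lemma binf_ge_0: "(\<And>x. x \<in> A \<Longrightarrow> 0 \<le> f x) \<Longrightarrow> 0 \<le> binf A f"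
  by (rule binf_greatest) auto

lemma bsup_le_1: "(\<And>x. x \<in> A \<Longrightarrow> f x \<le> 1) \<Longrightarrow> bsup A f \<le> 1"
  by (rule bsup_least) auto

text \<open>Lets every statement about infima be inherited from the one about suprema.\<close>
lemma binf_eq_compl:
  assumes f: "\<And>x. x \<in> A \<Longrightarrow> 0 \<le> f x \<and> f x \<le> 1"
  shows "binf A f = 1 - bsup A (\<lambda>x. 1 - f x)"
proof (rule antisym)
  have "bsup A (\<lambda>x. 1 - f x) \<le> 1 - binf A f"
    by (rule bsup_least) (use binf_lower[of A f] binf_le_1[of A f] f in auto)
  thus "binf A f \<le> 1 - bsup A (\<lambda>x. 1 - f x)" by simp
  show "1 - bsup A (\<lambda>x. 1 - f x) \<le> binf A f"
  proof (rule binf_greatest)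
    fix x assume "x \<in> A"
    thus "1 - bsup A (\<lambda>x. 1 - f x) \<le> f x" using bsup_upper[of A "\<lambda>x. 1 - f x" x] f by simp
  next
    show "1 - bsup A (\<lambda>x. 1 - f x) \<le> 1" using bsup_ge_0[of A "\<lambda>x. 1 - f x"] f by simp
  qed
qed

lemma bsup_eq_SUP: "A \<noteq> {} \<Longrightarrow> (\<And>x. x \<in> A \<Longrightarrow> 0 \<le> f x \<and> f x \<le> 1) \<Longrightarrow> bsup A f = (SUP x\<in>A. f x)"
proof -
  assume A: "A \<noteq> {}" and f: "\<And>x. x \<in> A \<Longrightarrow> 0 \<le> f x \<and> f x \<le> 1"
  have bd: "bdd_above (f ` A)" using f by (auto intro!: bdd_aboveI[of _ 1])
  obtain x where "x \<in> A" using A by blast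
  hence "0 \<le> (SUP x\<in>A. f x)" using f cSUP_upper[OF _ bd, of x] by (meson order_trans)
  thus ?thesis unfolding bsup_def using A bd by (simp add: cSup_insert sup_absorb2)
qed

lemma binf_empty [simp]: "binf {} f = 1" by (simp add: binf_def)
lemma bsup_empty [simp]: "bsup {} f = 0" by (simp add: bsup_def)

lemma binf_cong: "(\<And>x. x \<in> A \<Longrightarrow> f x = g x) \<Longrightarrow> binf A f = binf A g"
  unfolding binf_def by (metis image_cong)
lemma bsup_cong: "(\<And>x. x \<in> A \<Longrightarrow> f x = g x) \<Longrightarrow> bsup A f = bsup A g"
  unfolding bsup_def by (metis image_cong)

section \<open>Distances to sets and one-sided Hausdorff distances\<close>

context metric_set_structure
begin

definition dist_to :: "'a \<Rightarrow> 'a \<Rightarrow> real" where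
  "dist_to z a = binf (elts a) (d z)"

text \<open>The one-sided Hausdorff distance: it vanishes exactly for inclusion and obeys the
triangle inequality, so it measures the failure of \<open>a \<sqsubseteq> b\<close>.\<close>
definition excess :: "'a \<Rightarrow> 'a \<Rightarrow> real" where
  "excess a b = bsup (elts a) (\<lambda>x. dist_to x b)"

lemma elts_M: "x \<in> elts a \<Longrightarrow> x \<in> M"
  by (simp add: elts_def)

lemma dist_to_ge_0: "0 \<le> dist_to z a" and dist_to_le_1: "dist_to z a \<le> 1"
  unfolding dist_to_def by (auto intro: binf_ge_0 binf_le_1)

lemma excess_ge_0: "0 \<le> excess a b" and excess_le_1: "excess a b \<le> 1"
  unfolding excess_def by (auto intro: bsup_ge_0 bsup_le_1 dist_to_le_1)

lemma dist_to_le: "y \<in> elts a \<Longrightarrow> dist_to z a \<le> d z y"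
  unfolding dist_to_def by (rule binf_lower) auto

lemma dist_to_lessD: "dist_to z a < v \<Longrightarrow> v \<le> 1 \<Longrightarrow> \<exists>y\<in>elts a. d z y < v"
  unfolding dist_to_def by (rule binf_lessD)

lemma dist_to_geI: "(\<And>y. y \<in> elts a \<Longrightarrow> v \<le> d z y) \<Longrightarrow> v \<le> 1 \<Longrightarrow> v \<le> dist_to z a"
  unfolding dist_to_def by (rule binf_greatest)

lemma dist_to_le_excess: "x \<in> elts a \<Longrightarrow> dist_to x b \<le> excess a b"
  unfolding excess_def by (rule bsup_upper) (auto intro: dist_to_le_1)

lemma excess_leI: "(\<And>x. x \<in> elts a \<Longrightarrow> dist_to x b \<le> v) \<Longrightarrow> 0 \<le> v \<Longrightarrow> excess a b \<le> v"
  unfolding excess_def by (rule bsup_least)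

lemma dist_to_triangle: assumes "z \<in> M" "w \<in> M" shows "dist_to z a \<le> d z w + dist_to w a"
proof -
  have "dist_to z a - d z w \<le> dist_to w a"
  proof (rule dist_to_geI)
    fix y assume y: "y \<in> elts a"
    show "dist_to z a - d z w \<le> d w y"
      using dist_to_le[OF y, of z] triangle[OF assms elts_M[OF y]] by simp
    next show "dist_to z a - d z w \<le> 1" using dist_to_le_1[of z a] nonneg[of z w] by linarith
  qed
  thus ?thesis by simp
qed

lemma dist_to_excess: assumes "z \<in> M" shows "dist_to z b \<le> dist_to z a + excess a b"
proof -
  have "dist_to z b - excess a b \<le> dist_to z a"
  proof (rule dist_to_geI)
    fix y assume y: "y \<in> elts a"
    show "dist_to z b - excess a b \<le> d z y"
      using dist_to_le_excess[OF y, of b] dist_to_triangle[OF assms elts_M[OF y], of b] by simp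
    next show "dist_to z b - excess a b \<le> 1" using dist_to_le_1[of z b] excess_ge_0[of a b] by linarith
  qed
  thus ?thesis by simp
qed

lemma excess_triangle: "excess a c \<le> excess a b + excess b c"
proof (rule excess_leI)
  fix x assume x: "x \<in> elts a"
  show "dist_to x c \<le> excess a b + excess b c"
    using dist_to_excess[OF elts_M[OF x], of c b] dist_to_le_excess[OF x, of b] by linarith
qed (simp add: excess_ge_0 add_nonneg_nonneg)

lemma dist_to_ultra: assumes u: ultrametric and "z \<in> M" "w \<in> M" shows "dist_to z a \<le> max (d z w) (dist_to w a)"
proof (rule ccontr)
  assume "\<not> ?thesis"
  hence a: "d z w < dist_to z a" "dist_to w a < dist_to z a" by auto
  obtain y where y: "y \<in> elts a" "d w y < dist_to z a" using dist_to_lessD[OF a(2)] dist_to_le_1 by blast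
  have "d z y \<le> max (d z w) (d w y)" using u assms y elts_M unfolding ultrametric_def by blast
  thus False using dist_to_le[OF y(1), of z] a y by linarith
qed

lemma dist_to_excess_ultra: assumes u: ultrametric and "z \<in> M" shows "dist_to z b \<le> max (dist_to z a) (excess a b)"
proof (rule ccontr)
  assume "\<not> ?thesis"
  hence a: "dist_to z a < dist_to z b" "excess a b < dist_to z b" by auto
  obtain y where y: "y \<in> elts a" "d z y < dist_to z b" using dist_to_lessD[OF a(1)] dist_to_le_1 by blast
  have "dist_to z b \<le> max (d z y) (dist_to y b)" using dist_to_ultra[OF u] assms y elts_M by blast
  thus False using dist_to_le_excess[OF y(1), of b] a y by linarith
qed

lemma excess_ultra: assumes u: ultrametric shows "excess a c \<le> max (excess a b) (excess b c)"
proof (rule excess_leI)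
  fix x assume x: "x \<in> elts a"
  show "dist_to x c \<le> max (excess a b) (excess b c)"
    using dist_to_excess_ultra[OF u elts_M[OF x], of c b] dist_to_le_excess[OF x, of b] by linarith
qed (simp add: excess_ge_0 le_max_iff_disj)

text \<open>The axiom on Hausdorff distances splits into the two one-sided excesses; the
conventions for empty sets agree because \<open>dist_to\<close> to an empty set is 1.\<close>
lemma d_eq_excess: assumes "a \<in> M" "b \<in> M" shows "d a b = max (excess a b) (excess b a)"
proof -
  consider "elts a = {}" "elts b = {}" | "elts a = {}" "elts b \<noteq> {}" | "elts a \<noteq> {}" "elts b = {}"
    | "elts a \<noteq> {}" "elts b \<noteq> {}" by blast
  then show ?thesis
  proof cases
    case 1 thus ?thesis using dist_eq_hausdorff[OF assms] by (simp add: hausdorff_def excess_def)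
  next
    case 2
    then obtain y where y: "y \<in> elts b" by blast
    have "dist_to y a = 1" using 2 by (simp add: dist_to_def)
    hence "excess b a = 1" using dist_to_le_excess[OF y, of a] excess_le_1[of b a] by simp
    thus ?thesis using dist_eq_hausdorff[OF assms] 2 excess_le_1[of a b] by (simp add: hausdorff_def)
  next
    case 3
    then obtain y where y: "y \<in> elts a" by blast
    have "dist_to y b = 1" using 3 by (simp add: dist_to_def)
    hence "excess a b = 1" using dist_to_le_excess[OF y, of b] excess_le_1[of a b] by simp
    thus ?thesis using dist_eq_hausdorff[OF assms] 3 excess_le_1[of b a] by (simp add: hausdorff_def)
  next
    case 4
    let ?P = "\<lambda>t. 0 \<le> t \<and> t \<le> 1 \<and> (\<forall>r>t. (\<forall>x\<in>elts a. \<exists>y\<in>elts b. d x y < r) \<and>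
                (\<forall>y\<in>elts b. \<exists>x\<in>elts a. d y x < r))"
    have key: "\<exists>y\<in>elts b. d x y < r" if "x \<in> elts a" "excess a b < r" "elts b \<noteq> {}" for a b x r
    proof (cases "r \<le> 1")
      case True thus ?thesis using that dist_to_le_excess[of x a b] dist_to_lessD[of x b r] by fastforce
    next
      case False thus ?thesis using that dist_le_1 elts_M by force
    qed
    have "Least ?P = max (excess a b) (excess b a)"
    proof (rule Least_equality)
      show "?P (max (excess a b) (excess b a))"
      proof (intro conjI allI impI ballI)
        show "0 \<le> max (excess a b) (excess b a)" "max (excess a b) (excess b a) \<le> 1"
          using excess_ge_0[of a b] excess_le_1[of a b] excess_le_1[of b a] by linarith+
        show "\<exists>y\<in>elts b. d x y < r" if "max (excess a b) (excess b a) < r" "x \<in> elts a" for r x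
          using key[of x a b r] that 4 by simp
        show "\<exists>y\<in>elts a. d x y < r" if "max (excess a b) (excess b a) < r" "x \<in> elts b" for r x
          using key[of x b a r] that 4 by simp
      qed
    next
      fix t assume P: "?P t"
      have "excess a b \<le> t"
      proof (rule excess_leI)
        fix x assume "x \<in> elts a"
        hence "dist_to x b \<le> r" if "t < r" for r
          using P that dist_to_le[of _ b x] by fastforce
        thus "dist_to x b \<le> t" by (rule dense_ge)
      qed (use P in auto)
      moreover have "excess b a \<le> t"
      proof (rule excess_leI)
        fix x assume "x \<in> elts b"
        hence "dist_to x a \<le> r" if "t < r" for r
          using P that dist_to_le[of _ a x] by fastforce
        thus "dist_to x a \<le> t" by (rule dense_ge)
      qed (use P in auto)
      ultimately show "max (excess a b) (excess b a) \<le> t" by simp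
    qed
    thus ?thesis using dist_eq_hausdorff[OF assms] 4 by (simp add: hausdorff_def)
  qed
qed

lemma excess_le_d: "a \<in> M \<Longrightarrow> b \<in> M \<Longrightarrow> excess a b \<le> d a b"
  by (simp add: d_eq_excess)

text \<open>The only place where closedness of the membership relation enters: if \<open>z\<close> is
at distance 0 from the elements of \<open>a\<close>, then \<open>(z, a)\<close> is a limit of pairs in \<open>E\<close>. Thus membership, which is not
itself a formula, is expressed by one.\<close>
lemma dist_to_eq_0_iff: assumes "z \<in> M" "a \<in> M" shows "dist_to z a = 0 \<longleftrightarrow> z \<in> elts a"
proof
  assume "z \<in> elts a"
  thus "dist_to z a = 0" using dist_to_le[of z a z] dist_to_ge_0[of z a] assms by simp
next
  assume 0: "dist_to z a = 0"
  show "z \<in> elts a"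
  proof (rule ccontr)
    assume "z \<notin> elts a"
    hence n: "(z, a) \<in> M \<times> M - E" using assms by (simp add: elts_def)
    have op: "openin (prod_topology mtopology mtopology) (M \<times> M - E)"
      using mem_closed by (simp add: closedin_def)
    obtain U V where UV: "openin mtopology U" "z \<in> U" "a \<in> V" "U \<times> V \<subseteq> M \<times> M - E"
      using iffD1[OF openin_prod_topology_alt op, rule_format, OF n] by (elim exE conjE) rule
    then obtain r where r: "r > 0" "mball z r \<subseteq> U" unfolding openin_mtopology by blast
    have "dist_to z a < min r 1" using 0 r by simp
    then obtain y where y: "y \<in> elts a" "d z y < min r 1" using dist_to_lessD by (metis min.cobounded2)
    have "y \<in> mball z r" using y assms(1) elts_M[OF y(1)] by simp
    hence "(y, a) \<in> M \<times> M - E" using r UV(3,4) by blast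
    thus False using y(1) by (simp add: elts_def)
  qed
qed

lemma excess_eq_0_iff: assumes "a \<in> M" "b \<in> M" shows "excess a b = 0 \<longleftrightarrow> a \<sqsubseteq> b"
proof
  assume "excess a b = 0"
  hence "dist_to x b = 0" if "x \<in> elts a" for x using dist_to_le_excess[OF that, of b] dist_to_ge_0[of x b] by linarith
  hence "x \<in> elts b" if "x \<in> elts a" for x using that dist_to_eq_0_iff[OF elts_M[OF that] assms(2)] by simp
  thus "a \<sqsubseteq> b" unfolding subset_rel_def by blast
next
  assume "a \<sqsubseteq> b"
  hence "dist_to x b \<le> 0" if "x \<in> elts a" for x
    using that assms(2) dist_to_eq_0_iff[OF elts_M[OF that] assms(2)] unfolding subset_rel_def by auto
  hence "excess a b \<le> 0" by (auto intro: excess_leI)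
  thus "excess a b = 0" using excess_ge_0[of a b] by simp
qed

lemma excess_refl: "a \<in> M \<Longrightarrow> excess a a = 0"
  by (simp add: excess_eq_0_iff subset_rel_def)

lemma elts_inject: "a \<in> M \<Longrightarrow> b \<in> M \<Longrightarrow> elts a = elts b \<Longrightarrow> a = b"
  using d_eq_excess[of a b] excess_eq_0_iff[of a b] excess_eq_0_iff[of b a] zero[of a b] by (simp add: subset_rel_def)

lemma the_set_eq: "m \<in> M \<Longrightarrow> elts m = A \<Longrightarrow> the_set A = m"
  unfolding the_set_def by (rule the_equality) (auto intro: elts_inject)

end

section \<open>Definable functions\<close>

definition clip :: "real \<Rightarrow> real" where
  "clip v = max 0 (min 1 v)"

lemma clip_01 [simp]: "0 \<le> clip v" "clip v \<le> 1"
  by (auto simp: clip_def)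

text \<open>Formulas vanish where a condition holds, so 0 stands for truth. Then \<open>max\<close>,
\<open>min\<close>, suprema and infima are conjunction, disjunction and the two quantifiers.\<close>
definition truth :: "bool \<Rightarrow> real" where
  "truth Q = (if Q then 0 else 1)"

lemma truth_01 [simp]: "0 \<le> truth Q" "truth Q \<le> 1" "truth True = 0" "truth False = 1"
  by (auto simp: truth_def)

text \<open>Infima of two-valued functions stay two-valued; this is what keeps quantifiers
over arbitrary infinite sets exact.\<close>
lemma binf_truth: "binf A (\<lambda>x. truth (P x)) = truth (\<exists>x\<in>A. P x)"
proof (cases "\<exists>x\<in>A. P x")
  case True
  then obtain x where "x \<in> A" "P x" by blast
  hence "binf A (\<lambda>x. truth (P x)) \<le> 0" using binf_lower[of A "\<lambda>x. truth (P x)" x] by simp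
  moreover have "0 \<le> binf A (\<lambda>x. truth (P x))" by (rule binf_ge_0) simp
  ultimately show ?thesis using True by simp
next
  case False
  hence "1 \<le> binf A (\<lambda>x. truth (P x))" by (intro binf_greatest) (auto simp: truth_def)
  moreover have "binf A (\<lambda>x. truth (P x)) \<le> 1" by (rule binf_le_1) simp
  ultimately show ?thesis using False by simp
qed

lemma fbound_ge_0: "0 \<le> fbound p"
  by (induction p) auto

context mse_model
begin

definition envM :: "(nat \<Rightarrow> 'a) \<Rightarrow> bool" where
  "envM e \<longleftrightarrow> (\<forall>i. e i \<in> M)"

lemma envM_comp [simp]: "envM e \<Longrightarrow> envM (\<lambda>i. e (s i))"
  by (simp add: envM_def)

lemma envM_D [simp]: "envM e \<Longrightarrow> e i \<in> M"
  by (simp add: envM_def)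

lemma envM_upd [simp]: "envM e \<Longrightarrow> x \<in> M \<Longrightarrow> envM (e(z := x))"
  by (simp add: envM_def)

lemma envM_case [simp]: "envM e \<Longrightarrow> x \<in> M \<Longrightarrow> envM (case_nat x e)"
  by (auto simp: envM_def split: nat.split)

text \<open>A semantic stand-in for "given by a formula with parameters", for functions with values in $[0,1]$.
Here \<open>n\<close> bounds the variables on which \<open>F\<close> depends and \<open>K\<close> is the set of parameters. Demanding
a formula for every naming \<open>\<nu>\<close> of the variables and every naming \<open>\<kappa>\<close> of the parameters makes
substitution a matter of composing functions: no renaming of bound variables inside formulas is
ever needed. Quantifier rules follow the de Bruijn convention, the variable bound last being
\<open>e 0\<close>.\<close>
definition definable :: "((nat \<Rightarrow> 'a) \<Rightarrow> real) \<Rightarrow> bool" where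
  "definable F \<longleftrightarrow> (\<forall>e. envM e \<longrightarrow> 0 \<le> F e \<and> F e \<le> 1) \<and>
    (\<exists>n K. finite K \<and> K \<subseteq> M \<and>
       (\<forall>e e'. envM e \<longrightarrow> envM e' \<longrightarrow> (\<forall>i<n. e i = e' i) \<longrightarrow> F e = F e') \<and>
       (\<forall>\<nu> \<kappa>. \<exists>p. \<forall>e. envM e \<longrightarrow> (\<forall>m\<in>K. e (\<kappa> m) = m) \<longrightarrow> F (\<lambda>i. e (\<nu> i)) = fval p e))"

lemma definable_range: "definable F \<Longrightarrow> envM e \<Longrightarrow> 0 \<le> F e \<and> F e \<le> 1"
  by (simp add: definable_def)

lemma definableI:
  assumes "\<And>e. envM e \<Longrightarrow> 0 \<le> F e \<and> F e \<le> 1" and "finite K" "K \<subseteq> M"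
    and "\<And>e e'. envM e \<Longrightarrow> envM e' \<Longrightarrow> (\<And>i. i < n \<Longrightarrow> e i = e' i) \<Longrightarrow> F e = F e'"
    and "\<And>\<nu> \<kappa>. \<exists>p. \<forall>e. envM e \<longrightarrow> (\<forall>m\<in>K. e (\<kappa> m) = m) \<longrightarrow> F (\<lambda>i. e (\<nu> i)) = fval p e"
  shows "definable F"
  unfolding definable_def using assms by (intro conjI exI[of _ n] exI[of _ K]) blast+

lemma definableE:
  assumes "definable F"
  obtains n K where "finite K" "K \<subseteq> M"
    and "\<forall>e e'. envM e \<longrightarrow> envM e' \<longrightarrow> (\<forall>i<n. e i = e' i) \<longrightarrow> F e = F e'"
    and "\<forall>\<nu> \<kappa>. \<exists>p. \<forall>e. envM e \<longrightarrow> (\<forall>m\<in>K. e (\<kappa> m) = m) \<longrightarrow> F (\<lambda>i. e (\<nu> i)) = fval p e"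
  using assms unfolding definable_def by (elim conjE exE) (rule that)

lemma definable_real: "0 \<le> v \<Longrightarrow> v \<le> 1 \<Longrightarrow> definable (\<lambda>e. v)"
  by (rule definableI[of _ "{}" 0]) (auto intro!: exI[of _ "Scale v One"])

lemma definable_dvar: "definable (\<lambda>e. d (e i) (e j))"
proof (rule definableI[of _ "{}" "Suc (max i j)"])
  fix e e' assume "envM e" "envM e'" and eq: "\<And>k. k < Suc (max i j) \<Longrightarrow> e k = e' k"
  show "d (e i) (e j) = d (e' i) (e' j)" by (simp add: eq)
next
  fix \<nu> \<kappa> show "\<exists>p. \<forall>e. envM e \<longrightarrow> (\<forall>m\<in>{}. e (\<kappa> m) = m) \<longrightarrow> d (e (\<nu> i)) (e (\<nu> j)) = fval p e"
    by (auto intro!: exI[of _ "Dist (\<nu> i) (\<nu> j)"])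
qed (auto intro: dist_le_1)

lemma definable_binop:
  assumes F: "definable F" and G: "definable G"
    and op: "\<And>p q. \<exists>r. \<forall>e. fval r e = f (fval p e) (fval q e)"
    and rng: "\<And>x y. 0 \<le> x \<Longrightarrow> x \<le> 1 \<Longrightarrow> 0 \<le> y \<Longrightarrow> y \<le> 1 \<Longrightarrow> 0 \<le> f x y \<and> f x y \<le> 1"
  shows "definable (\<lambda>e. f (F e) (G e))"
proof -
  obtain n K where 1: "finite K" "K \<subseteq> M"
    "\<forall>e e'. envM e \<longrightarrow> envM e' \<longrightarrow> (\<forall>i<n. e i = e' i) \<longrightarrow> F e = F e'"
    "\<forall>\<nu> \<kappa>. \<exists>p. \<forall>e. envM e \<longrightarrow> (\<forall>m\<in>K. e (\<kappa> m) = m) \<longrightarrow> F (\<lambda>i. e (\<nu> i)) = fval p e"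
    by (rule definableE[OF F]) rule
  note 1 = 1(1,2) 1(3)[rule_format] 1(4)[rule_format]
  obtain n' K' where 2: "finite K'" "K' \<subseteq> M"
    "\<forall>e e'. envM e \<longrightarrow> envM e' \<longrightarrow> (\<forall>i<n'. e i = e' i) \<longrightarrow> G e = G e'"
    "\<forall>\<nu> \<kappa>. \<exists>p. \<forall>e. envM e \<longrightarrow> (\<forall>m\<in>K'. e (\<kappa> m) = m) \<longrightarrow> G (\<lambda>i. e (\<nu> i)) = fval p e"
    by (rule definableE[OF G]) rule
  note 2 = 2(1,2) 2(3)[rule_format] 2(4)[rule_format]
  show ?thesis
  proof (rule definableI[of _ "K \<union> K'" "max n n'"])
    fix e assume "envM e"
    thus "0 \<le> f (F e) (G e) \<and> f (F e) (G e) \<le> 1"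
      using definable_range[OF F] definable_range[OF G] by (intro rng) auto
  next
    fix e e' assume e: "envM e" "envM e'" "\<And>i. i < max n n' \<Longrightarrow> e i = e' i"
    have "F e = F e'" using e by (intro 1(3)) auto
    moreover have "G e = G e'" using e by (intro 2(3)) auto
    ultimately show "f (F e) (G e) = f (F e') (G e')" by simp
  next
    fix \<nu> \<kappa>
    obtain p where p: "\<And>e. envM e \<Longrightarrow> (\<forall>m\<in>K. e (\<kappa> m) = m) \<Longrightarrow> F (\<lambda>i. e (\<nu> i)) = fval p e"
      using 1(4)[of \<kappa> \<nu>] by blast
    obtain q where q: "\<And>e. envM e \<Longrightarrow> (\<forall>m\<in>K'. e (\<kappa> m) = m) \<Longrightarrow> G (\<lambda>i. e (\<nu> i)) = fval q e"
      using 2(4)[of \<kappa> \<nu>] by blast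
    obtain r where "\<And>e. fval r e = f (fval p e) (fval q e)" using op by blast
    thus "\<exists>r. \<forall>e. envM e \<longrightarrow> (\<forall>m\<in>K \<union> K'. e (\<kappa> m) = m) \<longrightarrow>
        f (F (\<lambda>i. e (\<nu> i))) (G (\<lambda>i. e (\<nu> i))) = fval r e"
      using p q by (intro exI[of _ r]) auto
  qed (use 1(1,2) 2(1,2) in auto)
qed

lemma definable_max: "definable F \<Longrightarrow> definable G \<Longrightarrow> definable (\<lambda>e. max (F e) (G e))"
  by (rule definable_binop[of _ _ max]) (auto intro: exI[of _ "MaxF p q" for p q])

lemma definable_min: "definable F \<Longrightarrow> definable G \<Longrightarrow> definable (\<lambda>e. min (F e) (G e))"
  by (rule definable_binop[of _ _ min]) (auto intro: exI[of _ "MinF p q" for p q])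

lemma definable_lin: assumes "definable F" "definable G" shows "definable (\<lambda>e. clip (\<alpha> * F e + \<beta> * G e + \<gamma>))"
proof (rule definable_binop[OF assms, of "\<lambda>x y. clip (\<alpha> * x + \<beta> * y + \<gamma>)"])
  fix p q
  show "\<exists>r. \<forall>e. fval r e = clip (\<alpha> * fval p e + \<beta> * fval q e + \<gamma>)"
    by (rule exI[of _ "MaxF (Scale 0 One) (MinF One (Plus (Plus (Scale \<alpha> p) (Scale \<beta> q)) (Scale \<gamma> One)))"])
       (simp add: clip_def)
qed auto

lemma definable_affine: assumes "definable F" shows "definable (\<lambda>e. clip (\<alpha> * F e + \<gamma>))"
  using definable_lin[OF assms assms, of \<alpha> 0 \<gamma>] by simp

lemma definable_cong:
  assumes "definable F" "\<And>e. envM e \<Longrightarrow> G e = F e" shows "definable G"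
proof -
  obtain n K where 1: "finite K" "K \<subseteq> M"
    "\<forall>e e'. envM e \<longrightarrow> envM e' \<longrightarrow> (\<forall>i<n. e i = e' i) \<longrightarrow> F e = F e'"
    "\<forall>\<nu> \<kappa>. \<exists>p. \<forall>e. envM e \<longrightarrow> (\<forall>m\<in>K. e (\<kappa> m) = m) \<longrightarrow> F (\<lambda>i. e (\<nu> i)) = fval p e"
    by (rule definableE[OF assms(1)]) rule
  note 1 = 1(1,2) 1(3)[rule_format] 1(4)[rule_format]
  show ?thesis
  proof (rule definableI[of _ K n])
    fix e assume "envM e"
    thus "0 \<le> G e \<and> G e \<le> 1" using definable_range[OF assms(1)] by (simp add: assms(2))
  next
    fix e e' assume e: "envM e" "envM e'" "\<And>i. i < n \<Longrightarrow> e i = e' i"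
    have "F e = F e'" by (rule 1(3)) (use e in auto)
    thus "G e = G e'" using e by (simp add: assms(2))
  next
    fix \<nu> \<kappa>
    obtain p where "\<And>e. envM e \<Longrightarrow> (\<forall>m\<in>K. e (\<kappa> m) = m) \<Longrightarrow> F (\<lambda>i. e (\<nu> i)) = fval p e"
      using 1(4)[of \<kappa> \<nu>] by blast
    thus "\<exists>p. \<forall>e. envM e \<longrightarrow> (\<forall>m\<in>K. e (\<kappa> m) = m) \<longrightarrow> G (\<lambda>i. e (\<nu> i)) = fval p e"
      by (intro exI[of _ p]) (simp add: assms(2))
  qed (use 1(1,2) in auto)
qed

lemma definable_compl: "definable F \<Longrightarrow> definable (\<lambda>e. 1 - F e)"
  by (rule definable_cong[OF definable_affine[of F "-1" 1]]) (auto simp: clip_def dest: definable_range)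

text \<open>The terms that may be substituted into a formula: a variable or a parameter.\<close>
definition simple :: "((nat \<Rightarrow> 'a) \<Rightarrow> 'a) \<Rightarrow> bool" where
  "simple t \<longleftrightarrow> (\<exists>i. t = (\<lambda>e. e i)) \<or> (\<exists>c\<in>M. t = (\<lambda>e. c))"

lemma simple_var [intro]: "simple (\<lambda>e. e i)" and simple_const [intro]: "c \<in> M \<Longrightarrow> simple (\<lambda>e. c)"
  by (auto simp: simple_def)

lemma simple_shift: "simple t \<Longrightarrow> simple (\<lambda>e. t (\<lambda>i. e (Suc i)))"
  by (auto simp: simple_def)

lemma simple_M: "simple t \<Longrightarrow> envM e \<Longrightarrow> t e \<in> M"
  by (auto simp: simple_def)

text \<open>A parameter is replaced by its name under \<open>\<kappa>\<close>, a variable by its name under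
\<open>\<nu>\<close>; the quantification over all namings in the definition absorbs both.\<close>
lemma definable_subst:
  assumes F: "definable F" and T: "\<And>i. simple (T i)"
  shows "definable (\<lambda>e. F (\<lambda>i. T i e))"
proof -
  obtain n K where 1: "finite K" "K \<subseteq> M"
    "\<forall>e e'. envM e \<longrightarrow> envM e' \<longrightarrow> (\<forall>i<n. e i = e' i) \<longrightarrow> F e = F e'"
    "\<forall>(\<nu>::nat\<Rightarrow>nat) \<kappa>. \<exists>p. \<forall>e. envM e \<longrightarrow> (\<forall>m\<in>K. e (\<kappa> m) = m) \<longrightarrow> F (\<lambda>i. e (\<nu> i)) = fval p e"
    by (rule definableE[OF F]) rule
  have "\<exists>j c. (T i = (\<lambda>e. e j)) \<or> c \<in> M \<and> T i = (\<lambda>e. c)" for i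
    using T[of i] unfolding simple_def by blast
  then obtain j c where jc: "\<And>i. (T i = (\<lambda>e. e (j i))) \<or> c i \<in> M \<and> T i = (\<lambda>e. c i)" by metis
  define V where "V = {i. T i = (\<lambda>e. e (j i))}"
  have TV: "T i e = e (j i)" if "i \<in> V" for i e using that by (simp add: V_def)
  have TC: "c i \<in> M" "T i e = c i" if "i \<notin> V" for i e using that jc[of i] by (auto simp: V_def)
  obtain N where N: "\<And>i. i < n \<Longrightarrow> j i < N"
    using finite_nat_set_iff_bounded[of "j ` {..<n}"] by auto
  have TM: "envM (\<lambda>i. T i e)" if "envM e" for e using simple_M[OF T that] by (simp add: envM_def)
  show ?thesis
  proof (rule definableI[of _ "K \<union> c ` ({..<n} - V)" N])
    fix e assume "envM e"
    thus "0 \<le> F (\<lambda>i. T i e) \<and> F (\<lambda>i. T i e) \<le> 1" using definable_range[OF F] TM by blast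
  next
    fix e e' assume e: "envM e" "envM e'" "\<And>i. i < N \<Longrightarrow> e i = e' i"
    have "T i e = T i e'" if "i < n" for i
      using N[OF that] e(3) TV[of i e] TV[of i e'] TC(2)[of i e] TC(2)[of i e'] by (cases "i \<in> V") auto
    thus "F (\<lambda>i. T i e) = F (\<lambda>i. T i e')" using 1(3) TM e by blast
  next
    fix \<nu> :: "nat \<Rightarrow> nat" and \<kappa> :: "'a \<Rightarrow> nat"
    define \<mu> where "\<mu> i = (if i \<in> V then \<nu> (j i) else \<kappa> (c i))" for i
    obtain p where p: "\<And>e. envM e \<Longrightarrow> (\<forall>m\<in>K. e (\<kappa> m) = m) \<Longrightarrow> F (\<lambda>i. e (\<mu> i)) = fval p e"
      using 1(4) by blast
    show "\<exists>p. \<forall>e. envM e \<longrightarrow> (\<forall>m\<in>K \<union> c ` ({..<n} - V). e (\<kappa> m) = m) \<longrightarrow>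
        F (\<lambda>i. T i (\<lambda>k. e (\<nu> k))) = fval p e"
    proof (intro exI[of _ p] allI impI)
      fix e assume e: "envM e" "\<forall>m\<in>K \<union> c ` ({..<n} - V). e (\<kappa> m) = m"
      have "T i (\<lambda>k. e (\<nu> k)) = e (\<mu> i)" if "i < n" for i
        using that e(2) TV[of i] TC(2)[of i] by (cases "i \<in> V") (auto simp: \<mu>_def)
      hence "F (\<lambda>i. T i (\<lambda>k. e (\<nu> k))) = F (\<lambda>i. e (\<mu> i))" using 1(3) TM e(1) envM_comp by blast
      also have "\<dots> = fval p e" using p e by blast
      finally show "F (\<lambda>i. T i (\<lambda>k. e (\<nu> k))) = fval p e" .
    qed
  qed (use 1(1,2) TC(1) in auto)
qed

lemma definable_reindex: "definable F \<Longrightarrow> definable (\<lambda>e. F (\<lambda>i. e (\<sigma> i)))"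
  using definable_subst[of F "\<lambda>i e. e (\<sigma> i)"] by (simp add: simple_var)

lemma definable_simple:
  assumes "definable (\<lambda>e. F (\<lambda>i. e (Suc i)) (e 0))" "simple t" shows "definable (\<lambda>e. F e (t e))"
proof -
  have "simple (case_nat t (\<lambda>i e. e i) i)" for i using assms(2) by (cases i) (auto intro: simple_var)
  from definable_subst[OF assms(1), of "case_nat t (\<lambda>i e. e i)", OF this] show ?thesis by simp
qed

text \<open>Finite support leaves a name \<open>z\<close> that clashes neither with the relevant variables
nor with the parameters, and this \<open>z\<close> can serve as the bound variable of a quantifier.\<close>
lemma definable_binder:
  assumes "definable (\<lambda>e. F (\<lambda>i. e (Suc i)) (e 0))"
  obtains n K where "finite K" "K \<subseteq> M"
    and "\<forall>e e' x. envM e \<longrightarrow> envM e' \<longrightarrow> x \<in> M \<longrightarrow> (\<forall>i<n. e i = e' i) \<longrightarrow> F e x = F e' x"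
    and "\<forall>e x. envM e \<longrightarrow> x \<in> M \<longrightarrow> 0 \<le> F e x \<and> F e x \<le> 1"
    and "\<forall>\<nu> \<kappa>. \<exists>p z. \<forall>e. envM e \<longrightarrow> (\<forall>m\<in>K. e (\<kappa> m) = m) \<longrightarrow> (\<forall>x\<in>M. F (\<lambda>i. e (\<nu> i)) x = fval p (e(z := x)))"
proof -
  let ?F = "\<lambda>e. F (\<lambda>i. e (Suc i)) (e 0)"
  obtain n K where 1: "finite K" "K \<subseteq> M"
    "\<forall>e e'. envM e \<longrightarrow> envM e' \<longrightarrow> (\<forall>i<n. e i = e' i) \<longrightarrow> ?F e = ?F e'"
    "\<forall>\<nu> \<kappa>. \<exists>p. \<forall>e. envM e \<longrightarrow> (\<forall>m\<in>K. e (\<kappa> m) = m) \<longrightarrow> ?F (\<lambda>i. e (\<nu> i)) = fval p e"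
    by (rule definableE[OF assms(1)]) rule
  note 1 = 1(1,2) 1(3)[rule_format] 1(4)[rule_format]
  have supp: "F e x = F e' x" if "envM e" "envM e'" "x \<in> M" "\<And>i. i < n \<Longrightarrow> e i = e' i" for e e' x
  proof -
    have "?F (case_nat x e) = ?F (case_nat x e')"
      by (rule 1(3)) (use that in \<open>auto split: nat.split\<close>)
    thus ?thesis by simp
  qed
  show thesis
  proof (rule that[of K n]; (intro allI)?)
    fix \<nu> :: "nat \<Rightarrow> nat" and \<kappa> :: "'a \<Rightarrow> nat"
    have fin: "finite (\<nu> ` {..<n} \<union> \<kappa> ` K)" using 1(1) by simp
    obtain z where z: "z \<notin> \<nu> ` {..<n} \<union> \<kappa> ` K"
      using ex_new_if_finite[OF infinite_UNIV_nat fin] by (elim exE) rule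
    obtain p where p: "\<And>e. envM e \<Longrightarrow> (\<forall>m\<in>K. e (\<kappa> m) = m) \<Longrightarrow>
        ?F (\<lambda>i. e (case_nat z \<nu> i)) = fval p e"
      using 1(4)[of \<kappa> "case_nat z \<nu>"] by blast
    show "\<exists>p z. \<forall>e. envM e \<longrightarrow> (\<forall>m\<in>K. e (\<kappa> m) = m) \<longrightarrow>
            (\<forall>x\<in>M. F (\<lambda>i. e (\<nu> i)) x = fval p (e(z := x)))"
    proof (intro exI allI impI ballI)
      fix e x assume e: "envM e" "\<forall>m\<in>K. e (\<kappa> m) = m" "x \<in> M"
      have k: "\<forall>m\<in>K. (e(z := x)) (\<kappa> m) = m" using e z by auto
      have "fval p (e(z := x)) = F (\<lambda>i. (e(z := x)) (\<nu> i)) x"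
        using p[of "e(z := x)", OF envM_upd[OF e(1,3)] k] by simp
      also have "\<dots> = F (\<lambda>i. e (\<nu> i)) x"
      proof (rule supp)
        show "envM (\<lambda>i. (e(z := x)) (\<nu> i))" using envM_comp[OF envM_upd[OF e(1,3)]] .
        show "(e(z := x)) (\<nu> i) = e (\<nu> i)" if "i < n" for i using z that by auto
      qed (use e in auto)
      finally show "F (\<lambda>i. e (\<nu> i)) x = fval p (e(z := x))" by simp
    qed
  next
    fix e x
    show "envM e \<longrightarrow> x \<in> M \<longrightarrow> 0 \<le> F e x \<and> F e x \<le> 1"
      using definable_range[OF assms, of "case_nat x e"] by simp
  next
    fix e e' x
    show "envM e \<longrightarrow> envM e' \<longrightarrow> x \<in> M \<longrightarrow> (\<forall>i<n. e i = e' i) \<longrightarrow> F e x = F e' x"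
      using supp[of e e' x] by simp
  qed (use 1(1,2) in auto)
qed

lemma definable_binder_range:
  assumes "definable (\<lambda>e. F (\<lambda>i. e (Suc i)) (e 0))" "envM e" "x \<in> M"
  shows "0 \<le> F e x \<and> F e x \<le> 1"
  using definable_range[OF assms(1), of "case_nat x e"] assms(2,3) by simp

lemma definable_bsup_var:
  assumes "definable (\<lambda>e. F (\<lambda>i. e (Suc i)) (e 0))" shows "definable (\<lambda>e. bsup (elts (e j)) (F e))"
proof -
  obtain n K where 1: "finite K" "K \<subseteq> M"
    "\<forall>e e' x. envM e \<longrightarrow> envM e' \<longrightarrow> x \<in> M \<longrightarrow> (\<forall>i<n. e i = e' i) \<longrightarrow> F e x = F e' x"
    "\<forall>e x. envM e \<longrightarrow> x \<in> M \<longrightarrow> 0 \<le> F e x \<and> F e x \<le> 1"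
    "\<forall>\<nu> \<kappa>. \<exists>p z. \<forall>e. envM e \<longrightarrow> (\<forall>m\<in>K. e (\<kappa> m) = m) \<longrightarrow> (\<forall>x\<in>M. F (\<lambda>i. e (\<nu> i)) x = fval p (e(z := x)))"
    by (rule definable_binder[OF assms]) rule
  note 1 = 1(1,2) 1(3)[rule_format] 1(4)[rule_format] 1(5)[rule_format]
  show ?thesis
  proof (rule definableI[of _ K "max n (Suc j)"])
    fix \<nu> \<kappa>
    obtain p z where p: "\<And>e x. envM e \<Longrightarrow> (\<forall>m\<in>K. e (\<kappa> m) = m) \<Longrightarrow> x \<in> M \<Longrightarrow>
         F (\<lambda>i. e (\<nu> i)) x = fval p (e(z := x))" using 1(5)[of \<kappa> \<nu>] by blast
    \<comment> \<open>truncation below at 0 turns the value \<open>- fbound p\<close> over an empty set into 0\<close>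
    let ?p = "MaxF (Scale 0 One) (BSup z (\<nu> j) p)"
    show "\<exists>p. \<forall>e. envM e \<longrightarrow> (\<forall>m\<in>K. e (\<kappa> m) = m) \<longrightarrow> bsup (elts (e (\<nu> j))) (F (\<lambda>i. e (\<nu> i))) = fval p e"
    proof (intro exI[of _ ?p] allI impI)
      fix e assume e: "envM e" "\<forall>m\<in>K. e (\<kappa> m) = m"
      show "bsup (elts (e (\<nu> j))) (F (\<lambda>i. e (\<nu> i))) = fval ?p e"
      proof (cases "elts (e (\<nu> j)) = {}")
        case True thus ?thesis using fbound_ge_0[of p] by simp
      next
        case False
        have "bsup (elts (e (\<nu> j))) (F (\<lambda>i. e (\<nu> i))) = (SUP x\<in>elts (e (\<nu> j)). F (\<lambda>i. e (\<nu> i)) x)"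
          by (rule bsup_eq_SUP) (use False 1(4) e elts_M in auto)
        also have "\<dots> = (SUP x\<in>elts (e (\<nu> j)). fval p (e(z := x)))" 
          using p[OF e] elts_M by (intro SUP_cong) auto
        finally have eq: "bsup (elts (e (\<nu> j))) (F (\<lambda>i. e (\<nu> i))) = (SUP x\<in>elts (e (\<nu> j)). fval p (e(z := x)))" .
        have "0 \<le> bsup (elts (e (\<nu> j))) (F (\<lambda>i. e (\<nu> i)))"
          by (rule bsup_ge_0) (use 1(4) e elts_M in auto)
        thus ?thesis using False by (simp add: eq)
      qed
    qed
  next
    fix e e' assume e: "envM e" "envM e'" "\<And>i. i < max n (Suc j) \<Longrightarrow> e i = e' i"
    show "bsup (elts (e j)) (F e) = bsup (elts (e' j)) (F e')"
      using e elts_M by (auto intro!: bsup_cong 1(3))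
  next
    fix e assume "envM e"
    thus "0 \<le> bsup (elts (e j)) (F e) \<and> bsup (elts (e j)) (F e) \<le> 1"
      using 1(4) elts_M by (auto intro!: bsup_ge_0 bsup_le_1)
  qed (use 1(1,2) in auto)
qed

lemma definable_binf_var:
  assumes "definable (\<lambda>e. F (\<lambda>i. e (Suc i)) (e 0))" shows "definable (\<lambda>e. binf (elts (e j)) (F e))"
proof (rule definable_cong[OF definable_compl[OF definable_bsup_var[OF definable_compl[OF assms]]]])
  fix e assume "envM e"
  thus "binf (elts (e j)) (F e) = 1 - bsup (elts (e j)) (\<lambda>x. 1 - F e x)"
    using definable_binder_range[OF assms] elts_M by (intro binf_eq_compl) blast
qed

lemma definable_d: assumes "simple s" "simple t" shows "definable (\<lambda>e. d (s e) (t e))"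
  by (rule definable_simple[OF _ assms(2), of "\<lambda>e. d (s e)"],
      rule definable_simple[OF _ simple_shift[OF assms(1)], of "\<lambda>e y. d y (e 0)"], rule definable_dvar)

lemma definable_bsup:
  assumes "definable (\<lambda>e. F (\<lambda>i. e (Suc i)) (e 0))" "simple t" shows "definable (\<lambda>e. bsup (elts (t e)) (F e))"
  by (rule definable_simple[OF _ assms(2), of "\<lambda>e y. bsup (elts y) (F e)"], rule definable_bsup_var,
      rule definable_reindex[OF assms(1), of "\<lambda>i. case i of 0 \<Rightarrow> 0 | Suc k \<Rightarrow> Suc (Suc k)", simplified])

lemma definable_binf:
  assumes "definable (\<lambda>e. F (\<lambda>i. e (Suc i)) (e 0))" "simple t" shows "definable (\<lambda>e. binf (elts (t e)) (F e))"
  by (rule definable_simple[OF _ assms(2), of "\<lambda>e y. binf (elts y) (F e)"], rule definable_binf_var,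
      rule definable_reindex[OF assms(1), of "\<lambda>i. case i of 0 \<Rightarrow> 0 | Suc k \<Rightarrow> Suc (Suc k)", simplified])

lemma definable_dist_to: assumes "simple s" "simple t" shows "definable (\<lambda>e. dist_to (s e) (t e))"
  unfolding dist_to_def by (intro definable_binf definable_d simple_shift assms simple_var)

lemma definable_excess: assumes "simple s" "simple t" shows "definable (\<lambda>e. excess (s e) (t e))"
  unfolding excess_def by (intro definable_bsup definable_dist_to simple_shift assms simple_var)

text \<open>The defining formula is used with variable 0 for the argument and with
pairwise distinct nonzero names for the finitely many parameters.\<close>
lemma excision_definable:
  assumes F: "definable (\<lambda>e. F (e 0))" and "r < s"
  shows "\<exists>b\<in>M. \<forall>c\<in>M. (F c \<le> r \<longrightarrow> c \<in> elts b) \<and> (c \<in> elts b \<longrightarrow> F c < s)"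
proof -
  obtain n K where 1: "finite K" "K \<subseteq> M"
    "\<forall>e e'. envM e \<longrightarrow> envM e' \<longrightarrow> (\<forall>i<(n::nat). e i = e' i) \<longrightarrow> F (e 0) = F (e' 0)"
    "\<forall>(\<nu>::nat \<Rightarrow> nat) \<kappa>. \<exists>p. \<forall>e. envM e \<longrightarrow> (\<forall>m\<in>K. e (\<kappa> m) = m) \<longrightarrow> F (e (\<nu> 0)) = fval p e"
    by (rule definableE[OF F]) rule
  note 1 = 1(1,2) 1(4)[rule_format]
  obtain f :: "'a \<Rightarrow> nat" where f: "inj_on f K" using finite_imp_inj_to_nat_seg[OF 1(1)] by auto
  define \<kappa> where "\<kappa> m = Suc (f m)" for m
  have inj: "inj_on \<kappa> K" using f by (simp add: \<kappa>_def inj_on_def)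
  obtain m0 where m0: "m0 \<in> M" using nonempty by blast
  define e where "e i = (if i \<in> \<kappa> ` K then inv_into K \<kappa> i else m0)" for i
  have e: "e i \<in> M" for i using 1(2) m0 inv_into_into[of i \<kappa> K] by (auto simp: e_def)
  have ek: "e (\<kappa> m) = m" if "m \<in> K" for m using that inj by (simp add: e_def inv_into_f_f)
  obtain p where p: "\<And>e. envM e \<Longrightarrow> (\<forall>m\<in>K. e (\<kappa> m) = m) \<Longrightarrow> F (e 0) = fval p e"
    using 1(3)[of \<kappa> "\<lambda>_. 0"] by blast
  have "F c = fval p (e(0 := c))" if "c \<in> M" for c
    using p[of "e(0 := c)"] that e ek by (auto simp: envM_def \<kappa>_def)
  thus ?thesis using excision[of e r s p 0, OF e assms(2)] by auto
qed

text \<open>Makes unrestricted quantifiers a special case of bounded ones.\<close>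
lemma universal_set: "\<exists>v\<in>M. elts v = M"
  using excision_definable[of "\<lambda>_. 0" 0 1, OF definable_real] elts_M by auto

lemma definable_bsup_M:
  assumes "definable (\<lambda>e. F (\<lambda>i. e (Suc i)) (e 0))" shows "definable (\<lambda>e. bsup M (F e))"
proof -
  obtain v where v: "v \<in> M" "elts v = M" using universal_set by blast
  show ?thesis using definable_bsup[OF assms simple_const[OF v(1)]] by (simp add: v(2))
qed

lemma definable_binf_M:
  assumes "definable (\<lambda>e. F (\<lambda>i. e (Suc i)) (e 0))" shows "definable (\<lambda>e. binf M (F e))"
proof -
  obtain v where v: "v \<in> M" "elts v = M" using universal_set by blast
  show ?thesis using definable_binf[OF assms simple_const[OF v(1)]] by (simp add: v(2))
qed

section \<open>Comprehension for distance functions\<close>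

text \<open>Excision only yields a set sandwiched between \<open>F \<le> 0\<close> and \<open>F < s\<close>. If \<open>F\<close> is the distance to a
class \<open>A\<close>, then this set is within Hausdorff distance \<open>s\<close> of \<open>A\<close>; so these sets form a Cauchy
sequence as \<open>s\<close> tends to 0, and completeness provides a limit, whose elements are the closure
of \<open>A\<close>. All exact constructions below are instances.\<close>
lemma exact_comprehension:
  assumes F: "definable (\<lambda>e. F (e 0))" and A: "A \<subseteq> M" and FA: "\<And>z. z \<in> M \<Longrightarrow> F z = binf A (d z)"
  shows "\<exists>m\<in>M. \<forall>z\<in>M. dist_to z m = F z"
proof -
  define s :: "nat \<Rightarrow> real" where "s n = inverse (Suc n)" for n
  have s0: "0 < s n" for n by (simp add: s_def)
  have "\<exists>b\<in>M. \<forall>c\<in>M. (F c \<le> 0 \<longrightarrow> c \<in> elts b) \<and> (c \<in> elts b \<longrightarrow> F c < s n)" for n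
    by (rule excision_definable[OF F s0])
  then obtain b where b: "\<And>n. b n \<in> M" "\<And>n c. c \<in> M \<Longrightarrow> F c \<le> 0 \<Longrightarrow> c \<in> elts (b n)"
    "\<And>n c. c \<in> elts (b n) \<Longrightarrow> F c < s n" using elts_M by metis
  have FA0: "F a \<le> 0" if "a \<in> A" for a
    using binf_lower[of A "d a" a] that A FA[of a] by auto
  have up: "dist_to z (b n) \<le> F z" if "z \<in> M" for z n
    unfolding FA[OF that] using A FA0 b(2) by (auto intro!: binf_greatest dist_to_le dist_to_le_1)
  have lip: "F z \<le> d z y + F y" if "z \<in> M" "y \<in> M" for z y
  proof -
    have "F z - d z y \<le> binf A (d y)"
    proof (rule binf_greatest)
      fix a assume a: "a \<in> A"
      have "F z \<le> d z a" using binf_lower[of A "d z" a] a FA[OF that(1)] by simp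
      thus "F z - d z y \<le> d y a" using triangle[of z y a] that a A by force
    next
      have "F z \<le> 1" using FA[OF that(1)] binf_le_1[of A "d z"] by simp
      thus "F z - d z y \<le> 1" using nonneg[of z y] by linarith
    qed
    thus ?thesis using FA[OF that(2)] by simp
  qed
  have lo: "F z - s n \<le> dist_to z (b n)" if "z \<in> M" for z n
  proof (rule dist_to_geI)
    fix y assume "y \<in> elts (b n)"
    thus "F z - s n \<le> d z y" using lip[of z y] that b(3)[of y n] elts_M by fastforce
  next
    have "F z \<le> 1" using FA[OF that] binf_le_1[of A "d z"] by simp
    thus "F z - s n \<le> 1" using s0[of n] by linarith
  qed
  have ex: "excess (b n) (b m) \<le> s n" for n m
  proof (rule excess_leI)
    fix x assume "x \<in> elts (b n)"
    thus "dist_to x (b m) \<le> s n" using up[of x m] b(3)[of x n] elts_M by fastforce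
  qed (use s0[of n] in simp)
  have s_anti: "s m \<le> s n" if "n \<le> m" for m n using that by (simp add: s_def field_simps)
  have lim0: "\<exists>N. \<forall>n\<ge>N. s n < \<epsilon>" if "\<epsilon> > 0" for \<epsilon>
    using reals_Archimedean[OF that] s_anti unfolding s_def by (meson order.strict_trans1)
  have "MCauchy b"
    unfolding MCauchy_def
  proof (intro conjI allI impI)
    fix \<epsilon> :: real assume "\<epsilon> > 0"
    then obtain N where N: "\<And>n. n \<ge> N \<Longrightarrow> s n < \<epsilon>" using lim0 by blast
    have "d (b n) (b n') < \<epsilon>" if "N \<le> n" "N \<le> n'" for n n'
      using ex[of n n'] ex[of n' n] N[of n] N[of n'] that by (simp add: d_eq_excess b(1))
    thus "\<exists>N. \<forall>n n'. N \<le> n \<longrightarrow> N \<le> n' \<longrightarrow> d (b n) (b n') < \<epsilon>" by blast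
  qed (use b(1) in auto)
  then obtain m where m: "limitin mtopology b m sequentially" using complete unfolding mcomplete_def by blast
  hence mM: "m \<in> M" and ml: "\<And>\<epsilon>. \<epsilon> > 0 \<Longrightarrow> \<exists>N. \<forall>n\<ge>N. b n \<in> M \<and> d (b n) m < \<epsilon>"
    unfolding limitin_metric eventually_sequentially by auto
  have "dist_to z m = F z" if z: "z \<in> M" for z
  proof -
    have "\<bar>dist_to z m - F z\<bar> \<le> \<epsilon>" if "\<epsilon> > 0" for \<epsilon>
    proof -
      have h: "\<epsilon>/2 > 0" using that by simp
      obtain N1 where N1: "\<And>n. n \<ge> N1 \<Longrightarrow> s n < \<epsilon>/2" using lim0[OF h] by blast
      obtain N2 where N2: "\<And>n. n \<ge> N2 \<Longrightarrow> d (b n) m < \<epsilon>/2" using ml[OF h] by blast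
      define n where "n = max N1 N2"
      have n: "s n < \<epsilon>/2" "d (b n) m < \<epsilon>/2" using N1[of n] N2[of n] by (auto simp: n_def)
      have "dist_to z m \<le> dist_to z (b n) + d (b n) m"
        using dist_to_excess[OF z, of m "b n"] excess_le_d[OF b(1) mM, of n] by linarith
      moreover have "dist_to z (b n) \<le> dist_to z m + d (b n) m"
        using dist_to_excess[OF z, of "b n" m] excess_le_d[OF mM b(1), of n] commute[of m "b n"] by linarith
      ultimately show ?thesis using up[OF z, of n] lo[OF z, of n] n by linarith
    qed
    hence "\<bar>dist_to z m - F z\<bar> \<le> 0" by (rule dense_ge)
    thus ?thesis by simp
  qed
  thus ?thesis using mM by blast
qed

end

section \<open>Sharp conditions\<close>

lemma truth_conj: "max (truth P) (truth Q) = truth (P \<and> Q)"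
  and truth_disj: "min (truth P) (truth Q) = truth (P \<or> Q)"
  and truth_not: "1 - truth P = truth (\<not> P)"
  by (auto simp: truth_def)

lemma case_nat_eta: "case_nat (e 0) (\<lambda>i. e (Suc i)) = e"
  by (rule ext) (simp split: nat.split)

lemma binf_filter:
  assumes "\<And>x. x \<in> B \<Longrightarrow> 0 \<le> f x \<and> f x \<le> 1"
  shows "binf {x \<in> B. P x} f = binf B (\<lambda>x. max (truth (P x)) (f x))" (is "?l = ?r")
proof (rule antisym)
  have l1: "?l \<le> 1" by (rule binf_le_1) (use assms in auto)
  show "?l \<le> ?r"
  proof (rule binf_greatest)
    fix x assume x: "x \<in> B"
    show "?l \<le> max (truth (P x)) (f x)"
    proof (cases "P x")
      case True
      have "?l \<le> f x" by (rule binf_lower) (use assms x True in auto)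
      thus ?thesis by simp
    next
      case False thus ?thesis using l1 by (simp add: truth_def)
    qed
  qed (rule l1)
  have r0: "0 \<le> max (truth (P x)) (f x)" for x by (simp add: le_max_iff_disj)
  show "?r \<le> ?l"
  proof (rule binf_greatest)
    fix x assume x: "x \<in> {x \<in> B. P x}"
    have "?r \<le> max (truth (P x)) (f x)" by (rule binf_lower) (use x r0 in auto)
    thus "?r \<le> f x" using x assms by auto
  qed (rule binf_le_1, rule r0)
qed

lemma bsup_filter:
  assumes "\<And>x. x \<in> B \<Longrightarrow> 0 \<le> f x \<and> f x \<le> 1"
  shows "bsup {x \<in> B. P x} f = bsup B (\<lambda>x. min (1 - truth (P x)) (f x))" (is "?l = ?r")
proof (rule antisym)
  have l0: "0 \<le> ?l" by (rule bsup_ge_0) (use assms in auto)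
  have r1: "min (1 - truth (P x)) (f x) \<le> 1" for x by (simp add: min_le_iff_disj)
  show "?r \<le> ?l"
  proof (rule bsup_least)
    fix x assume x: "x \<in> B"
    show "min (1 - truth (P x)) (f x) \<le> ?l"
    proof (cases "P x")
      case True
      have "f x \<le> ?l" by (rule bsup_upper) (use assms x True in auto)
      thus ?thesis by simp
    next
      case False thus ?thesis using l0 by (simp add: truth_def)
    qed
  qed (rule l0)
  show "?l \<le> ?r"
  proof (rule bsup_least)
    fix x assume x: "x \<in> {x \<in> B. P x}"
    have "min (1 - truth (P x)) (f x) \<le> ?r" by (rule bsup_upper) (use x r1 in auto)
    thus "f x \<le> ?r" using x assms by auto
  qed (rule bsup_ge_0, rule r1)
qed

context mse_model
begin

text \<open>\<open>sharp D Q\<close>: on the environments in \<open>D\<close>, some definable function takes only the values 0 and 1 and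
is the truth value of \<open>Q\<close>. Such conditions are closed under first-order logic with quantifiers over
sets, and they may be used for comprehension as in classical set theory.\<close>
definition sharp :: "((nat \<Rightarrow> 'a) \<Rightarrow> bool) \<Rightarrow> ((nat \<Rightarrow> 'a) \<Rightarrow> bool) \<Rightarrow> bool" where
  "sharp D Q \<longleftrightarrow> (\<exists>F. definable F \<and> (\<forall>e. envM e \<longrightarrow> D e \<longrightarrow> F e = truth (Q e)))"

lemma sharpI: "definable F \<Longrightarrow> (\<And>e. envM e \<Longrightarrow> D e \<Longrightarrow> F e = truth (Q e)) \<Longrightarrow> sharp D Q"
  unfolding sharp_def by blast

lemma sharp_triv: "(\<And>e. envM e \<Longrightarrow> D e \<Longrightarrow> Q e) \<Longrightarrow> sharp D Q"
  by (rule sharpI[OF definable_real[of 0]]) auto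

text \<open>A gap between the values where \<open>Q\<close> holds and where it fails can be stretched to
the gap between 0 and 1.\<close>
lemma sharp_thresh:
  assumes F: "definable F" and ab: "a < b"
    and Q: "\<And>e. envM e \<Longrightarrow> D e \<Longrightarrow> Q e \<Longrightarrow> F e \<le> a"
    and nQ: "\<And>e. envM e \<Longrightarrow> D e \<Longrightarrow> \<not> Q e \<Longrightarrow> b \<le> F e"
  shows "sharp D Q"
proof (rule sharpI[OF definable_affine[OF F, of "1 / (b - a)" "- a / (b - a)"]])
  fix e assume e: "envM e" "D e"
  have eq: "1 / (b - a) * F e + - a / (b - a) = (F e - a) / (b - a)" by (simp add: diff_divide_distrib)
  show "clip (1 / (b - a) * F e + - a / (b - a)) = truth (Q e)"
  proof (cases "Q e")
    case True
    hence "(F e - a) / (b - a) \<le> 0" using Q[OF e] ab by (simp add: field_simps)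
    thus ?thesis using True unfolding eq by (simp add: clip_def)
  next
    case False
    hence "1 \<le> (F e - a) / (b - a)" using nQ[OF e] ab by (simp add: field_simps)
    thus ?thesis using False unfolding eq by (simp add: clip_def)
  qed
qed

lemma sharp_conj: assumes "sharp D P" "sharp D Q" shows "sharp D (\<lambda>e. P e \<and> Q e)"
proof -
  obtain F where F: "definable F" "\<And>e. envM e \<Longrightarrow> D e \<Longrightarrow> F e = truth (P e)" using assms(1) unfolding sharp_def by blast
  obtain G where G: "definable G" "\<And>e. envM e \<Longrightarrow> D e \<Longrightarrow> G e = truth (Q e)" using assms(2) unfolding sharp_def by blast
  show ?thesis by (rule sharpI[OF definable_max[OF F(1) G(1)]]) (simp add: F G truth_conj)
qed

lemma sharp_not: assumes "sharp D P" shows "sharp D (\<lambda>e. \<not> P e)"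
proof -
  obtain F where F: "definable F" "\<And>e. envM e \<Longrightarrow> D e \<Longrightarrow> F e = truth (P e)" using assms(1) unfolding sharp_def by blast
  show ?thesis by (rule sharpI[OF definable_compl[OF F(1)]]) (simp add: F truth_not)
qed

lemma sharp_disj: assumes "sharp D P" "sharp D Q" shows "sharp D (\<lambda>e. P e \<or> Q e)"
  using sharp_not[OF sharp_conj[OF sharp_not[OF assms(1)] sharp_not[OF assms(2)]]] by simp

lemma sharp_imp: assumes "sharp D P" "sharp D Q" shows "sharp D (\<lambda>e. P e \<longrightarrow> Q e)"
  using sharp_disj[OF sharp_not[OF assms(1)] assms(2)] by simp

lemma sharp_iff: assumes "sharp D P" "sharp D Q" shows "sharp D (\<lambda>e. P e \<longleftrightarrow> Q e)"
  unfolding iff_conv_conj_imp by (rule sharp_conj[OF sharp_imp[OF assms] sharp_imp[OF assms(2,1)]])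

lemma sharp_bex:
  assumes "sharp (\<lambda>e. D (\<lambda>i. e (Suc i)) \<and> e 0 \<in> elts (t (\<lambda>i. e (Suc i)))) (\<lambda>e. Q (\<lambda>i. e (Suc i)) (e 0))"
    and "simple t"
  shows "sharp D (\<lambda>e. \<exists>x\<in>elts (t e). Q e x)"
proof -
  obtain F where F: "definable F"
    "\<And>e. envM e \<Longrightarrow> D (\<lambda>i. e (Suc i)) \<and> e 0 \<in> elts (t (\<lambda>i. e (Suc i))) \<Longrightarrow> F e = truth (Q (\<lambda>i. e (Suc i)) (e 0))"
    using assms(1) unfolding sharp_def by blast
  have "definable (\<lambda>e. binf (elts (t e)) (\<lambda>x. F (case_nat x e)))"
    by (rule definable_binf[OF _ assms(2)]) (simp add: case_nat_eta F)
  thus ?thesis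
  proof (rule sharpI)
    fix e assume e: "envM e" "D e"
    have "F (case_nat x e) = truth (Q e x)" if "x \<in> elts (t e)" for x
      using F(2)[of "case_nat x e"] that e elts_M by simp
    thus "binf (elts (t e)) (\<lambda>x. F (case_nat x e)) = truth (\<exists>x\<in>elts (t e). Q e x)"
      using binf_cong[of "elts (t e)" "\<lambda>x. F (case_nat x e)" "\<lambda>x. truth (Q e x)"] by (simp add: binf_truth)
  qed
qed

lemma sharp_ball:
  assumes "sharp (\<lambda>e. D (\<lambda>i. e (Suc i)) \<and> e 0 \<in> elts (t (\<lambda>i. e (Suc i)))) (\<lambda>e. Q (\<lambda>i. e (Suc i)) (e 0))"
    and "simple t"
  shows "sharp D (\<lambda>e. \<forall>x\<in>elts (t e). Q e x)"
  using sharp_not[OF sharp_bex[OF sharp_not[OF assms(1)] assms(2)]] by simp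

text \<open>For an unrestricted quantifier over \<open>M\<close> the matrix need not be two-valued. It suffices
that small values of it already witness \<open>Q\<close>.\<close>
lemma sharp_exM:
  assumes F: "definable (\<lambda>e. F (\<lambda>i. e (Suc i)) (e 0))" and ab: "a < b"
    and Q: "\<And>e. envM e \<Longrightarrow> D e \<Longrightarrow> Q e \<Longrightarrow> \<exists>f\<in>M. F e f \<le> a"
    and nQ: "\<And>e f. envM e \<Longrightarrow> D e \<Longrightarrow> f \<in> M \<Longrightarrow> F e f < b \<Longrightarrow> Q e" and b1: "b \<le> 1"
  shows "sharp D Q"
proof (rule sharp_thresh[OF definable_binf_M[OF F] ab])
  have r: "0 \<le> F e x" if "envM e" "x \<in> M" for e x
    using definable_range[OF F, of "case_nat x e"] that by simp
  fix e assume e: "envM e" "D e"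
  show "Q e \<Longrightarrow> binf M (F e) \<le> a"
    using Q[OF e] binf_lower[of M "F e"] r[OF e(1)] by (meson order_trans)
  show "\<not> Q e \<Longrightarrow> b \<le> binf M (F e)"
    using nQ[OF e] b1 by (intro binf_greatest) (auto simp: not_less[symmetric])
qed

lemma sharp_subst:
  assumes "sharp D0 Q0" and T: "\<And>i. simple (T i)"
    and D: "\<And>e. envM e \<Longrightarrow> D e \<Longrightarrow> D0 (\<lambda>i. T i e)"
  shows "sharp D (\<lambda>e. Q0 (\<lambda>i. T i e))"
proof -
  obtain F where F: "definable F" "\<And>e. envM e \<Longrightarrow> D0 e \<Longrightarrow> F e = truth (Q0 e)" using assms(1) unfolding sharp_def by blast
  show ?thesis
  proof (rule sharpI[OF definable_subst[OF F(1) T]])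
    fix e assume "envM e" "D e"
    moreover have "envM (\<lambda>i. T i e)" using simple_M[OF T \<open>envM e\<close>] by (simp add: envM_def)
    ultimately show "F (\<lambda>i. T i e) = truth (Q0 (\<lambda>i. T i e))" using F(2) D by blast
  qed
qed

definition sharp_set :: "'a \<Rightarrow> ('a \<Rightarrow> bool) \<Rightarrow> bool" where
  "sharp_set c P \<longleftrightarrow> sharp (\<lambda>e. e 0 \<in> elts c) (\<lambda>e. P (e 0))"

definition sharp_rel :: "'a \<Rightarrow> 'a \<Rightarrow> ('a \<Rightarrow> 'a \<Rightarrow> bool) \<Rightarrow> bool" where
  "sharp_rel a c R \<longleftrightarrow> sharp (\<lambda>e. e 0 \<in> elts a \<and> e (Suc 0) \<in> elts c) (\<lambda>e. R (e 0) (e (Suc 0)))"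

lemma sharp_set_at:
  assumes "sharp_set c P" "simple t" "\<And>e. envM e \<Longrightarrow> D e \<Longrightarrow> t e \<in> elts c"
  shows "sharp D (\<lambda>e. P (t e))"
  using sharp_subst[OF assms(1)[unfolded sharp_set_def], of "\<lambda>_. t" D] assms(2,3) by simp

lemma sharp_rel_at:
  assumes "sharp_rel a c R" "simple s" "simple t" "\<And>e. envM e \<Longrightarrow> D e \<Longrightarrow> s e \<in> elts a \<and> t e \<in> elts c"
  shows "sharp D (\<lambda>e. R (s e) (t e))"
  using sharp_subst[OF assms(1)[unfolded sharp_rel_def], of "case_nat s (\<lambda>_. t)" D] assms(2-4)
  by (simp split: nat.split)

lemma elts_eq_closed:
  assumes m: "m \<in> M" "\<And>z. z \<in> M \<Longrightarrow> dist_to z m = binf A (d z)" and A: "A \<subseteq> M"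
    and cl: "\<And>z. z \<in> M \<Longrightarrow> (\<And>\<epsilon>. 0 < \<epsilon> \<Longrightarrow> \<exists>a\<in>A. d z a < \<epsilon>) \<Longrightarrow> z \<in> A"
  shows "elts m = A"
proof (intro equalityI subsetI)
  fix z assume z: "z \<in> elts m"
  hence zM: "z \<in> M" by (rule elts_M)
  hence 0: "binf A (d z) = 0" using z m dist_to_eq_0_iff by metis
  show "z \<in> A"
  proof (rule cl[OF zM])
    fix \<epsilon> :: real assume "0 < \<epsilon>"
    hence "binf A (d z) < min \<epsilon> 1" using 0 by simp
    hence "\<exists>a\<in>A. d z a < min \<epsilon> 1" by (rule binf_lessD) simp
    thus "\<exists>a\<in>A. d z a < \<epsilon>" by auto
  qed
next
  fix z assume z: "z \<in> A"
  hence zM: "z \<in> M" using A by blast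
  have "binf A (d z) \<le> d z z" by (rule binf_lower) (use z in auto)
  hence "dist_to z m = 0" using m(2)[OF zM] dist_to_ge_0[of z m] zM by simp
  thus "z \<in> elts m" using dist_to_eq_0_iff zM m(1) by blast
qed

text \<open>Separation for conditions that cannot change between points closer than \<open>\<eta>\<close>;
such a condition cuts out a closed subclass.\<close>
lemma subset_set:
  assumes c: "c \<in> M" and P: "sharp_set c P" and \<eta>: "0 < \<eta>"
    and inv: "\<And>x y. x \<in> elts c \<Longrightarrow> y \<in> elts c \<Longrightarrow> P x \<Longrightarrow> d x y < \<eta> \<Longrightarrow> P y"
  shows "\<exists>m\<in>M. elts m = {x \<in> elts c. P x}"
proof -
  obtain F where F: "definable F" "\<And>e. envM e \<Longrightarrow> e 0 \<in> elts c \<Longrightarrow> F e = truth (P (e 0))"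
    using P[unfolded sharp_set_def] unfolding sharp_def by blast
  let ?A = "{x \<in> elts c. P x}"
  let ?G = "\<lambda>z. binf (elts c) (\<lambda>x. max (F (\<lambda>_. x)) (d z x))"
  have "definable (\<lambda>e. ?G (e 0))"
    by (intro definable_binf definable_max definable_d simple_var simple_const c definable_reindex[OF F(1), of "\<lambda>_. 0"])
  moreover have GA: "?G z = binf ?A (d z)" if z: "z \<in> M" for z
  proof -
    have "binf ?A (d z) = binf (elts c) (\<lambda>x. max (truth (P x)) (d z x))"
      by (rule binf_filter) (use z elts_M dist_le_1 in auto)
    also have "\<dots> = ?G z" using F(2) elts_M by (intro binf_cong) (auto simp: envM_def)
    finally show ?thesis by simp
  qed
  ultimately obtain m where m: "m \<in> M" "\<And>z. z \<in> M \<Longrightarrow> dist_to z m = ?G z"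
    using exact_comprehension[of ?G ?A] elts_M by blast
  have "elts m = ?A"
  proof (rule elts_eq_closed[OF m(1)])
    fix z assume z: "z \<in> M" and l: "\<And>\<epsilon>. 0 < \<epsilon> \<Longrightarrow> \<exists>a\<in>?A. d z a < \<epsilon>"
    have "dist_to z c \<le> 0"
    proof (rule dense_ge)
      fix v :: real assume "0 < v"
      then obtain a where "a \<in> ?A" "d z a < v" using l by blast
      thus "dist_to z c \<le> v" using dist_to_le[of a c z] by simp
    qed
    hence zc: "z \<in> elts c" using dist_to_ge_0[of z c] dist_to_eq_0_iff[OF z c] by simp
    obtain a where "a \<in> ?A" "d z a < \<eta>" using l[OF \<eta>] by blast
    thus "z \<in> ?A" using zc inv[of a z] commute[of a z] by simp
  qed (use m GA elts_M in auto)
  thus ?thesis using m(1) by blast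
qed

section \<open>Pairs and coded relations\<close>

lemma binf_insert2: "f x \<le> 1 \<Longrightarrow> f y \<le> 1 \<Longrightarrow> 0 \<le> f x \<Longrightarrow> 0 \<le> f y \<Longrightarrow> binf {x, y} f = min (f x) (f y)"
proof (rule antisym)
  assume f: "f x \<le> 1" "f y \<le> 1" "0 \<le> f x" "0 \<le> f y"
  have "binf {x, y} f \<le> f x" "binf {x, y} f \<le> f y" by (rule binf_lower; use f in auto)+
  thus "binf {x, y} f \<le> min (f x) (f y)" by simp
  show "min (f x) (f y) \<le> binf {x, y} f" by (rule binf_greatest) (use f in auto)
qed

lemma bsup_insert2: "f x \<le> 1 \<Longrightarrow> f y \<le> 1 \<Longrightarrow> 0 \<le> f x \<Longrightarrow> 0 \<le> f y \<Longrightarrow> bsup {x, y} f = max (f x) (f y)"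
proof (rule antisym)
  assume f: "f x \<le> 1" "f y \<le> 1" "0 \<le> f x" "0 \<le> f y"
  have "f x \<le> bsup {x, y} f" "f y \<le> bsup {x, y} f" by (rule bsup_upper; use f in auto)+
  thus "max (f x) (f y) \<le> bsup {x, y} f" by simp
  show "bsup {x, y} f \<le> max (f x) (f y)" by (rule bsup_least) (use f in auto)
qed

lemma elts_upair:
  assumes "x \<in> M" "y \<in> M" shows "the_set {x, y} \<in> M \<and> elts (the_set {x, y}) = {x, y}"
proof -
  have F: "definable (\<lambda>e. min (d (e 0) x) (d (e 0) y))"
    by (intro definable_min definable_d simple_var simple_const assms)
  have FA: "min (d z x) (d z y) = binf {x, y} (d z)" if "z \<in> M" for z
    using binf_insert2[of "d z" x y] that assms dist_le_1 by simp
  obtain m where m: "m \<in> M" "\<And>z. z \<in> M \<Longrightarrow> dist_to z m = min (d z x) (d z y)"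
    using exact_comprehension[of "\<lambda>z. min (d z x) (d z y)" "{x, y}", OF F] FA assms by blast
  have "elts m = {x, y}"
  proof (rule elts_eq_closed[OF m(1)])
    fix z assume z: "z \<in> M" and l: "\<And>\<epsilon>. 0 < \<epsilon> \<Longrightarrow> \<exists>a\<in>{x, y}. d z a < \<epsilon>"
    have "min (d z x) (d z y) \<le> 0"
    proof (rule dense_ge)
      fix v :: real assume "0 < v"
      then show "min (d z x) (d z y) \<le> v" using l[of v] by auto
    qed
    hence "d z x = 0 \<or> d z y = 0" using nonneg[of z x] nonneg[of z y] by linarith
    thus "z \<in> {x, y}" using z assms by simp
  qed (use m FA assms in auto)
  thus ?thesis using m(1) the_set_eq[of m "{x, y}"] by simp
qed

lemma elts_sing: "x \<in> M \<Longrightarrow> the_set {x} \<in> M \<and> elts (the_set {x}) = {x}"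
  using elts_upair[of x x] by simp

lemma emptyset: "emptyset \<in> M \<and> elts emptyset = {}"
proof -
  obtain m where m: "m \<in> M" "\<And>z. z \<in> M \<Longrightarrow> dist_to z m = 1"
    using exact_comprehension[of "\<lambda>z. 1" "{}", OF definable_real] by auto
  have "elts m = {}" by (rule elts_eq_closed[OF m(1)]) (use m in auto, metis zero_less_one)
  thus ?thesis using m(1) the_set_eq[of m "{}"] by (simp add: emptyset_def)
qed

lemma eq_emptyset_iff: "b \<in> M \<Longrightarrow> b = emptyset \<longleftrightarrow> elts b = {}"
  using emptyset elts_inject by blast

lemma pair_M: "x \<in> M \<Longrightarrow> y \<in> M \<Longrightarrow> pair x y \<in> M"
  unfolding pair_def using elts_upair elts_sing emptyset by metis

text \<open>Writes the distance to an unordered pair with bounded quantifiers, so that it is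
definable although no formula mentions the pair itself.\<close>
lemma d_upair:
  assumes "z \<in> M" "x \<in> M" "y \<in> M"
  shows "d z (the_set {x, y}) =
    max (bsup (elts z) (\<lambda>w. min (d w x) (d w y))) (max (dist_to x z) (dist_to y z))"
proof -
  note U = elts_upair[OF assms(2,3)]
  have 1: "excess z (the_set {x, y}) = bsup (elts z) (\<lambda>w. min (d w x) (d w y))"
    unfolding excess_def
  proof (rule bsup_cong)
    fix w assume w: "w \<in> elts z"
    show "dist_to w (the_set {x, y}) = min (d w x) (d w y)"
      unfolding dist_to_def using U binf_insert2[of "d w" x y] dist_le_1 elts_M[OF w] assms by simp
  qed
  have 2: "excess (the_set {x, y}) z = max (dist_to x z) (dist_to y z)"
    unfolding excess_def using U bsup_insert2[of "\<lambda>w. dist_to w z" x y] dist_to_ge_0 dist_to_le_1 by simp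
  show ?thesis using d_eq_excess[OF assms(1)] U 1 2 by simp
qed

lemma d_upair_upair:
  assumes "a \<in> M" "b \<in> M" "x \<in> M" "y \<in> M"
  shows "d (the_set {a, b}) (the_set {x, y}) =
    max (max (min (d a x) (d a y)) (min (d b x) (d b y))) (max (min (d x a) (d x b)) (min (d y a) (d y b)))"
proof -
  have dU: "dist_to w (the_set {a, b}) = min (d w a) (d w b)" if "w \<in> M" for w
    unfolding dist_to_def using elts_upair[OF assms(1,2)] binf_insert2[of "d w" a b] dist_le_1 that assms by simp
  have "bsup {a, b} (\<lambda>w. min (d w x) (d w y)) = max (min (d a x) (d a y)) (min (d b x) (d b y))"
    using bsup_insert2[of "\<lambda>w. min (d w x) (d w y)" a b] dist_le_1 assms by (simp add: min_le_iff_disj)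
  thus ?thesis
    using d_upair[of "the_set {a, b}" x y] elts_upair[OF assms(1,2)] dU assms by simp
qed

text \<open>Pairing is an isometry for the maximum metric: the empty set is at distance 1 from every
nonempty set, which keeps the two components of a pair apart.\<close>
lemma d_pair:
  assumes "x \<in> M" "y \<in> M" "x' \<in> M" "y' \<in> M"
  shows "d (pair x y) (pair x' y') = max (d x x') (d y y')"
proof -
  have s: "the_set {z} \<in> M" if "z \<in> M" for z using elts_sing that by blast
  have ss: "d (the_set {p}) (the_set {q}) = d p q" if "p \<in> M" "q \<in> M" for p q
    using d_upair_upair[of p p q q] that commute[of q p] by simp
  have se: "d (the_set {p}) emptyset = 1" "d emptyset (the_set {p}) = 1" if "p \<in> M" for p
  proof -
    have "d emptyset (the_set {p}) = 1"
      using d_upair[of emptyset p p] emptyset that by (simp add: dist_to_def)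
    thus "d emptyset (the_set {p}) = 1" "d (the_set {p}) emptyset = 1" using commute by metis+
  qed
  let ?U = "\<lambda>x. the_set {the_set {x}, emptyset}" and ?V = "\<lambda>y. the_set {the_set {y}}"
  have UU: "?U z \<in> M" "?V z \<in> M" if "z \<in> M" for z using elts_upair elts_sing emptyset that by metis+
  have dUU: "d (?U p) (?U q) = d p q" if "p \<in> M" "q \<in> M" for p q
    using d_upair_upair[of "the_set {p}" emptyset "the_set {q}" emptyset] s[OF that(1)] s[OF that(2)]
      emptyset ss that se dist_le_1[OF that] commute[of q p] by simp
  have dVV: "d (?V p) (?V q) = d p q" if "p \<in> M" "q \<in> M" for p q
    using ss s that by simp
  have dUV: "d (?U p) (?V q) = 1" "d (?V q) (?U p) = 1" if "p \<in> M" "q \<in> M" for p q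
  proof -
    have "1 \<le> d (?U p) (?V q)"
      using d_upair_upair[of "the_set {p}" emptyset "the_set {q}" "the_set {q}"] s[OF that(1)] s[OF that(2)]
      emptyset that se by simp
    thus "d (?U p) (?V q) = 1" "d (?V q) (?U p) = 1"
      using dist_le_1[OF UU(1)[OF that(1)] UU(2)[OF that(2)]] commute[of "?V q" "?U p"] by auto
  qed
  show ?thesis
    unfolding pair_def
    using d_upair_upair[of "?U x" "?V y" "?U x'" "?V y'"] UU assms dUU dVV dUV dist_le_1 commute[of x' x] commute[of y' y]
    by (simp add: min.absorb1 min.absorb2)
qed

text \<open>Terms enter formulas only through the distance of a variable to them.\<close>
definition definable_term :: "((nat \<Rightarrow> 'a) \<Rightarrow> 'a) \<Rightarrow> bool" where
  "definable_term t \<longleftrightarrow> (\<forall>e. envM e \<longrightarrow> t e \<in> M) \<and> definable (\<lambda>e. d (e 0) (t (\<lambda>i. e (Suc i))))"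

lemma definable_term_simple: "simple t \<Longrightarrow> definable_term t"
  unfolding definable_term_def using simple_M by (auto intro!: definable_d simple_var simple_shift)

lemma definable_term_upair: assumes s: "definable_term s" and t: "definable_term t" shows "definable_term (\<lambda>e. the_set {s e, t e})"
proof -
  have M: "s e \<in> M" "t e \<in> M" if "envM e" for e using s t that by (auto simp: definable_term_def)
  have p: "definable (\<lambda>e. d (e 0) (s (\<lambda>i. e (Suc (Suc i)))))" "definable (\<lambda>e. d (e 0) (t (\<lambda>i. e (Suc (Suc i)))))"
    using definable_reindex[of "\<lambda>e. d (e 0) (s (\<lambda>i. e (Suc i)))" "case_nat 0 (\<lambda>i. Suc (Suc i))"]
      definable_reindex[of "\<lambda>e. d (e 0) (t (\<lambda>i. e (Suc i)))" "case_nat 0 (\<lambda>i. Suc (Suc i))"] s t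
    by (simp_all add: definable_term_def)
  have "definable (\<lambda>e. max (bsup (elts (e 0)) (\<lambda>w. min (d w (s (\<lambda>i. e (Suc i)))) (d w (t (\<lambda>i. e (Suc i))))))
      (max (binf (elts (e 0)) (\<lambda>w. d w (s (\<lambda>i. e (Suc i))))) (binf (elts (e 0)) (\<lambda>w. d w (t (\<lambda>i. e (Suc i)))))))"
    by (intro definable_max definable_bsup definable_binf definable_min p simple_var)
  hence "definable (\<lambda>e. d (e 0) (the_set {s (\<lambda>i. e (Suc i)), t (\<lambda>i. e (Suc i))}))"
  proof (rule definable_cong)
    fix e assume e: "envM e"
    have c: "dist_to x y = binf (elts y) (\<lambda>w. d w x)" for x y unfolding dist_to_def by (rule binf_cong) (rule commute)
    show "d (e 0) (the_set {s (\<lambda>i. e (Suc i)), t (\<lambda>i. e (Suc i))}) =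
      max (bsup (elts (e 0)) (\<lambda>w. min (d w (s (\<lambda>i. e (Suc i)))) (d w (t (\<lambda>i. e (Suc i))))))
      (max (binf (elts (e 0)) (\<lambda>w. d w (s (\<lambda>i. e (Suc i))))) (binf (elts (e 0)) (\<lambda>w. d w (t (\<lambda>i. e (Suc i))))))"
      using d_upair[of "e 0" "s (\<lambda>i. e (Suc i))" "t (\<lambda>i. e (Suc i))"] M e by (simp add: c)
  qed
  thus ?thesis using elts_upair M by (simp add: definable_term_def)
qed

lemma definable_term_pair: assumes "definable_term s" "definable_term t" shows "definable_term (\<lambda>e. pair (s e) (t e))"
proof -
  have e: "definable_term (\<lambda>e. emptyset)" using emptyset by (intro definable_term_simple simple_const) auto
  have sg: "definable_term (\<lambda>e. the_set {t e})" if "definable_term t" for t using definable_term_upair[OF that that] by simp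
  show ?thesis unfolding pair_def by (intro definable_term_upair sg assms e)
qed

lemma definable_dt: assumes "simple s" "definable_term t" shows "definable (\<lambda>e. d (s e) (t e))"
  by (rule definable_simple[OF _ assms(1), of "\<lambda>e y. d y (t e)"]) (use assms(2) in \<open>simp add: definable_term_def\<close>)

lemma definable_term_shift: assumes "definable_term t" shows "definable_term (\<lambda>e. t (\<lambda>i. e (Suc i)))"
  using definable_reindex[of "\<lambda>e. d (e 0) (t (\<lambda>i. e (Suc i)))" "case_nat 0 (\<lambda>i. Suc (Suc i))"] assms
  by (simp add: definable_term_def)

lemma definable_dist_to_t: assumes "simple f" "definable_term t" shows "definable (\<lambda>e. dist_to (t e) (f e))"
proof -
  have "dist_to x y = binf (elts y) (\<lambda>w. d w x)" for x y unfolding dist_to_def by (rule binf_cong) (rule commute)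
  thus ?thesis by (simp only:) (intro definable_binf definable_dt definable_term_shift assms simple_var)
qed

text \<open>Codes a binary relation by a set of pairs. Only the distances to the code are recorded,
because the class of pairs need not be closed.\<close>
lemma rel_code:
  assumes ac: "a \<in> M" "c \<in> M" and R: "sharp_rel a c R"
  shows "\<exists>f\<in>M. \<forall>z\<in>M. dist_to z f = binf {pair x y | x y. x \<in> elts a \<and> y \<in> elts c \<and> R x y} (d z)"
proof -
  let ?A = "{pair x y | x y. x \<in> elts a \<and> y \<in> elts c \<and> R x y}"
  obtain F where F: "definable F" "\<And>e. envM e \<Longrightarrow> e 0 \<in> elts a \<and> e (Suc 0) \<in> elts c \<Longrightarrow> F e = truth (R (e 0) (e (Suc 0)))"
    using R[unfolded sharp_rel_def] unfolding sharp_def by blast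
  let ?G = "\<lambda>z. binf (elts a) (\<lambda>x. binf (elts c) (\<lambda>y. max (F (case_nat x (\<lambda>_. y))) (d z (pair x y))))"
  have AM: "?A \<subseteq> M" using pair_M elts_M by blast
  have "definable (\<lambda>e. F (\<lambda>i. case_nat (\<lambda>e. e (Suc 0)) (\<lambda>_ e. e 0) i e))"
    by (rule definable_subst[OF F(1)]) (auto split: nat.split)
  moreover have "(\<lambda>i. case_nat (\<lambda>e. e (Suc 0)) (\<lambda>_ e. e 0) i e) = case_nat (e (Suc 0)) (\<lambda>_. e 0)" for e :: "nat \<Rightarrow> 'a"
    by (rule ext) (simp split: nat.split)
  ultimately have pF: "definable (\<lambda>e. F (case_nat (e (Suc 0)) (\<lambda>_. e 0)))" by simp
  have "definable (\<lambda>e. ?G (e 0))"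
    by (intro definable_binf definable_max definable_dt definable_term_pair definable_term_simple simple_var simple_const ac pF)
  moreover have GA: "?G z = binf ?A (d z)" if z: "z \<in> M" for z
  proof (rule antisym)
    have Fxy: "F (case_nat x (\<lambda>_. y)) = truth (R x y)" if "x \<in> elts a" "y \<in> elts c" for x y
      using F(2)[of "case_nat x (\<lambda>_. y)"] that elts_M by (simp add: envM_def split: nat.split)
    have p0: "0 \<le> max v (d z p)" for v p by (simp add: le_max_iff_disj)
    have i0: "0 \<le> binf (elts c) (\<lambda>y. max (F (case_nat x (\<lambda>_. y))) (d z (pair x y)))" for x
      by (rule binf_ge_0) (rule p0)
    show "?G z \<le> binf ?A (d z)"
    proof (rule binf_greatest)
      fix p assume "p \<in> ?A"
      then obtain x y where p: "p = pair x y" "x \<in> elts a" "y \<in> elts c" "R x y" by blast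
      have "?G z \<le> binf (elts c) (\<lambda>y. max (F (case_nat x (\<lambda>_. y))) (d z (pair x y)))"
        by (rule binf_lower[OF i0 p(2)])
      also have "\<dots> \<le> max (F (case_nat x (\<lambda>_. y))) (d z (pair x y))"
        by (rule binf_lower[OF p0 p(3)])
      also have "\<dots> = d z p" using p Fxy by simp
      finally show "?G z \<le> d z p" .
    qed (rule binf_le_1, rule i0)
    have b1: "binf ?A (d z) \<le> 1" by (rule binf_le_1) simp
    show "binf ?A (d z) \<le> ?G z"
    proof (intro binf_greatest b1)
      fix x y assume xy: "x \<in> elts a" "y \<in> elts c"
      show "binf ?A (d z) \<le> max (F (case_nat x (\<lambda>_. y))) (d z (pair x y))"
      proof (cases "R x y")
        case True
        hence "pair x y \<in> ?A" using xy by blast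
        hence "binf ?A (d z) \<le> d z (pair x y)" by (intro binf_lower) auto
        thus ?thesis by simp
      next
        case False thus ?thesis using b1 Fxy[OF xy] by (simp add: truth_def)
      qed
    qed
  qed
  ultimately obtain f where "f \<in> M" "\<And>z. z \<in> M \<Longrightarrow> dist_to z f = ?G z"
    using exact_comprehension[of ?G ?A, OF _ AM] by blast
  thus ?thesis using GA by auto
qed

lemma discrete_eq: "discrete r a \<Longrightarrow> x \<in> elts a \<Longrightarrow> y \<in> elts a \<Longrightarrow> d x y < r \<Longrightarrow> x = y"
  unfolding discrete_def by force

lemma rel_set:
  assumes ac: "a \<in> M" "c \<in> M" and dis: "0 < r" "discrete r a" "discrete r c" and R: "sharp_rel a c R"
  shows "\<exists>f\<in>M. elts f = {pair x y | x y. x \<in> elts a \<and> y \<in> elts c \<and> R x y}"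
proof -
  let ?A = "{pair x y | x y. x \<in> elts a \<and> y \<in> elts c \<and> R x y}"
  have AM: "?A \<subseteq> M" using pair_M elts_M by blast
  obtain f where f: "f \<in> M" "\<And>z. z \<in> M \<Longrightarrow> dist_to z f = binf ?A (d z)" using rel_code[OF ac R] by blast
  have "elts f = ?A"
  proof (rule elts_eq_closed[OF f AM])
    fix z assume z: "z \<in> M" and l: "\<And>\<epsilon>. 0 < \<epsilon> \<Longrightarrow> \<exists>a\<in>?A. d z a < \<epsilon>"
    obtain p where p: "p \<in> ?A" "d z p < r / 2" using l[of "r/2"] dis(1) by auto
    then obtain x y where xy: "p = pair x y" "x \<in> elts a" "y \<in> elts c" by blast
    have "d z p \<le> 0"
    proof (rule dense_ge)
      fix v :: real assume "0 < v"
      hence "0 < min v (r/2)" using dis(1) by simp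
      then obtain q where q: "q \<in> ?A" "d z q < min v (r / 2)" using l by blast
      then obtain x' y' where xy': "q = pair x' y'" "x' \<in> elts a" "y' \<in> elts c" by blast
      have "d p q \<le> d p z + d z q" using triangle[of p z q] p q AM z by blast
      hence "d p q < r" using p(2) q(2) commute[of p z] by simp
      hence "d x x' < r" "d y y' < r" using d_pair[of x y x' y'] xy xy' elts_M by auto
      hence "x = x'" "y = y'" using discrete_eq dis(2,3) xy xy' by blast+
      thus "d z p \<le> v" using q xy xy' by simp
    qed
    hence "z = p" using z p(1) AM nonneg[of z p] zero[of z p] by (meson antisym subsetD)
    thus "z \<in> ?A" using p by simp
  qed
  thus ?thesis using f(1) by blast
qed

lemma sharp_rel_of_set:
  assumes dis: "0 < r" "discrete r a" "discrete r c"
    and f: "f \<in> M" "elts f = {pair x y | x y. x \<in> elts a \<and> y \<in> elts c \<and> R x y}"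
  shows "sharp_rel a c R"
  unfolding sharp_rel_def
proof (rule sharp_thresh[of "\<lambda>e. dist_to (pair (e 0) (e (Suc 0))) f" 0 "min r 1"])
  show "definable (\<lambda>e. dist_to (pair (e 0) (e (Suc 0))) f)"
    by (intro definable_dist_to_t definable_term_pair definable_term_simple simple_var simple_const f(1))
  fix e :: "nat \<Rightarrow> 'a" assume e: "e 0 \<in> elts a \<and> e (Suc 0) \<in> elts c"
  { assume "R (e 0) (e (Suc 0))"
    hence "pair (e 0) (e (Suc 0)) \<in> elts f" using e f(2) by blast
    thus "dist_to (pair (e 0) (e (Suc 0))) f \<le> 0" using dist_to_eq_0_iff f(1) elts_M by (metis order_refl) }
  { assume n: "\<not> R (e 0) (e (Suc 0))"
    show "min r 1 \<le> dist_to (pair (e 0) (e (Suc 0))) f"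
    proof (rule dist_to_geI)
      fix p assume "p \<in> elts f"
      then obtain x y where p: "p = pair x y" "x \<in> elts a" "y \<in> elts c" "R x y" using f(2) by blast
      hence "\<not> (d (e 0) x < r \<and> d (e (Suc 0)) y < r)" using n e discrete_eq dis(2,3) by blast
      thus "min r 1 \<le> d (pair (e 0) (e (Suc 0))) p"
        using d_pair[of "e 0" "e (Suc 0)" x y] e p elts_M by auto
    qed simp }
qed (use dis in auto)

end

section \<open>Approximate well-ordered chains\<close>

lemma bsup_lessD: "bsup A f < v \<Longrightarrow> (\<And>x. x \<in> A \<Longrightarrow> f x \<le> 1) \<Longrightarrow> x \<in> A \<Longrightarrow> f x < v"
  using bsup_upper[of A f x] by fastforce

text \<open>Excision delivers chains only up to an error. Here \<open>h\<close> is the error that is tolerated in all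
comparisons. \<open>le\<close> is inclusion up to \<open>h\<close>, and in the sets under consideration the excess is either
below \<open>h\<close> or at least \<open>3 * h\<close>, so that \<open>le\<close> is a sharp total preorder.\<close>
locale mse_tolerance = mse_model +
  fixes h :: real
  assumes h_pos: "0 < h" and h_small: "3 * h \<le> 1"
begin

definition le :: "'a \<Rightarrow> 'a \<Rightarrow> bool" where
  "le x y \<longleftrightarrow> excess x y < h"

definition alike :: "'a \<Rightarrow> 'a \<Rightarrow> bool" where
  "alike x y \<longleftrightarrow> le x y \<and> le y x"

text \<open>The approximate counterpart of an \<open>\<rho>\<close>-discrete well-ordered chain. Elements that are \<open>alike\<close> are to
be thought of as one element blurred by \<open>h\<close>.\<close>
definition wo_pre :: "real \<Rightarrow> 'a \<Rightarrow> bool" where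
  "wo_pre \<rho> c \<longleftrightarrow> c \<in> M \<and>
     (\<forall>x\<in>elts c. \<forall>y\<in>elts c. (le x y \<or> \<rho> \<le> excess x y) \<and> (le x y \<or> le y x)) \<and>
     (\<forall>m\<in>M. m \<sqsubseteq> c \<and> elts m \<noteq> {} \<longrightarrow> (\<exists>x\<in>elts m. \<forall>y\<in>elts m. le x y))"

abbreviation W :: "'a set" where "W \<equiv> {c. wo_pre (3 * h) c}"

lemma W_M: "c \<in> W \<Longrightarrow> c \<in> M"
  by (simp add: wo_pre_def)

lemma wo_pre_mono: "wo_pre \<rho> c \<Longrightarrow> \<rho>' \<le> \<rho> \<Longrightarrow> wo_pre \<rho>' c"
  unfolding wo_pre_def by (meson order_trans)

lemma le_refl: "x \<in> M \<Longrightarrow> le x x"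
  using h_pos by (simp add: le_def excess_refl)

lemma le_total: "c \<in> W \<Longrightarrow> x \<in> elts c \<Longrightarrow> y \<in> elts c \<Longrightarrow> le x y \<or> le y x"
  by (simp add: wo_pre_def)

lemma le_gap: "c \<in> W \<Longrightarrow> x \<in> elts c \<Longrightarrow> y \<in> elts c \<Longrightarrow> excess x y < 3 * h \<Longrightarrow> le x y"
  unfolding wo_pre_def by force

text \<open>Two errors of size \<open>h\<close> stay below the gap \<open>3 * h\<close>, which brings the excess back below \<open>h\<close>.\<close>
lemma le_trans: assumes "c \<in> W" "x \<in> elts c" "z \<in> elts c" "le x y" "le y z" shows "le x z"
  by (rule le_gap[OF assms(1-3)]) (use excess_triangle[of x z y] assms(4,5) h_pos in \<open>simp add: le_def\<close>)

lemma d_alike: "x \<in> M \<Longrightarrow> y \<in> M \<Longrightarrow> alike x y \<longleftrightarrow> d x y < h"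
  by (simp add: alike_def le_def d_eq_excess)

lemma near_alike: assumes "c \<in> W" "x \<in> elts c" "y \<in> elts c" "d x y < 3 * h" shows "alike x y"
  using assms le_gap[OF assms(1-3)] le_gap[OF assms(1,3,2)] d_eq_excess[OF elts_M[OF assms(2)] elts_M[OF assms(3)]]
  by (simp add: alike_def)

lemma le_at:
  assumes "simple s" "simple t" "\<And>e. envM e \<Longrightarrow> D e \<Longrightarrow> \<exists>c\<in>W. s e \<in> elts c \<and> t e \<in> elts c"
  shows "sharp D (\<lambda>e. le (s e) (t e))"
proof (rule sharp_thresh[OF definable_excess[OF assms(1,2)], of h "3 * h"])
  fix e assume e: "envM e" "D e"
  show "le (s e) (t e) \<Longrightarrow> excess (s e) (t e) \<le> h" by (simp add: le_def)
  show "\<not> le (s e) (t e) \<Longrightarrow> 3 * h \<le> excess (s e) (t e)" using assms(3)[OF e] le_gap by force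
qed (use h_pos in simp)

lemma le_in:
  assumes "c \<in> W" "simple s" "simple t" "\<And>e. envM e \<Longrightarrow> D e \<Longrightarrow> s e \<in> elts c \<and> t e \<in> elts c"
  shows "sharp D (\<lambda>e. le (s e) (t e))"
  by (rule le_at[OF assms(2,3)]) (use assms(1,4) in blast)

text \<open>Least elements are given for subsets that are members of \<open>M\<close>. A sharp condition is
first saturated under likeness, which makes it stable under small perturbations and hence a set.\<close>
lemma wo_least:
  assumes c: "c \<in> W" and P: "sharp_set c P" and x: "x \<in> elts c" "P x"
  shows "\<exists>x\<in>elts c. P x \<and> (\<forall>y\<in>elts c. P y \<longrightarrow> le x y)"
proof -
  let ?P = "\<lambda>x. \<exists>x'\<in>elts c. (le x x' \<and> le x' x) \<and> P x'"
  have cM: "c \<in> M" by (rule W_M[OF c])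
  have "sharp_set c ?P"
    unfolding sharp_set_def
    by (intro sharp_bex sharp_conj le_in[OF c] sharp_set_at[OF P] simple_var simple_const cM) auto
  then have "\<exists>m\<in>M. elts m = {x \<in> elts c. ?P x}"
  proof (rule subset_set[OF cM _ h_pos])
    fix x y assume xy: "x \<in> elts c" "y \<in> elts c" "?P x" "d x y < h"
    then obtain x' where x': "x' \<in> elts c" "le x x'" "le x' x" "P x'" by blast
    have "le x y" "le y x" using xy d_alike[OF elts_M elts_M] by (auto simp: alike_def)
    hence "le y x'" "le x' y" using le_trans[OF c] x' xy by blast+
    thus "?P y" using x' by blast
  qed
  then obtain m where m: "m \<in> M" "elts m = {x \<in> elts c. ?P x}" by blast
  have "x \<in> elts m" using m x le_refl[OF elts_M] by auto
  hence "elts m \<noteq> {}" "m \<sqsubseteq> c" using m by (auto simp: subset_rel_def)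
  moreover have "\<forall>m\<in>M. m \<sqsubseteq> c \<and> elts m \<noteq> {} \<longrightarrow> (\<exists>x\<in>elts m. \<forall>y\<in>elts m. le x y)"
    using c by (simp add: wo_pre_def)
  ultimately obtain u where u: "u \<in> elts m" "\<And>y. y \<in> elts m \<Longrightarrow> le u y"
    using m(1) by blast
  then obtain u' where u': "u \<in> elts c" "u' \<in> elts c" "le u u'" "le u' u" "P u'" using m by blast
  have "le u' y" if "y \<in> elts c" "P y" for y
  proof -
    have "y \<in> elts m" using m that le_refl[OF elts_M] by auto
    thus ?thesis using u(2) u' le_trans[OF c u'(2) that(1) u'(4)] by blast
  qed
  thus ?thesis using u' by blast
qed

lemma wo_induct:
  assumes c: "c \<in> W" and P: "sharp_set c P" and x: "x \<in> elts c"
    and step: "\<And>x. x \<in> elts c \<Longrightarrow> (\<And>y. y \<in> elts c \<Longrightarrow> \<not> le x y \<Longrightarrow> P y) \<Longrightarrow> P x"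
  shows "P x"
proof (rule ccontr)
  assume n: "\<not> P x"
  have "sharp_set c (\<lambda>x. \<not> P x)" using sharp_not[OF P[unfolded sharp_set_def]] by (simp add: sharp_set_def)
  then obtain u where "u \<in> elts c" "\<not> P u" "\<And>y. y \<in> elts c \<Longrightarrow> \<not> P y \<Longrightarrow> le u y"
    using wo_least[of c "\<lambda>x. \<not> P x" x] c x n by blast
  thus False using step[of u] by blast
qed

section \<open>Partial isomorphisms\<close>

text \<open>An isomorphism from an initial segment of \<open>a\<close> to one of \<open>c\<close>, as a relation that is
saturated under likeness. A relation is used since an element has no distinguished image among the
elements that are alike.\<close>
definition partial_iso :: "'a \<Rightarrow> 'a \<Rightarrow> ('a \<Rightarrow> 'a \<Rightarrow> bool) \<Rightarrow> bool" where
  "partial_iso a c R \<longleftrightarrow>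
     (\<forall>x y. R x y \<longrightarrow> x \<in> elts a \<and> y \<in> elts c) \<and>
     (\<forall>x y x' y'. R x y \<longrightarrow> R x' y' \<longrightarrow> (le x x' \<longleftrightarrow> le y y')) \<and>
     (\<forall>x y x'. R x y \<longrightarrow> x' \<in> elts a \<longrightarrow> le x' x \<longrightarrow> (\<exists>y'. R x' y')) \<and>
     (\<forall>x y y'. R x y \<longrightarrow> y' \<in> elts c \<longrightarrow> le y' y \<longrightarrow> (\<exists>x'. R x' y')) \<and>
     (\<forall>x y x' y'. R x y \<longrightarrow> x' \<in> elts a \<longrightarrow> y' \<in> elts c \<longrightarrow> alike x x' \<longrightarrow> alike y y' \<longrightarrow> R x' y')"

lemma partial_isoI:
  assumes "\<And>x y. R x y \<Longrightarrow> x \<in> elts a \<and> y \<in> elts c"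
    and "\<And>x y x' y'. R x y \<Longrightarrow> R x' y' \<Longrightarrow> le x x' \<longleftrightarrow> le y y'"
    and "\<And>x y x'. R x y \<Longrightarrow> x' \<in> elts a \<Longrightarrow> le x' x \<Longrightarrow> \<exists>y'. R x' y'"
    and "\<And>x y y'. R x y \<Longrightarrow> y' \<in> elts c \<Longrightarrow> le y' y \<Longrightarrow> \<exists>x'. R x' y'"
    and "\<And>x y x' y'. R x y \<Longrightarrow> x' \<in> elts a \<Longrightarrow> y' \<in> elts c \<Longrightarrow> alike x x' \<Longrightarrow> alike y y' \<Longrightarrow> R x' y'"
  shows "partial_iso a c R"
  unfolding partial_iso_def
proof (intro conjI)
  show "\<forall>x y. R x y \<longrightarrow> x \<in> elts a \<and> y \<in> elts c" using assms(1) by blast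
  show "\<forall>x y x' y'. R x y \<longrightarrow> R x' y' \<longrightarrow> le x x' = le y y'" using assms(2) by blast
  show "\<forall>x y x'. R x y \<longrightarrow> x' \<in> elts a \<longrightarrow> le x' x \<longrightarrow> (\<exists>y'. R x' y')" using assms(3) by blast
  show "\<forall>x y y'. R x y \<longrightarrow> y' \<in> elts c \<longrightarrow> le y' y \<longrightarrow> (\<exists>x'. R x' y')" using assms(4) by blast
  show "\<forall>x y x' y'. R x y \<longrightarrow> x' \<in> elts a \<longrightarrow> y' \<in> elts c \<longrightarrow> alike x x' \<longrightarrow> alike y y' \<longrightarrow> R x' y'"
    using assms(5) by blast
qed

lemma partial_iso_dom: "partial_iso a c R \<Longrightarrow> R x y \<Longrightarrow> x \<in> elts a \<and> y \<in> elts c"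
  unfolding partial_iso_def by (elim conjE) blast

lemma partial_iso_le: "partial_iso a c R \<Longrightarrow> R x y \<Longrightarrow> R x' y' \<Longrightarrow> le x x' \<longleftrightarrow> le y y'"
  unfolding partial_iso_def by (elim conjE) metis

lemma partial_iso_down: "partial_iso a c R \<Longrightarrow> R x y \<Longrightarrow> x' \<in> elts a \<Longrightarrow> le x' x \<Longrightarrow> \<exists>y'. R x' y'"
  unfolding partial_iso_def by (elim conjE) metis

lemma partial_iso_down': "partial_iso a c R \<Longrightarrow> R x y \<Longrightarrow> y' \<in> elts c \<Longrightarrow> le y' y \<Longrightarrow> \<exists>x'. R x' y'"
  unfolding partial_iso_def by (elim conjE) metis

lemma partial_iso_alike: "partial_iso a c R \<Longrightarrow> R x y \<Longrightarrow> x' \<in> elts a \<Longrightarrow> y' \<in> elts c \<Longrightarrow> alike x x' \<Longrightarrow> alike y y' \<Longrightarrow> R x' y'"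
  unfolding partial_iso_def by (elim conjE) metis

lemma alike_sym: "alike x y \<Longrightarrow> alike y x"
  by (simp add: alike_def)

lemma partial_iso_sym: "partial_iso a c R \<Longrightarrow> partial_iso c a (\<lambda>y x. R x y)"
proof (rule partial_isoI)
  assume p: "partial_iso a c R"
  show "y \<in> elts c \<and> x \<in> elts a" if "R x y" for y x using partial_iso_dom[OF p that] by simp
  show "le y y' \<longleftrightarrow> le x x'" if "R x y" "R x' y'" for y x y' x' using partial_iso_le[OF p that] by simp
  show "\<exists>x'. R x' y'" if "R x y" "y' \<in> elts c" "le y' y" for y x y' by (rule partial_iso_down'[OF p that])
  show "\<exists>y'. R x' y'" if "R x y" "x' \<in> elts a" "le x' x" for y x x' by (rule partial_iso_down[OF p that])
  show "R x' y'" if "R x y" "y' \<in> elts c" "x' \<in> elts a" "alike y y'" "alike x x'" for y x y' x'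
    by (rule partial_iso_alike[OF p that(1,3,2,5,4)])
qed

lemma sharp_rel_sym: "sharp_rel a c R \<Longrightarrow> sharp_rel c a (\<lambda>y x. R x y)"
  unfolding sharp_rel_def[of c a] by (rule sharp_rel_at[of a c R]) auto

text \<open>The uniqueness of isomorphisms of well-orders: at a least point of disagreement,
the smaller of the two images would have a preimage strictly below.\<close>
lemma partial_iso_compat:
  assumes a: "a \<in> W" and c: "c \<in> W" and R: "partial_iso a c R" "sharp_rel a c R" and R': "partial_iso a c R'" "sharp_rel a c R'"
    and xy: "R x y" "R' x y'"
  shows "alike y y'"
proof -
  have aM: "a \<in> M" and cM: "c \<in> M" using W_M a c by blast+
  let ?P = "\<lambda>x. \<forall>y\<in>elts c. \<forall>y'\<in>elts c. R x y \<and> R' x y' \<longrightarrow> le y y' \<and> le y' y"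
  have P: "sharp_set a ?P" unfolding sharp_set_def
    by (intro sharp_ball sharp_imp sharp_conj sharp_rel_at[OF R(2)] sharp_rel_at[OF R'(2)] le_in[OF c] simple_var simple_const cM) auto
  have aux: "le y y'" if S: "partial_iso a c S" "partial_iso a c S'" and xy: "S x y" "S' x y'"
    and IH: "\<And>x' y y'. x' \<in> elts a \<Longrightarrow> \<not> le x x' \<Longrightarrow> S x' y \<Longrightarrow> S' x' y' \<Longrightarrow> alike y y'"
    for S S' x y y'
  proof (rule ccontr)
    assume n: "\<not> le y y'"
    have d: "x \<in> elts a" "y \<in> elts c" "y' \<in> elts c" using partial_iso_dom S xy by blast+
    hence "le y' y" using n le_total[OF c] by blast
    then obtain x' where x': "S x' y'" using partial_iso_down'[OF S(1) xy(1) d(3)] by blast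
    hence x'a: "x' \<in> elts a" using partial_iso_dom S by blast
    have nl: "\<not> le x x'" using partial_iso_le[OF S(1) xy(1) x'] n by blast
    hence "le x' x" using le_total[OF a] d x'a by blast
    then obtain y'' where y'': "S' x' y''" using partial_iso_down[OF S(2) xy(2) x'a] by blast
    have "le y' y''" using IH[OF x'a nl x' y''] by (simp add: alike_def)
    thus False using nl partial_iso_le[OF S(2) xy(2) y''] by blast
  qed
  have "?P x"
  proof (rule wo_induct[OF a P])
    show "x \<in> elts a" using partial_iso_dom[OF R(1) xy(1)] by blast
    fix x assume x: "x \<in> elts a" and IH: "\<And>y. y \<in> elts a \<Longrightarrow> \<not> le x y \<Longrightarrow> ?P y"
    have I: "alike y y'" if "x' \<in> elts a" "\<not> le x x'" "R x' y" "R' x' y'" for x' y y'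
      using IH[OF that(1,2)] that(3,4) partial_iso_dom R(1) R'(1) unfolding alike_def by blast
    show "?P x"
    proof (intro ballI impI)
      fix y y' assume "R x y \<and> R' x y'"
      hence xy: "R x y" "R' x y'" by auto
      have "le y y'" by (rule aux[OF R(1) R'(1) xy I])
      moreover have "le y' y" by (rule aux[OF R'(1) R(1) xy(2,1)]) (rule alike_sym, rule I)
      ultimately show "le y y' \<and> le y' y" by blast
    qed
  qed
  thus ?thesis using xy partial_iso_dom[OF R(1) xy(1)] partial_iso_dom[OF R'(1) xy(2)] by (simp add: alike_def)
qed

text \<open>By compatibility this union is itself a partial isomorphism, hence the largest one.\<close>
definition max_iso :: "'a \<Rightarrow> 'a \<Rightarrow> 'a \<Rightarrow> 'a \<Rightarrow> bool" where
  "max_iso a c x y \<longleftrightarrow> (\<exists>R. sharp_rel a c R \<and> partial_iso a c R \<and> R x y)"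

lemma max_iso_sym: "max_iso a c x y \<Longrightarrow> max_iso c a y x"
  unfolding max_iso_def using sharp_rel_sym partial_iso_sym by fast

lemma max_iso_partial_iso: assumes a: "a \<in> W" and c: "c \<in> W" shows "partial_iso a c (max_iso a c)"
proof (rule partial_isoI)
  show "x \<in> elts a \<and> y \<in> elts c" if "max_iso a c x y" for x y
    using that partial_iso_dom unfolding max_iso_def by blast
  show "\<exists>y'. max_iso a c x' y'" if "max_iso a c x y" "x' \<in> elts a" "le x' x" for x y x'
    using that partial_iso_down unfolding max_iso_def by blast
  show "\<exists>x'. max_iso a c x' y'" if "max_iso a c x y" "y' \<in> elts c" "le y' y" for x y y'
    using that partial_iso_down' unfolding max_iso_def by blast
  show "max_iso a c x' y'" if "max_iso a c x y" "x' \<in> elts a" "y' \<in> elts c" "alike x x'" "alike y y'" for x y x' y'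
    using that partial_iso_alike unfolding max_iso_def by blast
  fix x y x' y' assume g: "max_iso a c x y" "max_iso a c x' y'"
  obtain R where R: "sharp_rel a c R" "partial_iso a c R" "R x y" using g(1) unfolding max_iso_def by blast
  obtain R' where R': "sharp_rel a c R'" "partial_iso a c R'" "R' x' y'" using g(2) unfolding max_iso_def by blast
  have d: "x \<in> elts a" "y \<in> elts c" "x' \<in> elts a" "y' \<in> elts c" using partial_iso_dom R R' by blast+
  show "le x x' \<longleftrightarrow> le y y'"
  proof
    assume "le x x'"
    then obtain y1 where y1: "R' x y1" using partial_iso_down[OF R'(2,3) d(1)] by blast
    have "alike y y1" by (rule partial_iso_compat[OF a c R(2,1) R'(2,1) R(3) y1])
    moreover have "le y1 y'" using partial_iso_le[OF R'(2) y1 R'(3)] \<open>le x x'\<close> by blast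
    ultimately show "le y y'" using le_trans[OF c d(2,4), of y1] by (simp add: alike_def)
  next
    assume l: "le y y'"
    show "le x x'"
    proof (rule ccontr)
      assume n: "\<not> le x x'"
      hence "le x' x" using le_total[OF a] d by blast
      then obtain y1 where y1: "R x' y1" using partial_iso_down[OF R(2,3) d(3)] by blast
      have "alike y1 y'" by (rule partial_iso_compat[OF a c R(2,1) R'(2,1) y1 R'(3)])
      moreover have "y1 \<in> elts c" using partial_iso_dom R y1 by blast
      ultimately have "le y y1" using le_trans[OF c d(2)] l by (auto simp: alike_def)
      thus False using partial_iso_le[OF R(2,3) y1] n by blast
    qed
  qed
qed

section \<open>Sharpness of the maximal partial isomorphism\<close>

text \<open>For an arbitrary \<open>f\<close> in \<open>M\<close> this reads off a fuzzy relation: 0 if the pair is within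
\<open>h\<close> of \<open>f\<close>, and 1 if it is at distance at least \<open>2 * h\<close>.\<close>
definition graph_val :: "'a \<Rightarrow> 'a \<Rightarrow> 'a \<Rightarrow> real" where
  "graph_val f x y = clip (1 / h * dist_to (pair x y) f + (- 1))"

definition le_val :: "'a \<Rightarrow> 'a \<Rightarrow> real" where
  "le_val x y = clip (1 / h * excess x y + (- 1))"

definition rxor :: "real \<Rightarrow> real \<Rightarrow> real" where
  "rxor u v = max (clip (1 * u + (-1) * v + 0)) (clip ((-1) * u + 1 * v + 0))"

lemma rxor_truth: "rxor (truth P) (truth Q) = truth (P \<longleftrightarrow> Q)"
  by (auto simp: rxor_def truth_def clip_def)

lemma graph_val_01 [simp]: "0 \<le> graph_val f x y" "graph_val f x y \<le> 1"
  by (simp_all add: graph_val_def)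

lemma definable_graph_val: "simple f \<Longrightarrow> simple s \<Longrightarrow> simple t \<Longrightarrow> definable (\<lambda>e. graph_val (f e) (s e) (t e))"
  unfolding graph_val_def by (intro definable_affine definable_dist_to_t definable_term_pair definable_term_simple)

lemma definable_le_val: "simple s \<Longrightarrow> simple t \<Longrightarrow> definable (\<lambda>e. le_val (s e) (t e))"
  unfolding le_val_def by (intro definable_affine definable_excess)

lemma definable_rxor: "definable F \<Longrightarrow> definable G \<Longrightarrow> definable (\<lambda>e. rxor (F e) (G e))"
  unfolding rxor_def by (intro definable_max definable_lin)

lemma le_val_truth: assumes "c \<in> W" "x \<in> elts c" "y \<in> elts c" shows "le_val x y = truth (le x y)"
proof (cases "le x y")
  case True
  hence "1 / h * excess x y - 1 \<le> 0" using h_pos by (simp add: le_def field_simps)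
  thus ?thesis using True by (simp add: le_val_def clip_def)
next
  case False
  hence "3 * h \<le> excess x y" using le_gap[OF assms] by force
  hence "1 / h * excess x y - 1 \<ge> 1" using h_pos by (simp add: field_simps)
  thus ?thesis using False by (simp add: le_val_def clip_def)
qed

text \<open>The five defects express, for the fuzzy relation coded by \<open>f\<close>, that it is nearly two-valued, that it
preserves and reflects the order, that its domain and its range are initial segments, and that it is
saturated. As 0 stands for truth, \<open>min (1 - P) Q\<close> is the implication from \<open>P\<close> to \<open>Q\<close>.\<close>
definition iso_defect1 :: "'a \<Rightarrow> 'a \<Rightarrow> 'a \<Rightarrow> real" where
  "iso_defect1 f a c = bsup (elts a) (\<lambda>x. bsup (elts c) (\<lambda>y. min (1 - graph_val f x y) (graph_val f x y)))"

definition iso_defect2 :: "'a \<Rightarrow> 'a \<Rightarrow> 'a \<Rightarrow> real" where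
  "iso_defect2 f a c = bsup (elts a) (\<lambda>x. bsup (elts c) (\<lambda>y. bsup (elts a) (\<lambda>x'. bsup (elts c) (\<lambda>y'.
     min (1 - graph_val f x y) (min (1 - graph_val f x' y') (rxor (le_val x x') (le_val y y')))))))"

definition iso_defect3 :: "'a \<Rightarrow> 'a \<Rightarrow> 'a \<Rightarrow> real" where
  "iso_defect3 f a c = bsup (elts a) (\<lambda>x. bsup (elts c) (\<lambda>y. bsup (elts a) (\<lambda>x'.
     min (1 - graph_val f x y) (min (1 - le_val x' x) (binf (elts c) (\<lambda>y'. graph_val f x' y'))))))"

definition iso_defect4 :: "'a \<Rightarrow> 'a \<Rightarrow> 'a \<Rightarrow> real" where
  "iso_defect4 f a c = bsup (elts a) (\<lambda>x. bsup (elts c) (\<lambda>y. bsup (elts c) (\<lambda>y'.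
     min (1 - graph_val f x y) (min (1 - le_val y' y) (binf (elts a) (\<lambda>x'. graph_val f x' y'))))))"

definition iso_defect5 :: "'a \<Rightarrow> 'a \<Rightarrow> 'a \<Rightarrow> real" where
  "iso_defect5 f a c = bsup (elts a) (\<lambda>x. bsup (elts c) (\<lambda>y. bsup (elts a) (\<lambda>x'. bsup (elts c) (\<lambda>y'.
     min (1 - graph_val f x y) (min (1 - max (le_val x x') (le_val x' x))
       (min (1 - max (le_val y y') (le_val y' y)) (graph_val f x' y')))))))"

definition iso_defect :: "'a \<Rightarrow> 'a \<Rightarrow> 'a \<Rightarrow> real" where
  "iso_defect f a c = max (iso_defect1 f a c) (max (iso_defect2 f a c) (max (iso_defect3 f a c) (max (iso_defect4 f a c) (iso_defect5 f a c))))"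

lemma definable_iso_defect: "simple f \<Longrightarrow> simple a \<Longrightarrow> simple c \<Longrightarrow> definable (\<lambda>e. iso_defect (f e) (a e) (c e))"
  unfolding iso_defect_def iso_defect1_def iso_defect2_def iso_defect3_def iso_defect4_def iso_defect5_def
  by (intro definable_max definable_bsup definable_binf definable_min definable_compl definable_graph_val definable_le_val definable_rxor simple_shift simple_var)

text \<open>Saturation is what makes the code of a partial isomorphism two-valued: a pair
closer than \<open>3 * h\<close> to the graph consists of elements alike to those of a pair in it.\<close>
lemma max_iso_imp_iso_defect:
  assumes a: "a \<in> W" and c: "c \<in> W" and g: "max_iso a c x y"
  shows "\<exists>f\<in>M. iso_defect f a c \<le> 0 \<and> graph_val f x y \<le> 0"
proof -
  obtain R where R: "sharp_rel a c R" "partial_iso a c R" "R x y" using g unfolding max_iso_def by blast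
  let ?A = "{pair x y | x y. x \<in> elts a \<and> y \<in> elts c \<and> R x y}"
  obtain f where f: "f \<in> M" "\<And>z. z \<in> M \<Longrightarrow> dist_to z f = binf ?A (d z)"
    using rel_code[OF W_M[OF a] W_M[OF c] R(1)] by blast
  have v: "graph_val f x y = truth (R x y)" if xy: "x \<in> elts a" "y \<in> elts c" for x y
  proof -
    have pM: "pair x y \<in> M" using xy pair_M elts_M by blast
    show ?thesis
    proof (cases "R x y")
      case True
      have "binf ?A (d (pair x y)) \<le> d (pair x y) (pair x y)"
        by (rule binf_lower) (use True xy in auto)
      hence "dist_to (pair x y) f = 0" using f(2)[OF pM] pM dist_to_ge_0[of "pair x y" f] by simp
      thus ?thesis using True by (simp add: graph_val_def clip_def)
    next
      case False
      have "3 * h \<le> binf ?A (d (pair x y))"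
      proof (rule binf_greatest)
        fix p assume "p \<in> ?A"
        then obtain x' y' where p: "p = pair x' y'" "x' \<in> elts a" "y' \<in> elts c" "R x' y'" by blast
        show "3 * h \<le> d (pair x y) p"
        proof (rule ccontr)
          assume "\<not> ?thesis"
          moreover have "d (pair x y) p = max (d x x') (d y y')" using p xy d_pair elts_M by metis
          ultimately have "d x x' < 3 * h" "d y y' < 3 * h" by linarith+
          hence "alike x' x" "alike y' y"
            using near_alike[OF a xy(1) p(2)] near_alike[OF c xy(2) p(3)] alike_sym by auto
          thus False using partial_iso_alike[OF R(2) p(4) xy] False by blast
        qed
      qed (rule h_small)
      hence "3 * h \<le> dist_to (pair x y) f" using f(2)[OF pM] by simp
      hence "1 / h * dist_to (pair x y) f - 1 \<ge> 1" using h_pos by (simp add: field_simps)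
      thus ?thesis using False by (simp add: graph_val_def clip_def)
    qed
  qed
  have bv0: "truth P \<le> 0 \<longleftrightarrow> P" for P by (simp add: truth_def)
  note tl = le_val_truth[OF a] le_val_truth[OF c]
  have "iso_defect1 f a c \<le> 0" unfolding iso_defect1_def
    by (intro bsup_least) (auto simp: v truth_def)
  moreover have "iso_defect2 f a c \<le> 0" unfolding iso_defect2_def
    using partial_iso_le[OF R(2)] by (intro bsup_least) (auto simp: v tl rxor_truth, auto simp: truth_def)
  moreover have "iso_defect3 f a c \<le> 0" unfolding iso_defect3_def
  proof (intro bsup_least order_refl)
    fix x y x' assume e: "x \<in> elts a" "y \<in> elts c" "x' \<in> elts a"
    have "binf (elts c) (\<lambda>y'. graph_val f x' y') = truth (\<exists>y'\<in>elts c. R x' y')"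
      unfolding binf_truth[symmetric] by (rule binf_cong) (simp add: v e)
    moreover have "\<exists>y'\<in>elts c. R x' y'" if "R x y" "le x' x"
      using partial_iso_down[OF R(2) that(1) e(3) that(2)] partial_iso_dom[OF R(2)] by blast
    ultimately show "min (1 - graph_val f x y) (min (1 - le_val x' x) (binf (elts c) (\<lambda>y'. graph_val f x' y'))) \<le> 0"
      using e by (simp add: v tl) (auto simp: truth_def)
  qed
  moreover have "iso_defect4 f a c \<le> 0" unfolding iso_defect4_def
  proof (intro bsup_least order_refl)
    fix x y y' assume e: "x \<in> elts a" "y \<in> elts c" "y' \<in> elts c"
    have "binf (elts a) (\<lambda>x'. graph_val f x' y') = truth (\<exists>x'\<in>elts a. R x' y')"
      unfolding binf_truth[symmetric] by (rule binf_cong) (simp add: v e)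
    moreover have "\<exists>x'\<in>elts a. R x' y'" if "R x y" "le y' y"
      using partial_iso_down'[OF R(2) that(1) e(3) that(2)] partial_iso_dom[OF R(2)] by blast
    ultimately show "min (1 - graph_val f x y) (min (1 - le_val y' y) (binf (elts a) (\<lambda>x'. graph_val f x' y'))) \<le> 0"
      using e by (simp add: v tl) (auto simp: truth_def)
  qed
  moreover have "iso_defect5 f a c \<le> 0" unfolding iso_defect5_def
  proof (intro bsup_least order_refl)
    fix x y x' y' assume e: "x \<in> elts a" "y \<in> elts c" "x' \<in> elts a" "y' \<in> elts c"
    have imp: "R x' y'" if "R x y" "le x x' \<and> le x' x" "le y y' \<and> le y' y"
      by (rule partial_iso_alike[OF R(2) that(1) e(3,4)]) (use that(2,3) in \<open>simp_all add: alike_def\<close>)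
    show "min (1 - graph_val f x y) (min (1 - max (le_val x x') (le_val x' x))
       (min (1 - max (le_val y y') (le_val y' y)) (graph_val f x' y'))) \<le> 0"
      unfolding v[OF e(1,2)] v[OF e(3,4)] le_val_truth[OF a e(1,3)] le_val_truth[OF a e(3,1)]
        le_val_truth[OF c e(2,4)] le_val_truth[OF c e(4,2)] truth_conj truth_not truth_disj bv0
      using imp by blast
  qed
  ultimately have "iso_defect f a c \<le> 0" by (simp add: iso_defect_def)
  moreover have "graph_val f x y \<le> 0" using v partial_iso_dom[OF R(2,3)] R(3) by simp
  ultimately show ?thesis using f(1) by blast
qed

text \<open>A defect below 1/3 forces each value of the coded relation below 1/3 or above 2/3, and
then the relation obtained by cutting at 1/2 satisfies all the conditions exactly.\<close>
lemma iso_defect_imp_max_iso: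
  assumes a: "a \<in> W" and c: "c \<in> W" and f: "f \<in> M" and t: "iso_defect f a c < 1 / 3"
    and xy: "x \<in> elts a" "y \<in> elts c" "graph_val f x y < 1 / 3"
  shows "max_iso a c x y"
proof -
  define R where "R x y \<longleftrightarrow> x \<in> elts a \<and> y \<in> elts c \<and> graph_val f x y < 1 / 2" for x y
  have t12345: "iso_defect1 f a c < 1/3" "iso_defect2 f a c < 1/3" "iso_defect3 f a c < 1/3" "iso_defect4 f a c < 1/3" "iso_defect5 f a c < 1/3"
    using t by (simp_all add: iso_defect_def)
  note tl = le_val_truth[OF a] le_val_truth[OF c]
  have m1: "min (1 - graph_val f x y) v \<le> 1" for x y v using graph_val_01(1)[of f x y] by linarith
  have i1: "min (1 - graph_val f x y) (graph_val f x y) < 1/3" if "x \<in> elts a" "y \<in> elts c" for x y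
    by (rule bsup_lessD[OF bsup_lessD[OF t12345(1)[unfolded iso_defect1_def] _ that(1)] _ that(2)])
       (intro bsup_le_1 m1)+
  have R13: "graph_val f x y < 1/3" "1 - graph_val f x y > 2/3" if "R x y" for x y
    using i1[of x y] that by (auto simp: R_def)
  have i2: "rxor (le_val x x') (le_val y y') < 1/3" if R: "R x y" "R x' y'" for x y x' y'
  proof -
    have e: "x \<in> elts a" "y \<in> elts c" "x' \<in> elts a" "y' \<in> elts c" using R by (auto simp: R_def)
    have "min (1 - graph_val f x y) (min (1 - graph_val f x' y') (rxor (le_val x x') (le_val y y'))) < 1/3"
      by (rule bsup_lessD[OF bsup_lessD[OF bsup_lessD[OF bsup_lessD[OF t12345(2)[unfolded iso_defect2_def]
            _ e(1)] _ e(2)] _ e(3)] _ e(4)]) (intro bsup_le_1 m1)+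
    thus ?thesis using R13[OF R(1)] R13[OF R(2)] by linarith
  qed
  have i3: "\<exists>y'. R x' y'" if R: "R x y" "x' \<in> elts a" "le x' x" for x y x'
  proof -
    have e: "x \<in> elts a" "y \<in> elts c" "x' \<in> elts a" using R by (auto simp: R_def)
    have "min (1 - graph_val f x y) (min (1 - le_val x' x) (binf (elts c) (\<lambda>y'. graph_val f x' y'))) < 1/3"
      by (rule bsup_lessD[OF bsup_lessD[OF bsup_lessD[OF t12345(3)[unfolded iso_defect3_def]
            _ e(1)] _ e(2)] _ e(3)]) (intro bsup_le_1 m1)+
    moreover have "le_val x' x = 0" using tl e R by simp
    ultimately have "binf (elts c) (\<lambda>y'. graph_val f x' y') < 1/3" using R13[OF R(1)] by linarith
    then obtain y' where "y' \<in> elts c" "graph_val f x' y' < 1/3" using binf_lessD by fastforce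
    thus ?thesis using e by (intro exI[of _ y']) (simp add: R_def)
  qed
  have i4: "\<exists>x'. R x' y'" if R: "R x y" "y' \<in> elts c" "le y' y" for x y y'
  proof -
    have e: "x \<in> elts a" "y \<in> elts c" "y' \<in> elts c" using R by (auto simp: R_def)
    have "min (1 - graph_val f x y) (min (1 - le_val y' y) (binf (elts a) (\<lambda>x'. graph_val f x' y'))) < 1/3"
      by (rule bsup_lessD[OF bsup_lessD[OF bsup_lessD[OF t12345(4)[unfolded iso_defect4_def]
            _ e(1)] _ e(2)] _ e(3)]) (intro bsup_le_1 m1)+
    moreover have "le_val y' y = 0" using tl e R by simp
    ultimately have "binf (elts a) (\<lambda>x'. graph_val f x' y') < 1/3" using R13[OF R(1)] by linarith
    then obtain x' where "x' \<in> elts a" "graph_val f x' y' < 1/3" using binf_lessD by fastforce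
    thus ?thesis using e by (intro exI[of _ x']) (simp add: R_def)
  qed
  have i5: "R x' y'" if R: "R x y" "x' \<in> elts a" "y' \<in> elts c" "alike x x'" "alike y y'" for x y x' y'
  proof -
    have e: "x \<in> elts a" "y \<in> elts c" "x' \<in> elts a" "y' \<in> elts c" using R by (auto simp: R_def)
    have "min (1 - graph_val f x y) (min (1 - max (le_val x x') (le_val x' x))
       (min (1 - max (le_val y y') (le_val y' y)) (graph_val f x' y'))) < 1/3"
      by (rule bsup_lessD[OF bsup_lessD[OF bsup_lessD[OF bsup_lessD[OF t12345(5)[unfolded iso_defect5_def]
            _ e(1)] _ e(2)] _ e(3)] _ e(4)]) (intro bsup_le_1 m1)+
    moreover have "le_val x x' = 0" "le_val x' x = 0" "le_val y y' = 0" "le_val y' y = 0"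
      using tl e R by (simp_all add: alike_def)
    ultimately have "graph_val f x' y' < 1/3" using R13[OF R(1)] by (simp add: min_def split: if_splits)
    thus ?thesis using e by (simp add: R_def)
  qed
  have "sharp_rel a c R" unfolding sharp_rel_def
  proof (rule sharp_thresh[of "\<lambda>e. graph_val f (e 0) (e (Suc 0))" "1/3" "1/2"])
    show "definable (\<lambda>e. graph_val f (e 0) (e (Suc 0)))" by (intro definable_graph_val simple_var simple_const f)
    fix e :: "nat \<Rightarrow> 'a" assume "e 0 \<in> elts a \<and> e (Suc 0) \<in> elts c"
    thus "R (e 0) (e (Suc 0)) \<Longrightarrow> graph_val f (e 0) (e (Suc 0)) \<le> 1 / 3"
      "\<not> R (e 0) (e (Suc 0)) \<Longrightarrow> 1 / 2 \<le> graph_val f (e 0) (e (Suc 0))"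
      using R13(1)[of "e 0" "e (Suc 0)"] by (auto simp: R_def)
  qed simp
  moreover have "partial_iso a c R"
  proof (rule partial_isoI)
    show "x \<in> elts a \<and> y \<in> elts c" if "R x y" for x y using that by (simp add: R_def)
    fix x y x' y' assume R: "R x y" "R x' y'"
    have "rxor (le_val x x') (le_val y y') = truth (le x x' \<longleftrightarrow> le y y')"
      using tl R by (simp add: rxor_truth R_def)
    thus "le x x' \<longleftrightarrow> le y y'" using i2[OF R] by (auto simp: truth_def split: if_splits)
  qed (use i3 i4 i5 in auto)
  moreover have "R x y" using xy by (simp add: R_def)
  ultimately show ?thesis unfolding max_iso_def by blast
qed

text \<open>The two preceding lemmas leave a gap between 0 and 1/3, so that the existential
quantifier over codes of isomorphisms is sharp. This makes the comparison of order types available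
inside comprehension.\<close>
lemma max_iso_sharp:
  "sharp (\<lambda>e. e 0 \<in> W \<and> e (Suc 0) \<in> W \<and> e (Suc (Suc 0)) \<in> elts (e 0) \<and> e (Suc (Suc (Suc 0))) \<in> elts (e (Suc 0)))
     (\<lambda>e. max_iso (e 0) (e (Suc 0)) (e (Suc (Suc 0))) (e (Suc (Suc (Suc 0)))))"
proof (rule sharp_exM[of "\<lambda>e f. max (iso_defect f (e 0) (e (Suc 0))) (graph_val f (e (Suc (Suc 0))) (e (Suc (Suc (Suc 0)))))" 0 "1/3"])
  show "definable (\<lambda>e. max (iso_defect (e 0) (e (Suc 0)) (e (Suc (Suc 0)))) (graph_val (e 0) (e (Suc (Suc (Suc 0)))) (e (Suc (Suc (Suc (Suc 0)))))))"
    by (intro definable_max definable_iso_defect definable_graph_val simple_var)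
qed (use max_iso_imp_iso_defect iso_defect_imp_max_iso in auto)

lemma max_iso_at:
  assumes "simple a" "simple c" "simple s" "simple t"
    "\<And>e. envM e \<Longrightarrow> D e \<Longrightarrow> a e \<in> W \<and> c e \<in> W \<and> s e \<in> elts (a e) \<and> t e \<in> elts (c e)"
  shows "sharp D (\<lambda>e. max_iso (a e) (c e) (s e) (t e))"
  using sharp_subst[OF max_iso_sharp, of "case_nat a (case_nat c (case_nat s (\<lambda>_. t)))" D] assms
  by (simp split: nat.split)

lemma max_iso_sharp_rel: "a \<in> W \<Longrightarrow> c \<in> W \<Longrightarrow> sharp_rel a c (max_iso a c)"
  unfolding sharp_rel_def by (rule max_iso_at) (auto intro: simple_var simple_const W_M)

section \<open>Comparison of order types\<close>

text \<open>Comparability of well-orders: otherwise the least element missing from the domain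
and the least one missing from the range could be matched.\<close>
lemma max_iso_total:
  assumes a: "a \<in> W" and c: "c \<in> W"
  shows "(\<forall>x\<in>elts a. \<exists>y\<in>elts c. max_iso a c x y) \<or> (\<forall>y\<in>elts c. \<exists>x\<in>elts a. max_iso a c x y)"
proof (rule ccontr)
  assume "\<not> ?thesis"
  then obtain x0 y0 where 0: "x0 \<in> elts a" "\<not> (\<exists>y\<in>elts c. max_iso a c x0 y)"
    "y0 \<in> elts c" "\<not> (\<exists>x\<in>elts a. max_iso a c x y0)" by blast
  have aM: "a \<in> M" and cM: "c \<in> M" using W_M a c by blast+
  note G = max_iso_partial_iso[OF a c]
  have "sharp_set a (\<lambda>x. \<not> (\<exists>y\<in>elts c. max_iso a c x y))" unfolding sharp_set_def
    by (intro sharp_not sharp_bex sharp_rel_at[OF max_iso_sharp_rel[OF a c]] simple_var simple_const cM) auto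
  then obtain x where x: "x \<in> elts a" "\<And>y. \<not> max_iso a c x y"
      "\<And>x'. x' \<in> elts a \<Longrightarrow> \<not> le x x' \<Longrightarrow> \<exists>y. max_iso a c x' y"
    using wo_least[OF a _ 0(1), of "\<lambda>x. \<not> (\<exists>y\<in>elts c. max_iso a c x y)"] 0(2) partial_iso_dom[OF G] by blast
  have "sharp_set c (\<lambda>y. \<not> (\<exists>x\<in>elts a. max_iso a c x y))" unfolding sharp_set_def
    by (intro sharp_not sharp_bex sharp_rel_at[OF max_iso_sharp_rel[OF a c]] simple_var simple_const aM) auto
  then obtain y where y: "y \<in> elts c" "\<And>x. \<not> max_iso a c x y"
      "\<And>y'. y' \<in> elts c \<Longrightarrow> \<not> le y y' \<Longrightarrow> \<exists>x. max_iso a c x y'"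
    using wo_least[OF c _ 0(3), of "\<lambda>y. \<not> (\<exists>x\<in>elts a. max_iso a c x y)"] 0(4) partial_iso_dom[OF G] by blast
  have xM: "x \<in> M" and yM: "y \<in> M" using x y elts_M by blast+
  have below: "\<not> le x x1 \<and> le x1 x \<and> \<not> le y y1 \<and> le y1 y" if "max_iso a c x1 y1" for x1 y1
    using partial_iso_down[OF G that x(1)] partial_iso_down'[OF G that y(1)] x(1,2) y(1,2)
      le_total[OF a x(1), of x1] le_total[OF c y(1), of y1] partial_iso_dom[OF G that] by blast
  define R where "R x1 y1 \<longleftrightarrow> max_iso a c x1 y1 \<or>
      (x1 \<in> elts a \<and> y1 \<in> elts c) \<and> (le x1 x \<and> le x x1) \<and> (le y1 y \<and> le y y1)" for x1 y1
  have "sharp_rel a c R" unfolding sharp_rel_def R_def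
    by (intro sharp_disj sharp_conj sharp_rel_at[OF max_iso_sharp_rel[OF a c]] simple_var simple_const xM yM
        le_in[OF a, of "\<lambda>e. e 0"] le_in[OF a, of "\<lambda>_. x"]
        le_in[OF c, of "\<lambda>e. e (Suc 0)"] le_in[OF c, of "\<lambda>_. y"])
       (auto intro: x y sharp_triv)
  moreover have "partial_iso a c R"
  proof (rule partial_isoI)
    note ta = le_trans[OF a] and tc = le_trans[OF c]
    show dom: "x1 \<in> elts a \<and> y1 \<in> elts c" if "R x1 y1" for x1 y1
      using that partial_iso_dom[OF G] by (auto simp: R_def)
    show "le x1 x2 \<longleftrightarrow> le y1 y2" if R12: "R x1 y1" "R x2 y2" for x1 y1 x2 y2
    proof -
      have d: "x1 \<in> elts a" "y1 \<in> elts c" "x2 \<in> elts a" "y2 \<in> elts c" using dom R12 by blast+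
      consider "max_iso a c x1 y1" "max_iso a c x2 y2" | "max_iso a c x1 y1" "le x2 x \<and> le x x2" "le y2 y \<and> le y y2"
        | "le x1 x \<and> le x x1" "le y1 y \<and> le y y1" "max_iso a c x2 y2"
        | "le x1 x \<and> le x x1" "le y1 y \<and> le y y1" "le x2 x \<and> le x x2" "le y2 y \<and> le y y2"
        using R12 unfolding R_def by blast
      thus ?thesis
      proof cases
        case 1 thus ?thesis by (rule partial_iso_le[OF G])
      next
        case 2
        have "le x1 x2" using below[OF 2(1)] 2(2) ta[OF d(1,3), of x] by blast
        moreover have "le y1 y2" using below[OF 2(1)] 2(3) tc[OF d(2,4), of y] by blast
        ultimately show ?thesis by blast
      next
        case 3
        have "\<not> le x1 x2" using below[OF 3(3)] 3(1) ta[OF x(1) d(3), of x1] by blast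
        moreover have "\<not> le y1 y2" using below[OF 3(3)] 3(2) tc[OF y(1) d(4), of y1] by blast
        ultimately show ?thesis by blast
      next
        case 4
        have "le x1 x2" using 4 ta[OF d(1,3), of x] by blast
        moreover have "le y1 y2" using 4 tc[OF d(2,4), of y] by blast
        ultimately show ?thesis by blast
      qed
    qed
    show "\<exists>y2. R x2 y2" if "R x1 y1" "x2 \<in> elts a" "le x2 x1" for x1 y1 x2
    proof (cases "max_iso a c x1 y1")
      case True thus ?thesis using partial_iso_down[OF G _ that(2,3)] by (auto simp: R_def)
    next
      case False
      hence o: "le x1 x" "le x x1" "y1 \<in> elts c" "le y1 y" "le y y1" "x1 \<in> elts a" using that(1) by (auto simp: R_def)
      have "le x2 x" using ta[OF that(2) x(1) that(3) o(1)] .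
      thus ?thesis using x(3)[OF that(2)] o that(2) unfolding R_def by blast
    qed
    show "\<exists>x2. R x2 y2" if "R x1 y1" "y2 \<in> elts c" "le y2 y1" for x1 y1 y2
    proof (cases "max_iso a c x1 y1")
      case True thus ?thesis using partial_iso_down'[OF G _ that(2,3)] by (auto simp: R_def)
    next
      case False
      hence o: "le x1 x" "le x x1" "y1 \<in> elts c" "le y1 y" "le y y1" "x1 \<in> elts a" using that(1) by (auto simp: R_def)
      have "le y2 y" using tc[OF that(2) y(1) that(3) o(4)] .
      thus ?thesis using y(3)[OF that(2)] o that(2) unfolding R_def by blast
    qed
    show "R x2 y2" if "R x1 y1" "x2 \<in> elts a" "y2 \<in> elts c" "alike x1 x2" "alike y1 y2" for x1 y1 x2 y2
    proof (cases "max_iso a c x1 y1")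
      case True thus ?thesis using partial_iso_alike[OF G _ that(2-5)] by (simp add: R_def)
    next
      case False
      hence o: "le x1 x" "le x x1" "y1 \<in> elts c" "le y1 y" "le y y1" "x1 \<in> elts a" using that(1) by (auto simp: R_def)
      have "le x2 x" "le x x2" "le y2 y" "le y y2"
        using ta[OF that(2) x(1), of x1] ta[OF x(1) that(2), of x1] tc[OF that(3) y(1), of y1]
          tc[OF y(1) that(3), of y1] o that(4,5) unfolding alike_def by blast+
      thus ?thesis using that by (simp add: R_def)
    qed
  qed
  moreover have "R x y" using x(1) y(1) le_refl xM yM by (simp add: R_def)
  ultimately show False using x(2) unfolding max_iso_def by blast
qed

lemma max_iso_comp:
  assumes a: "a \<in> W" and b: "b \<in> W" and c: "c \<in> W" and g: "max_iso a b x y" "max_iso b c y z"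
  shows "max_iso a c x z"
proof -
  note G = max_iso_partial_iso[OF a b] and H = max_iso_partial_iso[OF b c]
  let ?R = "\<lambda>x z. \<exists>y\<in>elts b. max_iso a b x y \<and> max_iso b c y z"
  have R: "?R x z" if "max_iso a b x y" "max_iso b c y z" for x y z using that partial_iso_dom[OF G] by blast
  have "sharp_rel a c ?R" unfolding sharp_rel_def
    by (intro sharp_bex sharp_conj sharp_rel_at[OF max_iso_sharp_rel[OF a b]] sharp_rel_at[OF max_iso_sharp_rel[OF b c]] simple_var simple_const W_M[OF b]) auto
  moreover have "partial_iso a c ?R"
  proof (rule partial_isoI)
    show "x \<in> elts a \<and> z \<in> elts c" if "?R x z" for x z using that partial_iso_dom[OF G] partial_iso_dom[OF H] by blast
    show "le x x' \<longleftrightarrow> le z z'" if "?R x z" "?R x' z'" for x z x' z'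
      using that partial_iso_le[OF G] partial_iso_le[OF H] by metis
    show "\<exists>z'. ?R x' z'" if xz: "?R x z" "x' \<in> elts a" "le x' x" for x z x'
    proof -
      obtain y where y: "max_iso a b x y" "max_iso b c y z" using xz by blast
      obtain y' where y': "max_iso a b x' y'" using partial_iso_down[OF G y(1) xz(2,3)] by blast
      have "le y' y" using partial_iso_le[OF G y' y(1)] xz(3) by blast
      then obtain z' where "max_iso b c y' z'" using partial_iso_down[OF H y(2)] partial_iso_dom[OF G y'] by blast
      thus ?thesis using R[OF y'] by blast
    qed
    show "\<exists>x'. ?R x' z'" if xz: "?R x z" "z' \<in> elts c" "le z' z" for x z z'
    proof -
      obtain y where y: "max_iso a b x y" "max_iso b c y z" using xz by blast
      obtain y' where y': "max_iso b c y' z'" using partial_iso_down'[OF H y(2) xz(2,3)] by blast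
      have "le y' y" using partial_iso_le[OF H y' y(2)] xz(3) by blast
      then obtain x' where "max_iso a b x' y'" using partial_iso_down'[OF G y(1)] partial_iso_dom[OF H y'] by blast
      thus ?thesis using R[OF _ y'] by blast
    qed
    show "?R x' z'" if xz: "?R x z" "x' \<in> elts a" "z' \<in> elts c" "alike x x'" "alike z z'" for x z x' z'
    proof -
      obtain y where y: "y \<in> elts b" "max_iso a b x y" "max_iso b c y z" using xz by blast
      have e: "alike y y" using le_refl elts_M y(1) by (simp add: alike_def)
      have "max_iso a b x' y" by (rule partial_iso_alike[OF G y(2) xz(2) y(1) xz(4) e])
      moreover have "max_iso b c y z'" by (rule partial_iso_alike[OF H y(3) y(1) xz(3) e xz(5)])
      ultimately show ?thesis using y(1) by blast
    qed
  qed
  ultimately show ?thesis unfolding max_iso_def[of a c] using R[OF g] by blast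
qed

lemma max_iso_segment:
  assumes a: "a \<in> W" and b: "b \<in> W" and sub: "elts a \<subseteq> elts b"
    and down: "\<And>x y. x \<in> elts a \<Longrightarrow> y \<in> elts b \<Longrightarrow> le y x \<Longrightarrow> y \<in> elts a" and z: "z \<in> elts a"
  shows "max_iso a b z z"
proof -
  let ?R = "\<lambda>x y. (x \<in> elts a \<and> y \<in> elts b) \<and> (le x y \<and> le y x)"
  have "sharp_rel a b ?R" unfolding sharp_rel_def
    by (intro sharp_conj le_in[OF b] simple_var) (use sub in \<open>auto intro: sharp_triv\<close>)
  moreover have "partial_iso a b ?R"
  proof (rule partial_isoI)
    note t = le_trans[OF b]
    show "le x x' \<longleftrightarrow> le y y'" if "?R x y" "?R x' y'" for x y x' y'
      using that t sub by (meson subsetD)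
    show "?R x' y'" if "?R x y" "x' \<in> elts a" "y' \<in> elts b" "alike x x'" "alike y y'" for x y x' y'
      using that t sub unfolding alike_def by (meson subsetD)
    show "\<exists>y'. ?R x' y'" if "x' \<in> elts a" for x' using that sub le_refl elts_M by blast
    show "\<exists>x'. ?R x' y'" if R: "?R x y" and y': "y' \<in> elts b" "le y' y" for x y y'
    proof -
      have "le y' x" by (rule t[OF y'(1) _ y'(2)]) (use R sub in auto)
      hence "y' \<in> elts a" using down R y' by blast
      thus ?thesis using y'(1) le_refl elts_M by blast
    qed
  qed auto
  ultimately show ?thesis unfolding max_iso_def using z sub le_refl elts_M by blast
qed

lemma max_iso_refl: "a \<in> W \<Longrightarrow> x \<in> elts a \<Longrightarrow> max_iso a a x x"
  by (rule max_iso_segment) auto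

text \<open>That is, \<open>a\<close> is isomorphic, up to likeness, to an initial segment of \<open>c\<close>.\<close>
definition type_le :: "'a \<Rightarrow> 'a \<Rightarrow> bool" where
  "type_le a c \<longleftrightarrow> (\<forall>x\<in>elts a. \<exists>y\<in>elts c. max_iso a c x y)"

lemma type_le_refl: "a \<in> W \<Longrightarrow> type_le a a"
  unfolding type_le_def using max_iso_refl by blast

lemma type_le_trans: assumes "a \<in> W" "b \<in> W" "c \<in> W" "type_le a b" "type_le b c" shows "type_le a c"
  unfolding type_le_def
proof
  fix x assume "x \<in> elts a"
  then obtain y where y: "y \<in> elts b" "max_iso a b x y" using assms(4) unfolding type_le_def by blast
  then obtain z where "z \<in> elts c" "max_iso b c y z" using assms(5) unfolding type_le_def by blast
  thus "\<exists>z\<in>elts c. max_iso a c x z" using max_iso_comp[OF assms(1-3) y(2)] by blast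
qed

lemma type_le_total: assumes "a \<in> W" "c \<in> W" shows "type_le a c \<or> type_le c a"
  using max_iso_total[OF assms] max_iso_sym unfolding type_le_def by blast

lemma type_le_at:
  assumes "simple s" "simple t" "\<And>e. envM e \<Longrightarrow> D e \<Longrightarrow> s e \<in> W \<and> t e \<in> W"
  shows "sharp D (\<lambda>e. type_le (s e) (t e))"
  unfolding type_le_def
  apply (intro sharp_ball sharp_bex max_iso_at simple_var simple_shift assms(1,2))
  subgoal for e using assms(3)[OF envM_comp, of e "\<lambda>i. Suc (Suc i)"] by simp
  done

text \<open>If \<open>d a c < \<kappa>\<close>, pair up the elements of \<open>a\<close> and \<open>c\<close> that are closer than \<open>\<kappa>'\<close>. Hypothesis \<open>H\<close> bounds
by how much this pairing distorts inclusion. As long as the distortion stays below the gap \<open>\<rho>\<close>, the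
pairing is an isomorphism. In a general metric \<open>H\<close> costs \<open>2 * \<kappa>'\<close>, in an ultrametric only \<open>\<kappa>'\<close>; this is
the source of the factor 1/2 in the theorem.\<close>
lemma near_type_le:
  assumes a: "wo_pre \<rho> a" and c: "wo_pre \<rho> c" and \<rho>: "3 * h \<le> \<rho>"
    and dac: "d a c < \<kappa>" and \<kappa>1: "\<kappa> \<le> 1" and \<kappa>: "\<kappa> + 4 * h \<le> \<kappa>'"
    and H: "\<And>x x' y y'. x \<in> M \<Longrightarrow> x' \<in> M \<Longrightarrow> y \<in> M \<Longrightarrow> y' \<in> M \<Longrightarrow> d x y < \<kappa>' \<Longrightarrow> d x' y' < \<kappa>' \<Longrightarrow>
        excess x x' < h \<Longrightarrow> excess y y' < \<rho>"
  shows "type_le a c"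
proof -
  have aW: "a \<in> W" and cW: "c \<in> W" using wo_pre_mono[OF a \<rho>] wo_pre_mono[OF c \<rho>] by auto
  have aM: "a \<in> M" and cM: "c \<in> M" using W_M aW cW by blast+
  have gapa: "le x y" if "x \<in> elts a" "y \<in> elts a" "excess x y < \<rho>" for x y
    using a that unfolding wo_pre_def by force
  have gapc: "le x y" if "x \<in> elts c" "y \<in> elts c" "excess x y < \<rho>" for x y
    using c that unfolding wo_pre_def by force
  have toc: "\<exists>y\<in>elts c. d x y < \<kappa>" if "x \<in> elts a" for x
    using dist_to_le_excess[OF that, of c] excess_le_d[OF aM cM] dac \<kappa>1 by (intro dist_to_lessD) auto
  have toa: "\<exists>x\<in>elts a. d x y < \<kappa>" if "y \<in> elts c" for y
  proof -
    have "dist_to y a < \<kappa>" using dist_to_le_excess[OF that, of a] excess_le_d[OF cM aM] dac commute[of c a] by simp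
    thus ?thesis using dist_to_lessD[OF _ \<kappa>1] commute by metis
  qed
  define R where "R x y \<longleftrightarrow> (x \<in> elts a \<and> y \<in> elts c) \<and> d x y < \<kappa>'" for x y
  have small: "d x y < \<kappa> + h" if "R x y" for x y
  proof -
    have xy: "x \<in> elts a" "y \<in> elts c" "d x y < \<kappa>'" using that by (auto simp: R_def)
    obtain y' where y': "y' \<in> elts c" "d x y' < \<kappa>" using toc xy by blast
    note m = elts_M[OF xy(1)] elts_M[OF xy(2)] elts_M[OF y'(1)]
    have "d x y' < \<kappa>'" using y' \<kappa> h_pos by linarith
    have e: "excess x x < h" using h_pos m by (simp add: excess_refl)
    have "excess y y' < \<rho>" "excess y' y < \<rho>"
      using H[OF m(1) m(1) m(2,3) xy(3) \<open>d x y' < \<kappa>'\<close> e] H[OF m(1) m(1) m(3,2) \<open>d x y' < \<kappa>'\<close> xy(3) e] .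
    hence "alike y' y" using gapc xy y' by (simp add: alike_def)
    hence "d y' y < h" using d_alike m by blast
    thus ?thesis using y'(2) triangle[of x y' y] m by linarith
  qed
  have R\<kappa>: "R x y" if "x \<in> elts a" "y \<in> elts c" "d x y < \<kappa> + 3 * h" for x y
    using that \<kappa> h_pos by (simp add: R_def)
  have "sharp_rel a c R" unfolding sharp_rel_def
  proof (rule sharp_thresh[of "\<lambda>e. d (e 0) (e (Suc 0))" "\<kappa> + h" \<kappa>'])
    fix e :: "nat \<Rightarrow> 'a" assume "e 0 \<in> elts a \<and> e (Suc 0) \<in> elts c"
    thus "R (e 0) (e (Suc 0)) \<Longrightarrow> d (e 0) (e (Suc 0)) \<le> \<kappa> + h"
      "\<not> R (e 0) (e (Suc 0)) \<Longrightarrow> \<kappa>' \<le> d (e 0) (e (Suc 0))"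
      using small[of "e 0" "e (Suc 0)"] by (auto simp: R_def)
  qed (use \<kappa> h_pos in \<open>auto intro: definable_d\<close>)
  moreover have "partial_iso a c R"
  proof (rule partial_isoI)
    show "x \<in> elts a \<and> y \<in> elts c" if "R x y" for x y using that by (simp add: R_def)
    show "le x x' \<longleftrightarrow> le y y'" if r: "R x y" "R x' y'" for x y x' y'
    proof
      have i: "x \<in> elts a" "y \<in> elts c" "x' \<in> elts a" "y' \<in> elts c" "d x y < \<kappa>'" "d x' y' < \<kappa>'"
        using r by (auto simp: R_def)
      note m = elts_M[OF i(1)] elts_M[OF i(2)] elts_M[OF i(3)] elts_M[OF i(4)]
      show "le y y'" if "le x x'"
        by (rule gapc[OF i(2,4)]) (use H[OF m(1,3,2,4) i(5,6)] that in \<open>simp add: le_def\<close>)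
      show "le x x'" if "le y y'"
        by (rule gapa[OF i(1,3)])
           (use H[OF m(2,4,1,3)] i(5,6) commute[of y x] commute[of y' x'] that in \<open>simp add: le_def\<close>)
    qed
    show "\<exists>y'. R x' y'" if "x' \<in> elts a" for x'
      using toc[OF that] R\<kappa>[OF that] h_pos by fastforce
    show "\<exists>x'. R x' y'" if "y' \<in> elts c" for y'
      using toa[OF that] R\<kappa>[OF _ that] h_pos by fastforce
    show "R x' y'" if r: "R x y" "x' \<in> elts a" "y' \<in> elts c" "alike x x'" "alike y y'" for x y x' y'
    proof (rule R\<kappa>[OF r(2,3)])
      have i: "x \<in> elts a" "y \<in> elts c" using r by (auto simp: R_def)
      note m = elts_M[OF i(1)] elts_M[OF i(2)] elts_M[OF r(2)] elts_M[OF r(3)]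
      have "d x' y' \<le> d x' x + (d x y + d y y')"
        using triangle[of x' x y'] triangle[of x y y'] m by linarith
      moreover have "d x' x < h" "d y y' < h" using r(4,5) d_alike m alike_sym by blast+
      ultimately show "d x' y' < \<kappa> + 3 * h" using small[OF r(1)] by linarith
    qed
  qed
  ultimately have g: "max_iso a c x y" if "R x y" for x y using that unfolding max_iso_def by blast
  show ?thesis unfolding type_le_def
  proof
    fix x assume x: "x \<in> elts a"
    then obtain y where "y \<in> elts c" "d x y < \<kappa>" using toc by blast
    thus "\<exists>y\<in>elts c. max_iso a c x y" using g[OF R\<kappa>[OF x]] h_pos by force
  qed
qed

text \<open>The well-ordering of order types. For \<open>p0\<close> in the class, a member that does not lie above \<open>p0\<close>
misses some element of \<open>p0\<close>; a member that misses the least possible element of \<open>p0\<close> is least.\<close>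
lemma type_le_least:
  assumes b: "b \<in> M" and bW: "elts b \<subseteq> W" and P: "sharp_set b P" and p0: "p0 \<in> elts b" "P p0"
  shows "\<exists>p\<in>elts b. P p \<and> (\<forall>q\<in>elts b. P q \<longrightarrow> type_le p q)"
proof (cases "\<forall>q\<in>elts b. P q \<longrightarrow> type_le p0 q")
  case True thus ?thesis using p0 by blast
next
  case False
  then obtain q0 where q0: "q0 \<in> elts b" "P q0" "\<not> type_le p0 q0" by blast
  have pW: "p0 \<in> W" using p0 bW by blast
  have pM: "p0 \<in> M" using W_M pW by blast
  define Q where "Q x \<longleftrightarrow> (\<exists>q\<in>elts b. P q \<and> \<not> (\<exists>y\<in>elts q. max_iso p0 q x y))" for x
  have Q: "sharp_set p0 Q" unfolding sharp_set_def Q_def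
    by (intro sharp_bex sharp_conj sharp_not max_iso_at sharp_set_at[OF P] simple_var simple_const b pM) (use bW pW in auto)
  obtain x0 where x0: "x0 \<in> elts p0" "Q x0" using q0 unfolding type_le_def Q_def by blast
  obtain x where x: "x \<in> elts p0" "Q x" "\<And>x'. x' \<in> elts p0 \<Longrightarrow> Q x' \<Longrightarrow> le x x'"
    using wo_least[OF pW Q x0] by blast
  obtain q where q: "q \<in> elts b" "P q" "\<not> (\<exists>y\<in>elts q. max_iso p0 q x y)" using x(2) unfolding Q_def by blast
  have qW: "q \<in> W" using q bW by blast
  note G = max_iso_partial_iso[OF pW qW]
  have "type_le q q'" if q': "q' \<in> elts b" "P q'" for q'
  proof (rule ccontr)
    assume "\<not> type_le q q'"
    then obtain y where y: "y \<in> elts q" "\<not> (\<exists>z\<in>elts q'. max_iso q q' y z)" unfolding type_le_def by blast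
    have q'W: "q' \<in> W" using q' bW by blast
    have "\<not> type_le p0 q" using q(3) x(1) unfolding type_le_def by blast
    hence "type_le q p0" using type_le_total[OF pW qW] by blast
    then obtain x' where x': "x' \<in> elts p0" "max_iso q p0 y x'" using y(1) unfolding type_le_def by blast
    have "Q x'" unfolding Q_def
    proof (intro bexI[of _ q'] conjI notI)
      assume "\<exists>z\<in>elts q'. max_iso p0 q' x' z"
      then obtain z where "z \<in> elts q'" "max_iso p0 q' x' z" by blast
      thus False using y(2) max_iso_comp[OF qW pW q'W x'(2)] by blast
    qed (use q' in auto)
    hence "le x x'" using x(3) x'(1) by blast
    then obtain y2 where "max_iso p0 q x y2" using partial_iso_down[OF G max_iso_sym[OF x'(2)] x(1)] by blast
    thus False using q(3) partial_iso_dom[OF G] by blast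
  qed
  thus ?thesis using q by blast
qed

end

section \<open>Uniformly discrete chains and their isomorphisms\<close>

context mse_model
begin

text \<open>Of two comparable sets the larger one carries the whole Hausdorff distance.\<close>
lemma sub_excess: assumes "chain a" "discrete r a" "x \<in> elts a" "y \<in> elts a" "\<not> x \<sqsubseteq> y"
  shows "r \<le> excess x y"
proof -
  have M: "x \<in> M" "y \<in> M" using assms elts_M by blast+
  have "y \<sqsubseteq> x" using assms unfolding chain_def by blast
  hence "excess y x = 0" using excess_eq_0_iff M by blast
  moreover have "x \<noteq> y" using assms(5) by (auto simp: subset_rel_def)
  hence "r \<le> d x y" using assms unfolding discrete_def by blast
  ultimately show ?thesis using d_eq_excess[OF M] excess_ge_0[of x y] by simp
qed

lemma ud_chainE: assumes "ud_chain a" obtains r where "0 < r" "discrete r a" "chain a" "a \<in> M"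
  using assms unfolding ud_chain_def uniformly_discrete_def chain_def by blast

lemma discrete_mono: "discrete r a \<Longrightarrow> r' \<le> r \<Longrightarrow> discrete r' a"
  unfolding discrete_def by (meson order_trans)

lemma discrete_sub: "discrete r a \<Longrightarrow> b \<sqsubseteq> a \<Longrightarrow> discrete r b"
  unfolding discrete_def subset_rel_def by blast

lemma sub_at:
  assumes a: "ud_chain a" and simple: "simple s" "simple t"
    and D: "\<And>e. envM e \<Longrightarrow> D e \<Longrightarrow> s e \<in> elts a \<and> t e \<in> elts a"
  shows "sharp D (\<lambda>e. s e \<sqsubseteq> t e)"
proof -
  obtain r where r: "0 < r" "discrete r a" "chain a" by (rule ud_chainE[OF a])
  show ?thesis
  proof (rule sharp_thresh[OF definable_excess[OF simple] r(1)])
    fix e assume e: "envM e" "D e"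
    show "s e \<sqsubseteq> t e \<Longrightarrow> excess (s e) (t e) \<le> 0" using excess_eq_0_iff[OF simple_M[OF simple(1) e(1)] simple_M[OF simple(2) e(1)]] by simp
    show "\<not> s e \<sqsubseteq> t e \<Longrightarrow> r \<le> excess (s e) (t e)" using sub_excess[OF r(3,2)] D[OF e] by blast
  qed
qed

lemma eq_at:
  assumes a: "ud_chain a" and simple: "simple s" "simple t"
    and D: "\<And>e. envM e \<Longrightarrow> D e \<Longrightarrow> s e \<in> elts a \<and> t e \<in> elts a"
  shows "sharp D (\<lambda>e. s e = t e)"
proof -
  obtain r where r: "0 < r" "discrete r a" "chain a" by (rule ud_chainE[OF a])
  show ?thesis
  proof (rule sharp_thresh[OF definable_d[OF simple] r(1)])
    fix e assume e: "envM e" "D e"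
    show "s e = t e \<Longrightarrow> d (s e) (t e) \<le> 0" using simple_M[OF simple(2) e(1)] by simp
    show "s e \<noteq> t e \<Longrightarrow> r \<le> d (s e) (t e)" using r(2) D[OF e] unfolding discrete_def by blast
  qed
qed

lemma ud_subset:
  assumes a: "ud_chain a" and P: "sharp_set a P"
  shows "\<exists>m\<in>M. elts m = {x \<in> elts a. P x}"
proof -
  obtain r where r: "0 < r" "discrete r a" "a \<in> M" by (rule ud_chainE[OF a])
  show ?thesis by (rule subset_set[OF r(3) P r(1)]) (use discrete_eq[OF r(2)] in blast)
qed

lemma wo_chain_least:
  assumes a: "wo_chain a" and P: "sharp_set a P" and x: "x \<in> elts a" "P x"
  shows "\<exists>x\<in>elts a. P x \<and> (\<forall>y\<in>elts a. P y \<longrightarrow> x \<sqsubseteq> y)"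
proof -
  obtain m where m: "m \<in> M" "elts m = {x \<in> elts a. P x}"
    using ud_subset[OF _ P] a unfolding wo_chain_def by blast
  have "m \<sqsubseteq> a" using m by (auto simp: subset_rel_def)
  moreover have "m \<noteq> emptyset" using m x eq_emptyset_iff by blast
  ultimately obtain u where "u \<in> elts m" "\<And>y. y \<in> elts m \<Longrightarrow> u \<sqsubseteq> y"
    using a m(1) unfolding wo_chain_def by blast
  thus ?thesis using m(2) by blast
qed

lemma sub_antisym: "x \<in> M \<Longrightarrow> y \<in> M \<Longrightarrow> x \<sqsubseteq> y \<Longrightarrow> y \<sqsubseteq> x \<Longrightarrow> x = y"
  using elts_inject unfolding subset_rel_def by blast

lemma sub_trans: "x \<sqsubseteq> y \<Longrightarrow> y \<sqsubseteq> z \<Longrightarrow> x \<sqsubseteq> z"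
  unfolding subset_rel_def by blast

lemma chain_sub: "chain a \<Longrightarrow> c \<in> M \<Longrightarrow> c \<sqsubseteq> a \<Longrightarrow> chain c"
  unfolding chain_def subset_rel_def by blast

lemma ud_chain_sub: "ud_chain a \<Longrightarrow> c \<in> M \<Longrightarrow> c \<sqsubseteq> a \<Longrightarrow> ud_chain c"
  unfolding ud_chain_def uniformly_discrete_def using chain_sub discrete_sub by blast

lemma wo_chain_sub: "wo_chain a \<Longrightarrow> c \<in> M \<Longrightarrow> c \<sqsubseteq> a \<Longrightarrow> wo_chain c"
  unfolding wo_chain_def using ud_chain_sub sub_trans by blast

text \<open>An isomorphism that is a member of \<open>M\<close> is the same as one with a sharp graph; this
reduces closure properties of isomorphisms to first-order definability.\<close>
lemma order_iso_iff:
  "order_iso a c \<longleftrightarrow> ud_chain a \<and> ud_chain c \<and>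
     (\<exists>g. bij_betw g (elts a) (elts c) \<and> (\<forall>x\<in>elts a. \<forall>y\<in>elts a. x \<sqsubseteq> y \<longleftrightarrow> g x \<sqsubseteq> g y) \<and>
        sharp_rel a c (\<lambda>x y. y = g x))" (is "?L \<longleftrightarrow> ?R")
proof (cases "ud_chain a \<and> ud_chain c")
  case False thus ?thesis by (auto simp: order_iso_def)
next
  case True
  hence a: "ud_chain a" and c: "ud_chain c" by auto
  obtain r1 where r1: "0 < r1" "discrete r1 a" "a \<in> M" by (rule ud_chainE[OF a])
  obtain r2 where r2: "0 < r2" "discrete r2 c" "c \<in> M" by (rule ud_chainE[OF c])
  define r where "r = min r1 r2"
  have r: "0 < r" "discrete r a" "discrete r c" using r1 r2 discrete_mono by (auto simp: r_def)
  have graph: "{pair x (g x) | x. x \<in> elts a} = {pair x y | x y. x \<in> elts a \<and> y \<in> elts c \<and> y = g x}"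
    if "bij_betw g (elts a) (elts c)" for g using that bij_betwE by blast
  show ?thesis
  proof
    assume ?L
    then obtain f g where f: "f \<in> M" "elts f = {pair x (g x) | x. x \<in> elts a}"
      "bij_betw g (elts a) (elts c)" "\<forall>x\<in>elts a. \<forall>y\<in>elts a. x \<sqsubseteq> y \<longleftrightarrow> g x \<sqsubseteq> g y"
      unfolding order_iso_def by blast
    have "sharp_rel a c (\<lambda>x y. y = g x)"
      by (rule sharp_rel_of_set[OF r f(1)]) (simp only: f(2) graph[OF f(3)])
    thus ?R using f(3,4) a c by blast
  next
    assume ?R
    then obtain g where g: "bij_betw g (elts a) (elts c)"
      "\<forall>x\<in>elts a. \<forall>y\<in>elts a. x \<sqsubseteq> y \<longleftrightarrow> g x \<sqsubseteq> g y" "sharp_rel a c (\<lambda>x y. y = g x)" by blast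
    obtain f where f: "f \<in> M" "elts f = {pair x y | x y. x \<in> elts a \<and> y \<in> elts c \<and> y = g x}"
      using rel_set[OF r1(3) r2(3) r g(3)] by blast
    have "sharp_rel a c (\<lambda>x y. True)" unfolding sharp_rel_def by (rule sharpI[OF definable_real[of 0]]) auto
    then obtain p where p: "p \<in> M" "elts p = {pair x y | x y. x \<in> elts a \<and> y \<in> elts c \<and> True}"
      using rel_set[OF r1(3) r2(3) r] by blast
    have "product a c = p" unfolding product_def by (rule the_set_eq[OF p(1)]) (use p(2) in simp)
    hence "f \<sqsubseteq> product a c" using p(2) f(2) by (auto simp: subset_rel_def)
    moreover have "elts f = {pair x (g x) | x. x \<in> elts a}" using f(2) graph[OF g(1)] by simp
    ultimately show ?L unfolding order_iso_def using a c f(1) g(1,2) by blast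
  qed
qed

lemma order_iso_refl: assumes a: "ud_chain a" shows "order_iso a a"
proof -
  have "sharp_rel a a (\<lambda>x y. y = x)" unfolding sharp_rel_def by (intro eq_at[OF a] simple_var) auto
  thus ?thesis unfolding order_iso_iff using a by (auto intro!: exI[of _ "\<lambda>x. x"] bij_betw_id[unfolded id_def])
qed

lemma order_iso_sym: assumes "order_iso a c" shows "order_iso c a"
proof -
  obtain g where g: "ud_chain a" "ud_chain c" "bij_betw g (elts a) (elts c)"
      "\<forall>x\<in>elts a. \<forall>y\<in>elts a. x \<sqsubseteq> y \<longleftrightarrow> g x \<sqsubseteq> g y" "sharp_rel a c (\<lambda>x y. y = g x)"
    using assms unfolding order_iso_iff by blast
  define k where "k = inv_into (elts a) g"
  have k: "bij_betw k (elts c) (elts a)" unfolding k_def by (rule bij_betw_inv_into[OF g(3)])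
  have gk: "g (k y) = y" if "y \<in> elts c" for y unfolding k_def using that g(3) by (meson bij_betw_inv_into_right)
  have kg: "k (g x) = x" if "x \<in> elts a" for x unfolding k_def using that g(3) by (meson bij_betw_inv_into_left)
  have kin: "k y \<in> elts a" if "y \<in> elts c" for y using that k bij_betwE by blast
  have "sharp (\<lambda>e. e 0 \<in> elts c \<and> e (Suc 0) \<in> elts a) (\<lambda>e. e 0 = g (e (Suc 0)))"
    by (rule sharp_rel_at[OF g(5)]) auto
  then obtain F where F: "definable F" "\<And>e. envM e \<Longrightarrow> e 0 \<in> elts c \<and> e (Suc 0) \<in> elts a \<Longrightarrow> F e = truth (e 0 = g (e (Suc 0)))"
    unfolding sharp_def by blast
  have "sharp_rel c a (\<lambda>y x. x = k y)" unfolding sharp_rel_def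
  proof (rule sharpI[OF F(1)])
    fix e assume e: "envM e" "e 0 \<in> elts c \<and> e (Suc 0) \<in> elts a"
    have "e 0 = g (e (Suc 0)) \<longleftrightarrow> e (Suc 0) = k (e 0)" using e gk kg by metis
    thus "F e = truth (e (Suc 0) = k (e 0))" using F(2)[OF e] by simp
  qed
  moreover have "\<forall>x\<in>elts c. \<forall>y\<in>elts c. x \<sqsubseteq> y \<longleftrightarrow> k x \<sqsubseteq> k y" using g(4) gk kin by metis
  ultimately show ?thesis unfolding order_iso_iff using g k by blast
qed

lemma order_iso_trans: assumes "order_iso a b" "order_iso b c" shows "order_iso a c"
proof -
  obtain g where g: "ud_chain a" "ud_chain b" "bij_betw g (elts a) (elts b)"
      "\<forall>x\<in>elts a. \<forall>y\<in>elts a. x \<sqsubseteq> y \<longleftrightarrow> g x \<sqsubseteq> g y" "sharp_rel a b (\<lambda>x y. y = g x)"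
    using assms(1) unfolding order_iso_iff by blast
  obtain k where k: "ud_chain c" "bij_betw k (elts b) (elts c)"
      "\<forall>x\<in>elts b. \<forall>y\<in>elts b. x \<sqsubseteq> y \<longleftrightarrow> k x \<sqsubseteq> k y" "sharp_rel b c (\<lambda>x y. y = k x)"
    using assms(2) unfolding order_iso_iff by blast
  have gin: "g x \<in> elts b" if "x \<in> elts a" for x using that g(3) bij_betwE by blast
  have bM: "b \<in> M" using g(2) by (auto simp: ud_chain_def chain_def)
  have "sharp (\<lambda>e. e 0 \<in> elts a \<and> e (Suc 0) \<in> elts c)
      (\<lambda>e. \<exists>y\<in>elts b. y = g (e 0) \<and> e (Suc 0) = k y)"
    by (intro sharp_bex sharp_conj sharp_rel_at[OF g(5)] sharp_rel_at[OF k(4)] simple_var simple_const bM) auto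
  then obtain F where F: "definable F" "\<And>e. envM e \<Longrightarrow> e 0 \<in> elts a \<and> e (Suc 0) \<in> elts c \<Longrightarrow>
      F e = truth (\<exists>y\<in>elts b. y = g (e 0) \<and> e (Suc 0) = k y)"
    unfolding sharp_def by blast
  have "sharp_rel a c (\<lambda>x y. y = (k \<circ> g) x)" unfolding sharp_rel_def
    by (rule sharpI[OF F(1)]) (use F(2) gin in auto)
  moreover have "bij_betw (k \<circ> g) (elts a) (elts c)" by (rule bij_betw_trans[OF g(3) k(2)])
  moreover have "\<forall>x\<in>elts a. \<forall>y\<in>elts a. x \<sqsubseteq> y \<longleftrightarrow> (k \<circ> g) x \<sqsubseteq> (k \<circ> g) y" using g(4) k(3) gin by simp
  ultimately show ?thesis unfolding order_iso_iff using g(1) k(1) by blast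
qed

lemma otp_eq_iff: assumes "ud_chain a" "ud_chain b" shows "otp a = otp b \<longleftrightarrow> order_iso a b"
proof
  assume "otp a = otp b"
  moreover have "a \<in> otp a" using order_iso_refl[OF assms(1)] by (simp add: otp_def)
  ultimately have "order_iso b a" by (simp add: otp_def)
  thus "order_iso a b" by (rule order_iso_sym)
next
  assume "order_iso a b"
  thus "otp a = otp b" unfolding otp_def using order_iso_sym order_iso_trans by blast
qed

lemma initial_segment_transport:
  assumes X: "order_iso X X'" and C: "initial_segment C X"
  shows "\<exists>C'. initial_segment C' X' \<and> order_iso C C'"
proof -
  obtain g where g: "ud_chain X" "ud_chain X'" "bij_betw g (elts X) (elts X')"
      "\<forall>x\<in>elts X. \<forall>y\<in>elts X. x \<sqsubseteq> y \<longleftrightarrow> g x \<sqsubseteq> g y" "sharp_rel X X' (\<lambda>x y. y = g x)"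
    using X unfolding order_iso_iff by blast
  have CM: "C \<in> M" and CX: "elts C \<subseteq> elts X" using C by (auto simp: initial_segment_def subset_rel_def)
  have gin: "g x \<in> elts X'" if "x \<in> elts X" for x using that g(3) bij_betwE by blast
  have "sharp_set X' (\<lambda>y. \<exists>x\<in>elts C. y = g x)" unfolding sharp_set_def
    by (intro sharp_bex sharp_rel_at[OF g(5)] simple_var simple_const CM) (use CX in auto)
  then obtain C' where C': "C' \<in> M" "elts C' = {y \<in> elts X'. \<exists>x\<in>elts C. y = g x}"
    using ud_subset[OF g(2)] by blast
  have im: "elts C' = g ` elts C" using C'(2) gin CX by auto
  have "bij_betw g (elts C) (elts C')" using bij_betw_subset[OF g(3) CX] im by blast
  moreover have C'X: "C' \<sqsubseteq> X'" using C' by (auto simp: subset_rel_def)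
  moreover have "sharp_rel C C' (\<lambda>x y. y = g x)" unfolding sharp_rel_def
    by (rule sharp_rel_at[OF g(5)]) (use CX C'X in \<open>auto simp: subset_rel_def\<close>)
  moreover have "ud_chain C" "ud_chain C'"
    using ud_chain_sub g(1,2) CM C'(1) CX C'X by (auto simp: subset_rel_def)
  ultimately have "order_iso C C'" unfolding order_iso_iff using g(4) CX by blast
  moreover have "initial_segment C' X'" unfolding initial_segment_def
  proof (intro conjI ballI impI)
    fix x y assume x: "x \<in> elts C'" and y: "y \<in> elts X'" and yx: "y \<sqsubseteq> x"
    obtain x1 where x1: "x1 \<in> elts C" "x = g x1" using x im by blast
    obtain y1 where y1: "y1 \<in> elts X" "y = g y1" using y g(3) unfolding bij_betw_def by blast
    have "y1 \<sqsubseteq> x1" using g(4) x1 y1 yx CX by blast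
    hence "y1 \<in> elts C" using C x1 y1 unfolding initial_segment_def by blast
    thus "y \<in> elts C'" using im y1 by blast
  qed (use C'(1) C'X in auto)
  ultimately show ?thesis by blast
qed

text \<open>The least element moved downwards by the isomorphism would be sent to an element
that is moved downwards as well.\<close>
lemma no_proper_segment:
  assumes X: "wo_chain X" and C: "initial_segment C X" and iso: "order_iso X C"
  shows "elts X \<subseteq> elts C"
proof (rule ccontr)
  assume "\<not> ?thesis"
  then obtain s where s: "s \<in> elts X" "s \<notin> elts C" by blast
  obtain g where g: "ud_chain X" "ud_chain C" "bij_betw g (elts X) (elts C)"
      "\<forall>x\<in>elts X. \<forall>y\<in>elts X. x \<sqsubseteq> y \<longleftrightarrow> g x \<sqsubseteq> g y" "sharp_rel X C (\<lambda>x y. y = g x)"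
    using iso unfolding order_iso_iff by blast
  have ch: "chain X" and CM: "C \<in> M" and CX: "elts C \<subseteq> elts X" using g C by (auto simp: ud_chain_def initial_segment_def subset_rel_def)
  have gin: "g x \<in> elts C" if "x \<in> elts X" for x using that g(3) bij_betwE by blast
  have tot: "x \<sqsubseteq> y \<or> y \<sqsubseteq> x" if "x \<in> elts X" "y \<in> elts X" for x y using ch that unfolding chain_def by blast
  let ?P = "\<lambda>x. \<exists>y\<in>elts C. y = g x \<and> \<not> x \<sqsubseteq> y"
  have "sharp_set X ?P" unfolding sharp_set_def
    by (intro sharp_bex sharp_conj sharp_not sharp_rel_at[OF g(5)] sub_at[OF g(1)] simple_var simple_const CM) (use CX in auto)
  moreover have "?P s"
  proof (intro bexI[of _ "g s"] conjI notI)
    assume "s \<sqsubseteq> g s"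
    thus False using C gin[OF s(1)] s unfolding initial_segment_def by blast
  qed (use gin[OF s(1)] in auto)
  ultimately obtain x where x: "x \<in> elts X" "?P x" "\<And>y. y \<in> elts X \<Longrightarrow> ?P y \<Longrightarrow> x \<sqsubseteq> y"
    using wo_chain_least[OF X _ s(1), of ?P] by blast
  have gx: "g x \<in> elts X" "\<not> x \<sqsubseteq> g x" using x gin CX by blast+
  hence "\<not> g x \<sqsubseteq> g (g x)" using g(4) x(1) by blast
  hence "?P (g x)" using gin[OF gx(1)] by blast
  thus False using x(3)[OF gx(1)] gx(2) by blast
qed

end


lemma clip_less_D: "clip v < w \<Longrightarrow> w \<le> 1 \<Longrightarrow> v < w"
  by (auto simp: clip_def)

section \<open>A set of all sufficiently discrete well-ordered chains\<close>

context mse_model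
begin

text \<open>Three formulas that vanish on \<open>r\<close>-discrete well-ordered chains, see \<open>approx_chains\<close>: the excess is
never strictly between 0 and \<open>r\<close>; of two elements one includes the other; each nonempty \<open>m\<close> has a
least element, up to an error proportional to the excess of \<open>m\<close> over \<open>c\<close>. The last error term is
needed since \<open>m\<close> ranges over all of \<open>M\<close>.\<close>
definition gap_defect :: "real \<Rightarrow> 'a \<Rightarrow> real" where
  "gap_defect r c = bsup (elts c) (\<lambda>x. bsup (elts c) (\<lambda>y. min (excess x y) (clip ((-1) * excess x y + r))))"

definition chain_defect :: "'a \<Rightarrow> real" where
  "chain_defect c = bsup (elts c) (\<lambda>x. bsup (elts c) (\<lambda>y. min (excess x y) (excess y x)))"

definition wo_defect :: "real \<Rightarrow> 'a \<Rightarrow> 'a \<Rightarrow> real" where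
  "wo_defect r c m = min (bsup (elts m) (\<lambda>_. 1))
     (clip (1 * binf (elts m) (\<lambda>x. bsup (elts m) (\<lambda>y. excess x y)) + (- (4 / r)) * excess m c + 0))"

text \<open>If the excess \<open>\<eta>\<close> of \<open>m\<close> over \<open>a\<close> is at least $r/4$, the error term is at least 1. Otherwise
every element of \<open>m\<close> is within \<open>\<eta>\<close> of a unique element of \<open>a\<close>, these elements of \<open>a\<close> form a set with a
least element, and an element of \<open>m\<close> near it is least in \<open>m\<close> up to \<open>2 * \<eta>\<close>.\<close>
lemma wo_defect_exact:
  assumes a: "wo_chain a" and r: "discrete r a" "0 < r" "r \<le> 1" and m: "m \<in> M"
  shows "wo_defect r a m \<le> 0"
proof (cases "elts m = {}")
  case True thus ?thesis by (simp add: wo_defect_def)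
next
  case False
  let ?\<eta> = "excess m a"
  let ?b = "binf (elts m) (\<lambda>x. bsup (elts m) (\<lambda>y. excess x y))"
  have ch: "chain a" and ud: "ud_chain a" and aM: "a \<in> M"
    using a by (auto simp: wo_chain_def ud_chain_def chain_def)
  have s0: "0 \<le> bsup (elts m) (\<lambda>y. excess x y)" for x by (rule bsup_ge_0) (rule excess_le_1)
  have "?b \<le> 4 / r * ?\<eta>"
  proof (cases "r / 4 \<le> ?\<eta>")
    case True
    hence "1 \<le> 4 / r * ?\<eta>" using r(2) by (simp add: field_simps)
    moreover have "?b \<le> 1" by (rule binf_le_1) (rule s0)
    ultimately show ?thesis by linarith
  next
    case False
    have toa: "\<exists>y\<in>elts a. d x y < v" if "x \<in> elts m" "?\<eta> < v" "v \<le> 1" for x v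
      using dist_to_le_excess[OF that(1), of a] that by (intro dist_to_lessD) auto
    have near: "d x y \<le> ?\<eta>" if x: "x \<in> elts m" and y: "y \<in> elts a" and xy: "d x y < r / 2" for x y
    proof (rule dense_ge_bounded[of _ "r / 2"])
      show "?\<eta> < r / 2" using False r(2) by simp
      fix v assume v: "?\<eta> < v" "v < r / 2"
      then obtain y' where y': "y' \<in> elts a" "d x y' < v" using toa[OF x v(1)] r by auto
      have "d y y' \<le> d y x + d x y'" by (rule triangle) (use elts_M x y y' in blast)+
      hence "d y y' < r" using y' v xy commute[of y x] by simp
      hence "y = y'" using discrete_eq[OF r(1) y y'(1)] by blast
      thus "d x y \<le> v" using y' by simp
    qed
    have pick: "\<exists>y\<in>elts a. d x y < r / 2" if "x \<in> elts m" for x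
      using toa[OF that, of "r/2"] False r(2,3) by simp
    define P where "P y \<longleftrightarrow> (\<exists>x\<in>elts m. d x y < r / 2)" for y
    have "sharp_set a P" unfolding sharp_set_def P_def
    proof (rule sharp_bex[OF sharp_thresh[OF definable_d, of "\<lambda>e. e 0" "\<lambda>e. e (Suc 0)" ?\<eta> "r / 2"]])
      fix e :: "nat \<Rightarrow> 'a" assume "e (Suc 0) \<in> elts a \<and> e 0 \<in> elts m"
      thus "d (e 0) (e (Suc 0)) < r / 2 \<Longrightarrow> d (e 0) (e (Suc 0)) \<le> ?\<eta>" using near by blast
    qed (use False r(2) m in auto)
    moreover obtain y1 where "y1 \<in> elts a" "P y1" using pick \<open>elts m \<noteq> {}\<close> unfolding P_def by blast
    ultimately obtain y0 where y0: "y0 \<in> elts a" "P y0" "\<And>y. y \<in> elts a \<Longrightarrow> P y \<Longrightarrow> y0 \<sqsubseteq> y"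
      using wo_chain_least[OF a] by blast
    then obtain x0 where x0: "x0 \<in> elts m" "d x0 y0 < r / 2" unfolding P_def by blast
    have x0y0: "excess x0 y0 \<le> ?\<eta>"
      using near[OF x0(1) y0(1) x0(2)] excess_le_d[OF elts_M[OF x0(1)] elts_M[OF y0(1)]] by linarith
    have "excess x0 x \<le> 2 * ?\<eta>" if x: "x \<in> elts m" for x
    proof -
      obtain y where y: "y \<in> elts a" "d x y < r / 2" using pick x by blast
      hence "P y" using x by (auto simp: P_def)
      hence "excess y0 y = 0" using y0 y excess_eq_0_iff elts_M by metis
      moreover have "excess y x \<le> ?\<eta>"
        using near[OF x y] excess_le_d[OF elts_M[OF y(1)] elts_M[OF x]] commute[of x y] by linarith
      ultimately show ?thesis using excess_triangle[of x0 x y0] excess_triangle[of y0 x y] x0y0 by linarith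
    qed
    hence "bsup (elts m) (\<lambda>y. excess x0 y) \<le> 2 * ?\<eta>" by (rule bsup_least) (simp_all add: excess_ge_0)
    moreover have "?b \<le> bsup (elts m) (\<lambda>y. excess x0 y)" by (rule binf_lower[OF s0 x0(1)])
    moreover have "2 * ?\<eta> \<le> 4 / r * ?\<eta>"
      using mult_right_mono[of 2 "4 / r" ?\<eta>] r(2,3) excess_ge_0[of m a] by (simp add: field_simps)
    ultimately show ?thesis by linarith
  qed
  hence "clip (1 * ?b + (- (4 / r)) * ?\<eta> + 0) \<le> 0" by (simp add: clip_def)
  thus ?thesis unfolding wo_defect_def by linarith
qed

end

context mse_tolerance
begin

lemma exact_le: assumes "chain a" "discrete r a" "h \<le> r" "x \<in> elts a" "y \<in> elts a"
  shows "le x y \<longleftrightarrow> x \<sqsubseteq> y"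
proof
  assume "le x y" thus "x \<sqsubseteq> y" using sub_excess[OF assms(1,2,4,5)] assms(3) by (force simp: le_def)
next
  assume "x \<sqsubseteq> y"
  hence "excess x y = 0" using excess_eq_0_iff elts_M assms by blast
  thus "le x y" using h_pos by (simp add: le_def)
qed

text \<open>The one essential use of excision with a positive error: it collects all
\<open>r\<close>-discrete well-ordered chains, and what else it lets in is still well-ordered up to \<open>h\<close>.\<close>
lemma approx_chains:
  assumes r: "0 < r" "r \<le> 1"
  shows "\<exists>b\<in>M. (\<forall>a. wo_chain a \<and> discrete r a \<longrightarrow> a \<in> elts b) \<and> (\<forall>p\<in>elts b. wo_pre (r - h) p)"
proof -
  let ?G = "\<lambda>c. max (gap_defect r c) (max (chain_defect c) (bsup M (wo_defect r c)))"
  have "definable (\<lambda>e. ?G (e 0))"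
    unfolding gap_defect_def chain_defect_def wo_defect_def
    by (intro definable_max definable_bsup_M definable_bsup definable_min definable_affine definable_lin definable_excess definable_binf definable_real simple_var) simp_all
  from excision_definable[OF this h_pos]
  obtain b where b: "b \<in> M" "\<And>c. c \<in> M \<Longrightarrow> ?G c \<le> 0 \<Longrightarrow> c \<in> elts b" "\<And>c. c \<in> elts b \<Longrightarrow> ?G c < h"
    using elts_M by blast
  have h1: "h \<le> 1" using h_small h_pos by linarith
  have "a \<in> elts b" if a: "wo_chain a" and dis: "discrete r a" for a
  proof -
    have ch: "chain a" and aM: "a \<in> M" using a by (auto simp: wo_chain_def ud_chain_def chain_def)
    have z: "excess x y = 0 \<or> r \<le> excess x y \<and> excess y x = 0" if "x \<in> elts a" "y \<in> elts a" for x y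
    proof (cases "x \<sqsubseteq> y")
      case True thus ?thesis using excess_eq_0_iff[OF elts_M[OF that(1)] elts_M[OF that(2)]] by simp
    next
      case False
      hence "y \<sqsubseteq> x" using ch that unfolding chain_def by blast
      thus ?thesis using excess_eq_0_iff[OF elts_M[OF that(2)] elts_M[OF that(1)]] sub_excess[OF ch dis that False] by simp
    qed
    have "gap_defect r a \<le> 0" unfolding gap_defect_def
    proof (intro bsup_least order_refl)
      fix x y assume "x \<in> elts a" "y \<in> elts a"
      thus "min (excess x y) (clip ((-1) * excess x y + r)) \<le> 0" using z[of x y] by (auto simp: clip_def)
    qed
    moreover have "chain_defect a \<le> 0" unfolding chain_defect_def
    proof (intro bsup_least order_refl)
      fix x y assume "x \<in> elts a" "y \<in> elts a"
      thus "min (excess x y) (excess y x) \<le> 0" using z[of x y] by auto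
    qed
    moreover have "bsup M (wo_defect r a) \<le> 0" by (rule bsup_least) (use wo_defect_exact[OF a dis r] in auto)
    ultimately show ?thesis using b(2)[OF aM] by simp
  qed
  moreover have "wo_pre (r - h) c" if c: "c \<in> elts b" for c
  proof -
    have cM: "c \<in> M" using c elts_M by blast
    have G: "gap_defect r c < h" "chain_defect c < h" "bsup M (wo_defect r c) < h" using b(3)[OF c] by auto
    have m1: "min (excess x y) w \<le> 1" for x y w using excess_le_1[of x y] by linarith
    have i1: "min (excess x y) (clip ((-1) * excess x y + r)) < h" if "x \<in> elts c" "y \<in> elts c" for x y
      by (rule bsup_lessD[OF bsup_lessD[OF G(1)[unfolded gap_defect_def] _ that(1)] _ that(2)]) (intro bsup_le_1 m1)+
    have i2: "min (excess x y) (excess y x) < h" if "x \<in> elts c" "y \<in> elts c" for x y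
      by (rule bsup_lessD[OF bsup_lessD[OF G(2)[unfolded chain_defect_def] _ that(1)] _ that(2)]) (intro bsup_le_1 m1)+
    have i3: "wo_defect r c m < h" if "m \<in> M" for m
    proof (rule bsup_lessD[OF G(3) _ that])
      show "wo_defect r c x \<le> 1" for x unfolding wo_defect_def by (simp add: min_le_iff_disj)
    qed
    show ?thesis unfolding wo_pre_def
    proof (intro conjI ballI impI)
      fix x y assume xy: "x \<in> elts c" "y \<in> elts c"
      show "le x y \<or> r - h \<le> excess x y"
      proof (rule disjCI)
        assume "\<not> r - h \<le> excess x y"
        hence "\<not> (-1) * excess x y + r < h" by simp
        hence "\<not> clip ((-1) * excess x y + r) < h" using clip_less_D h1 by blast
        thus "le x y" using i1[OF xy] by (auto simp: le_def)
      qed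
      show "le x y \<or> le y x" using i2[OF xy] by (auto simp: le_def)
    next
      fix m assume m: "m \<in> M" "m \<sqsubseteq> c \<and> elts m \<noteq> {}"
      then obtain x1 where x1: "x1 \<in> elts m" by blast
      have "1 \<le> bsup (elts m) (\<lambda>_. 1)" by (rule bsup_upper[OF _ x1]) simp
      moreover have "excess m c = 0" using m cM excess_eq_0_iff by blast
      ultimately have "clip (binf (elts m) (\<lambda>x. bsup (elts m) (\<lambda>y. excess x y))) < h"
        using i3[OF m(1)] h1 by (auto simp: wo_defect_def)
      hence "binf (elts m) (\<lambda>x. bsup (elts m) (\<lambda>y. excess x y)) < h" using clip_less_D h1 by blast
      then obtain x where x: "x \<in> elts m" "bsup (elts m) (\<lambda>y. excess x y) < h" using binf_lessD h1 by blast
      have "le x y" if "y \<in> elts m" for y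
        unfolding le_def by (rule bsup_lessD[OF x(2) _ that]) (rule excess_le_1)
      thus "\<exists>x\<in>elts m. \<forall>y\<in>elts m. le x y" using x(1) by blast
    qed (rule cM)
  qed
  ultimately show ?thesis using b(1) by blast
qed

end

section \<open>The chain of order types\<close>

text \<open>A set \<open>b\<close> of approximate well-ordered chains in which different order types are at least \<open>u\<close> apart.
Replacing a member \<open>p\<close> by the set \<open>lower p\<close> of all members of at most its type turns the comparison
of types into inclusion; the sets \<open>lower p\<close> form a chain that represents all types occurring in \<open>b\<close>.\<close>
locale order_type_family = mse_tolerance +
  fixes b :: 'a and u :: real
  assumes b_M: "b \<in> M" and b_W: "elts b \<subseteq> W" and u_pos: "0 < u" and u_le_1: "u \<le> 1"
    and near: "p \<in> elts b \<Longrightarrow> q \<in> elts b \<Longrightarrow> d p q < u \<Longrightarrow> type_le p q"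
begin

definition lower :: "'a \<Rightarrow> 'a" where
  "lower p = the_set {q \<in> elts b. type_le q p}"

definition type_chain :: 'a where
  "type_chain = the_set (lower ` elts b)"

lemma member_W: "p \<in> elts b \<Longrightarrow> p \<in> W"
  using b_W by blast

lemma class_trans: "p \<in> elts b \<Longrightarrow> q \<in> elts b \<Longrightarrow> q' \<in> elts b \<Longrightarrow> type_le p q \<Longrightarrow> type_le q q' \<Longrightarrow> type_le p q'"
  using type_le_trans member_W by blast

lemma elts_lower: assumes p: "p \<in> elts b" shows "lower p \<in> M \<and> elts (lower p) = {q \<in> elts b. type_le q p}"
proof -
  have pM: "p \<in> M" using p elts_M by blast
  have "sharp_set b (\<lambda>q. type_le q p)" unfolding sharp_set_def
    by (rule type_le_at[OF simple_var simple_const[OF pM]]) (use p b_W in auto)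
  then have "\<exists>m\<in>M. elts m = {q \<in> elts b. type_le q p}"
  proof (rule subset_set[OF b_M _ u_pos])
    fix q q' assume q: "q \<in> elts b" "q' \<in> elts b" "type_le q p" "d q q' < u"
    have "type_le q' q" using near[OF q(2,1)] q(4) commute[of q q'] by simp
    thus "type_le q' p" by (rule class_trans[OF q(2,1) p _ q(3)])
  qed
  then obtain m where m: "m \<in> M" "elts m = {q \<in> elts b. type_le q p}" by blast
  show ?thesis using the_set_eq[OF m] m by (simp add: lower_def)
qed

lemma lower_mem: "p \<in> elts b \<Longrightarrow> q \<in> elts (lower p) \<longleftrightarrow> q \<in> elts b \<and> type_le q p"
  using elts_lower by blast

lemma lower_sub: assumes p: "p \<in> elts b" and q: "q \<in> elts b" shows "lower p \<sqsubseteq> lower q \<longleftrightarrow> type_le p q"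
proof
  assume "lower p \<sqsubseteq> lower q"
  moreover have "p \<in> elts (lower p)" using lower_mem[OF p] p type_le_refl[OF member_W[OF p]] by blast
  ultimately show "type_le p q" using lower_mem[OF q] by (auto simp: subset_rel_def)
next
  assume "type_le p q"
  thus "lower p \<sqsubseteq> lower q" using lower_mem[OF p] lower_mem[OF q] class_trans[OF _ p q] unfolding subset_rel_def by blast
qed

lemma lower_eq: "p \<in> elts b \<Longrightarrow> q \<in> elts b \<Longrightarrow> lower p = lower q \<longleftrightarrow> type_le p q \<and> type_le q p"
proof
  assume pq: "p \<in> elts b" "q \<in> elts b"
  note pq' = lower_sub[OF pq] lower_sub[OF pq(2,1)]
  assume "lower p = lower q"
  hence "lower p \<sqsubseteq> lower q" "lower q \<sqsubseteq> lower p" by (simp_all add: subset_rel_def)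
  thus "type_le p q \<and> type_le q p" using pq' by blast
next
  assume pq: "p \<in> elts b" "q \<in> elts b" and "type_le p q \<and> type_le q p"
  hence "elts (lower p) = elts (lower q)" using lower_sub[OF pq] lower_sub[OF pq(2,1)] unfolding subset_rel_def by blast
  thus "lower p = lower q" using elts_inject elts_lower pq by blast
qed

text \<open>A member of larger type is at distance at least \<open>u\<close> from every member of smaller type, so passing
to lower classes does not lose discreteness.\<close>
lemma dist_to_lower: assumes p: "p \<in> elts b" and q: "q \<in> elts b" and n: "\<not> type_le q p" shows "u \<le> dist_to q (lower p)"
proof (rule dist_to_geI)
  fix x assume "x \<in> elts (lower p)"
  hence x: "x \<in> elts b" "type_le x p" using lower_mem[OF p] by auto
  show "u \<le> d q x" using near[OF q x(1)] class_trans[OF q x(1) p _ x(2)] n by force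
qed (rule u_le_1)

lemma d_lower: assumes p: "p \<in> elts b" and q: "q \<in> elts b" and n: "lower p \<noteq> lower q" shows "u \<le> d (lower p) (lower q)"
proof -
  have *: "u \<le> excess (lower q) (lower p)" if "p \<in> elts b" "q \<in> elts b" "\<not> type_le q p" for p q
  proof -
    have "q \<in> elts (lower q)" using lower_mem that type_le_refl member_W by blast
    thus ?thesis using dist_to_lower[OF that] dist_to_le_excess[of q "lower q" "lower p"] by linarith
  qed
  have "\<not> type_le q p \<or> \<not> type_le p q" using n lower_eq[OF p q] by blast
  thus ?thesis using *[OF p q] *[OF q p] d_eq_excess[of "lower p" "lower q"] elts_lower p q by fastforce
qed

text \<open>The distance to \<open>lower p\<close> is definable uniformly in \<open>p\<close>, so the class of all
\<open>lower p\<close> has a definable distance function; being \<open>u\<close>-discrete, it is closed.\<close>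
lemma elts_type_chain: "type_chain \<in> M \<and> elts type_chain = lower ` elts b"
proof -
  have "sharp (\<lambda>e. e 0 \<in> elts b \<and> e (Suc 0) \<in> elts b) (\<lambda>e. type_le (e 0) (e (Suc 0)))"
    by (rule type_le_at[OF simple_var simple_var]) (use b_W in auto)
  then obtain F where F: "definable F" "\<And>e. envM e \<Longrightarrow> e 0 \<in> elts b \<and> e (Suc 0) \<in> elts b \<Longrightarrow> F e = truth (type_le (e 0) (e (Suc 0)))"
    unfolding sharp_def by blast
  define T where "T q p = F (case_nat q (\<lambda>_. p))" for q p
  have T: "T q p = truth (type_le q p)" if "q \<in> elts b" "p \<in> elts b" for q p
    unfolding T_def using F(2)[of "case_nat q (\<lambda>_. p)"] that elts_M by (simp add: envM_def split: nat.split)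
  have pT: "definable (\<lambda>e. T (e i) (e j))" for i j
  proof -
    have "(\<lambda>k. e (case_nat i (\<lambda>_. j) k)) = case_nat (e i) (\<lambda>_. e j)" for e :: "nat \<Rightarrow> 'a"
      by (rule ext) (simp split: nat.split)
    thus ?thesis unfolding T_def using definable_reindex[OF F(1), of "case_nat i (\<lambda>_. j)"] by simp
  qed
  let ?D = "\<lambda>z p. max (bsup (elts z) (\<lambda>w. binf (elts b) (\<lambda>q. max (T q p) (d w q))))
      (bsup (elts b) (\<lambda>q. min (1 - T q p) (dist_to q z)))"
  let ?G = "\<lambda>z. binf (elts b) (\<lambda>p. ?D z p)"
  have pG: "definable (\<lambda>e. ?G (e 0))"
    by (intro definable_binf definable_bsup definable_max definable_min definable_compl pT definable_d definable_dist_to simple_var simple_const b_M)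
  have D: "?D z p = d z (lower p)" if z: "z \<in> M" and p: "p \<in> elts b" for z p
  proof -
    have el: "elts (lower p) = {q \<in> elts b. type_le q p}" and SM: "lower p \<in> M" using elts_lower[OF p] by auto
    have "excess z (lower p) = bsup (elts z) (\<lambda>w. binf (elts b) (\<lambda>q. max (T q p) (d w q)))"
      unfolding excess_def
    proof (rule bsup_cong)
      fix w assume w: "w \<in> elts z"
      have "dist_to w (lower p) = binf (elts b) (\<lambda>q. max (truth (type_le q p)) (d w q))"
        unfolding dist_to_def el by (rule binf_filter) (use w elts_M dist_le_1 in auto)
      also have "\<dots> = binf (elts b) (\<lambda>q. max (T q p) (d w q))" by (rule binf_cong) (simp add: T p)
      finally show "dist_to w (lower p) = binf (elts b) (\<lambda>q. max (T q p) (d w q))" .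
    qed
    moreover have "excess (lower p) z = bsup (elts b) (\<lambda>q. min (1 - T q p) (dist_to q z))"
    proof -
      have "excess (lower p) z = bsup (elts b) (\<lambda>q. min (1 - truth (type_le q p)) (dist_to q z))"
        unfolding excess_def el by (rule bsup_filter) (use dist_to_ge_0 dist_to_le_1 in auto)
      also have "\<dots> = bsup (elts b) (\<lambda>q. min (1 - T q p) (dist_to q z))" by (rule bsup_cong) (simp add: T p)
      finally show ?thesis .
    qed
    ultimately show ?thesis using d_eq_excess[OF z SM] by simp
  qed
  have G: "?G z = binf (lower ` elts b) (d z)" if z: "z \<in> M" for z
  proof -
    have "?G z = binf (elts b) (\<lambda>p. d z (lower p))" by (rule binf_cong) (rule D[OF z])
    also have "\<dots> = binf (lower ` elts b) (d z)" by (simp add: binf_def image_image)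
    finally show ?thesis .
  qed
  have SM: "lower ` elts b \<subseteq> M" using elts_lower by blast
  obtain m where m: "m \<in> M" "\<And>z. z \<in> M \<Longrightarrow> dist_to z m = ?G z"
    using exact_comprehension[of ?G "lower ` elts b", OF pG SM G] by auto
  have "elts m = lower ` elts b"
  proof (rule elts_eq_closed[OF m(1) _ SM])
    show "dist_to z m = binf (lower ` elts b) (d z)" if "z \<in> M" for z using m(2)[OF that] G[OF that] by simp
    fix z assume z: "z \<in> M" and l: "\<And>\<epsilon>. 0 < \<epsilon> \<Longrightarrow> \<exists>a\<in>lower ` elts b. d z a < \<epsilon>"
    obtain p where p: "p \<in> elts b" "d z (lower p) < u / 2" using l[of "u/2"] u_pos by auto
    have "d z (lower p) \<le> 0"
    proof (rule dense_ge)
      fix v :: real assume "0 < v"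
      then obtain q where q: "q \<in> elts b" "d z (lower q) < min v (u / 2)" using l[of "min v (u/2)"] u_pos by auto
      have "d (lower p) (lower q) \<le> d (lower p) z + d z (lower q)" by (rule triangle) (use elts_lower p q z in auto)
      hence "d (lower p) (lower q) < u" using p q commute[of z "lower p"] by simp
      hence "lower p = lower q" using d_lower[OF p(1) q(1)] by force
      thus "d z (lower p) \<le> v" using q by simp
    qed
    hence "z = lower p" using nonneg[of z "lower p"] zero[of z "lower p"] z elts_lower[OF p(1)] by simp
    thus "z \<in> lower ` elts b" using p by blast
  qed
  thus ?thesis using m(1) the_set_eq[of m] unfolding type_chain_def by simp
qed

lemma type_chain_chain: "chain type_chain"
  unfolding chain_def
proof (intro conjI ballI)
  fix x y assume "x \<in> elts type_chain" "y \<in> elts type_chain"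
  then obtain p q where pq: "p \<in> elts b" "x = lower p" "q \<in> elts b" "y = lower q" using elts_type_chain by auto
  show "x \<sqsubseteq> y \<or> y \<sqsubseteq> x"
    using type_le_total[OF member_W[OF pq(1)] member_W[OF pq(3)]] lower_sub[OF pq(1,3)] lower_sub[OF pq(3,1)] pq(2,4) by blast
qed (use elts_type_chain in blast)

lemma type_chain_discrete: "discrete u type_chain"
  unfolding discrete_def using elts_type_chain d_lower by auto

text \<open>The equation is rewritten so that it mentions only membership, which jumps from 0
to at least \<open>u\<close> here, and the comparison of types.\<close>
lemma eq_lower_at:
  assumes simple: "simple s" "simple t" and D: "\<And>e. envM e \<Longrightarrow> D e \<Longrightarrow> s e \<in> elts type_chain \<and> t e \<in> elts b"
  shows "sharp D (\<lambda>e. s e = lower (t e))"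
proof -
  have "sharp D (\<lambda>e. t e \<in> elts (s e) \<and> (\<forall>q\<in>elts (s e). type_le q (t e)))"
  proof (intro sharp_conj sharp_ball[OF type_le_at] sharp_thresh[OF definable_dist_to[OF simple(2,1)] u_pos] simple simple_shift simple_var)
    fix e assume e: "envM e" "D e"
    then obtain p where p: "p \<in> elts b" "s e = lower p" "t e \<in> elts b" using D elts_type_chain by blast
    have M: "t e \<in> M" "s e \<in> M" using e simple simple_M by blast+
    show "t e \<in> elts (s e) \<Longrightarrow> dist_to (t e) (s e) \<le> 0" using dist_to_eq_0_iff[OF M] by simp
    show "t e \<notin> elts (s e) \<Longrightarrow> u \<le> dist_to (t e) (s e)" using dist_to_lower[OF p(1,3)] p lower_mem[OF p(1)] by simp
  next
    fix e assume e: "envM e" "D (\<lambda>i. e (Suc i)) \<and> e 0 \<in> elts (s (\<lambda>i. e (Suc i)))"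
    let ?e = "\<lambda>i. e (Suc i)"
    obtain p where p: "p \<in> elts b" "s ?e = lower p" "t ?e \<in> elts b" using D[of ?e] e elts_type_chain by auto
    thus "e 0 \<in> W \<and> t ?e \<in> W" using e(2) lower_mem[OF p(1)] member_W by auto
  qed
  then obtain F where F: "definable F"
    "\<And>e. envM e \<Longrightarrow> D e \<Longrightarrow> F e = truth (t e \<in> elts (s e) \<and> (\<forall>q\<in>elts (s e). type_le q (t e)))"
    unfolding sharp_def by blast
  show ?thesis
  proof (rule sharpI[OF F(1)])
    fix e assume e: "envM e" "D e"
    then obtain p where p: "p \<in> elts b" "s e = lower p" "t e \<in> elts b" using D elts_type_chain by blast
    have "s e = lower (t e) \<longleftrightarrow> type_le p (t e) \<and> type_le (t e) p" using lower_eq[OF p(1,3)] p(2) by simp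
    also have "\<dots> \<longleftrightarrow> t e \<in> elts (lower p) \<and> (\<forall>q\<in>elts (lower p). type_le q (t e))"
      using p(1,3) lower_mem[OF p(1)] type_le_refl[OF member_W[OF p(1)]] class_trans[OF _ p(1) p(3)] by blast
    also have "\<dots> \<longleftrightarrow> t e \<in> elts (s e) \<and> (\<forall>q\<in>elts (s e). type_le q (t e))" by (simp only: p(2))
    finally show "F e = truth (s e = lower (t e))" using F(2)[OF e] by simp
  qed
qed

lemma type_chain_wo: "wo_chain type_chain"
  unfolding wo_chain_def ud_chain_def uniformly_discrete_def
proof (intro conjI ballI impI)
  show "\<exists>r>0. discrete r type_chain" using type_chain_discrete u_pos by blast
  fix m assume m: "m \<in> M" "m \<sqsubseteq> type_chain \<and> m \<noteq> emptyset"
  then obtain s where s: "s \<in> elts m" using eq_emptyset_iff by blast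
  have mX: "elts m \<subseteq> elts type_chain" using m by (simp add: subset_rel_def)
  define P where "P p \<longleftrightarrow> (\<exists>s\<in>elts m. s = lower p)" for p
  have "sharp_set b P" unfolding sharp_set_def P_def
    by (rule sharp_bex[OF eq_lower_at]) (use mX m in auto)
  moreover obtain p0 where "p0 \<in> elts b" "P p0" using s mX elts_type_chain unfolding P_def by blast
  ultimately obtain p where p: "p \<in> elts b" "P p" "\<And>q. q \<in> elts b \<Longrightarrow> P q \<Longrightarrow> type_le p q"
    using type_le_least[OF b_M b_W] by blast
  have "lower p \<in> elts m" using p(2) by (auto simp: P_def)
  moreover have "lower p \<sqsubseteq> s'" if s': "s' \<in> elts m" for s'
  proof -
    obtain q where q: "q \<in> elts b" "s' = lower q" using s' mX elts_type_chain by blast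
    hence "P q" using s' by (auto simp: P_def)
    thus ?thesis using p(3) lower_sub p(1) q by blast
  qed
  ultimately show "\<exists>x\<in>elts m. \<forall>y\<in>elts m. x \<sqsubseteq> y" by blast
qed (rule type_chain_chain)

text \<open>\<open>p\<close> has the order type of the initial segment of \<open>a\<close> strictly below \<open>x\<close>.\<close>
definition cut :: "'a \<Rightarrow> 'a \<Rightarrow> 'a \<Rightarrow> bool" where
  "cut a x p \<longleftrightarrow> type_le p a \<and> (\<forall>y\<in>elts a. (\<exists>z\<in>elts p. max_iso p a z y) \<longleftrightarrow> \<not> le x y)"

lemma cut_type_le:
  assumes a: "a \<in> elts b" and p: "p \<in> elts b" "p' \<in> elts b" and x: "x \<in> elts a" "x' \<in> elts a"
    and J: "cut a x p" "cut a x' p'"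
  shows "le x x' \<longleftrightarrow> type_le p p'"
proof
  note w = member_W[OF a] member_W[OF p(1)] member_W[OF p(2)]
  assume l: "le x x'"
  show "type_le p p'" unfolding type_le_def
  proof
    fix z assume z: "z \<in> elts p"
    then obtain y where y: "y \<in> elts a" "max_iso p a z y" using J(1) unfolding cut_def type_le_def by blast
    hence "\<not> le x y" using J(1) z unfolding cut_def by blast
    hence "\<not> le x' y" using le_trans[OF w(1) x(1) y(1) l] by blast
    then obtain z' where "z' \<in> elts p'" "max_iso p' a z' y" using J(2) y(1) unfolding cut_def by blast
    thus "\<exists>z'\<in>elts p'. max_iso p p' z z'" using max_iso_comp[OF w(2,1,3) y(2)] max_iso_sym by blast
  qed
next
  note w = member_W[OF a] member_W[OF p(1)] member_W[OF p(2)]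
  assume l: "type_le p p'"
  show "le x x'"
  proof (rule ccontr)
    assume "\<not> le x x'"
    then obtain z where z: "z \<in> elts p" "max_iso p a z x'" using J(1) x(2) unfolding cut_def by blast
    then obtain z' where z': "z' \<in> elts p'" "max_iso p p' z z'" using l unfolding type_le_def by blast
    have "max_iso p' a z' x'" using max_iso_comp[OF w(3,2,1) max_iso_sym[OF z'(2)] z(2)] .
    hence "\<not> le x' x'" using J(2) x(2) z'(1) unfolding cut_def by blast
    thus False using le_refl elts_M x(2) by blast
  qed
qed

lemma cut_less: assumes a: "a \<in> elts b" and p: "p \<in> elts b" and x: "x \<in> elts a" and J: "cut a x p"
  shows "\<not> type_le a p"
proof
  assume "type_le a p"
  then obtain z where z: "z \<in> elts p" "max_iso a p x z" using x unfolding type_le_def by blast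
  hence "\<not> le x x" using J x max_iso_sym[OF z(2)] unfolding cut_def by blast
  thus False using le_refl elts_M x by blast
qed

lemma less_cut: assumes a: "a \<in> elts b" and p: "p \<in> elts b" and n: "\<not> type_le a p"
  shows "\<exists>x\<in>elts a. cut a x p"
proof -
  note w = member_W[OF a] member_W[OF p]
  note G = max_iso_partial_iso[OF w(2,1)]
  have pa: "type_le p a" using type_le_total[OF w] n by blast
  define P where "P y \<longleftrightarrow> \<not> (\<exists>z\<in>elts p. max_iso p a z y)" for y
  have "sharp_set a P" unfolding sharp_set_def P_def
    by (intro sharp_not sharp_bex sharp_rel_at[OF max_iso_sharp_rel[OF w(2,1)]] simple_var simple_const W_M[OF w(2)]) auto
  moreover obtain x0 where "x0 \<in> elts a" "P x0" using n max_iso_sym unfolding type_le_def P_def by blast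
  ultimately obtain x where x: "x \<in> elts a" "P x" "\<And>y. y \<in> elts a \<Longrightarrow> P y \<Longrightarrow> le x y"
    using wo_least[OF w(1)] by blast
  have "cut a x p" unfolding cut_def
  proof (intro conjI pa ballI iffI notI)
    fix y assume y: "y \<in> elts a" "\<exists>z\<in>elts p. max_iso p a z y" and l: "le x y"
    then obtain z where "max_iso p a z y" by blast
    then obtain z' where z': "max_iso p a z' x" using partial_iso_down'[OF G _ x(1) l] by blast
    thus False using x(2) partial_iso_dom[OF G z'] unfolding P_def by blast
  next
    fix y assume "y \<in> elts a" "\<not> le x y"
    thus "\<exists>z\<in>elts p. max_iso p a z y" using x(3) unfolding P_def by blast
  qed
  thus ?thesis using x(1) by blast
qed

text \<open>The Burali-Forti step. A chain \<open>a\<close> in \<open>b\<close> embeds by sending \<open>x\<close> to the lower class of the initial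
segment below \<open>x\<close>, which is in \<open>b\<close> because initial segments inherit discreteness and well-ordering.
The image consists of the classes strictly below that of \<open>a\<close>, so it omits the class of \<open>a\<close> itself.\<close>
lemma type_chain_dominates:
  assumes a: "wo_chain a" "discrete r a" and h: "h \<le> r"
    and all: "\<And>a. wo_chain a \<Longrightarrow> discrete r a \<Longrightarrow> a \<in> elts b"
  shows "\<exists>C. initial_segment C type_chain \<and> order_iso a C \<and> elts C \<noteq> elts type_chain"
proof -
  have ab: "a \<in> elts b" using all a by blast
  have aW: "a \<in> W" using member_W[OF ab] .
  have aM: "a \<in> M" using W_M[OF aW] .
  have ud: "ud_chain a" and ch: "chain a" using a by (auto simp: wo_chain_def ud_chain_def)
  note le_sub = exact_le[OF ch a(2) h]
  have udX: "ud_chain type_chain" using type_chain_wo by (simp add: wo_chain_def)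
  have ex: "\<exists>p\<in>elts b. cut a x p" if x: "x \<in> elts a" for x
  proof -
    have xM: "x \<in> M" using x elts_M by blast
    have "sharp_set a (\<lambda>y. \<not> x \<sqsubseteq> y)" unfolding sharp_set_def
      by (intro sharp_not sub_at[OF ud] simple_var simple_const xM) (use x in auto)
    then obtain p where p: "p \<in> M" "elts p = {y \<in> elts a. \<not> x \<sqsubseteq> y}" using ud_subset[OF ud] by blast
    have "p \<sqsubseteq> a" using p by (auto simp: subset_rel_def)
    hence pb: "p \<in> elts b" using all wo_chain_sub[OF a(1) p(1)] discrete_sub[OF a(2)] by blast
    note pW = member_W[OF pb]
    have g: "max_iso p a z z" if "z \<in> elts p" for z
    proof (rule max_iso_segment[OF pW aW _ _ that])
      show "elts p \<subseteq> elts a" using p by blast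
      fix v y assume "v \<in> elts p" "y \<in> elts a" "le y v"
      thus "y \<in> elts p" using p(2) le_sub sub_trans by blast
    qed
    note G = max_iso_partial_iso[OF pW aW]
    have "cut a x p" unfolding cut_def type_le_def
    proof (intro conjI ballI iffI notI)
      show "\<exists>y\<in>elts a. max_iso p a z y" if "z \<in> elts p" for z using g[OF that] that p(2) by blast
    next
      fix y assume y: "y \<in> elts a" "\<exists>z\<in>elts p. max_iso p a z y" and l: "le x y"
      then obtain z where z: "z \<in> elts p" "max_iso p a z y" by blast
      have "le z z \<longleftrightarrow> le y z" by (rule partial_iso_le[OF G z(2) g[OF z(1)]])
      hence "le y z" using le_refl elts_M z(1) by blast
      hence "y \<sqsubseteq> z" "x \<sqsubseteq> y" using le_sub z(1) p(2) y(1) x l by blast+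
      thus False using sub_trans z(1) p(2) by blast
    next
      fix y assume "y \<in> elts a" "\<not> le x y"
      hence "y \<in> elts p" using le_sub x p(2) by blast
      thus "\<exists>z\<in>elts p. max_iso p a z y" using g by blast
    qed
    thus ?thesis using pb by blast
  qed
  define f where "f x = (SOME p. p \<in> elts b \<and> cut a x p)" for x
  have f: "f x \<in> elts b" "cut a x (f x)" if "x \<in> elts a" for x
    using someI_ex[of "\<lambda>p. p \<in> elts b \<and> cut a x p"] ex[OF that] unfolding f_def by blast+
  define g where "g x = lower (f x)" for x
  have gle: "x \<sqsubseteq> y \<longleftrightarrow> g x \<sqsubseteq> g y" if "x \<in> elts a" "y \<in> elts a" for x y
    using cut_type_le[OF ab f(1)[OF that(1)] f(1)[OF that(2)] that f(2)[OF that(1)] f(2)[OF that(2)]]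
      le_sub[OF that] lower_sub[OF f(1)[OF that(1)] f(1)[OF that(2)]] by (simp add: g_def)
  have gS: "g x = lower p" if "x \<in> elts a" "p \<in> elts b" "cut a x p" for x p
    unfolding g_def
    using lower_eq[OF f(1)[OF that(1)] that(2)] le_refl[OF elts_M[OF that(1)]]
      cut_type_le[OF ab f(1)[OF that(1)] that(2) that(1,1) f(2)[OF that(1)] that(3)]
      cut_type_le[OF ab that(2) f(1)[OF that(1)] that(1,1) that(3) f(2)[OF that(1)]] by blast
  define P where "P s \<longleftrightarrow> (\<exists>p\<in>elts b. s = lower p \<and> \<not> type_le a p)" for s
  have "sharp_set type_chain P" unfolding sharp_set_def P_def
    by (intro sharp_bex sharp_conj sharp_not eq_lower_at type_le_at simple_var simple_const b_M aM) (use b_W aW in auto)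
  then obtain C where C: "C \<in> M" "elts C = {s \<in> elts type_chain. P s}" using ud_subset[OF udX] by blast
  have CX: "C \<sqsubseteq> type_chain" using C by (auto simp: subset_rel_def)
  have im: "elts C = g ` elts a"
  proof (intro equalityI subsetI)
    fix s assume "s \<in> elts C"
    then obtain p where p: "p \<in> elts b" "s = lower p" "\<not> type_le a p" using C unfolding P_def by blast
    obtain x where x: "x \<in> elts a" "cut a x p" using less_cut[OF ab p(1,3)] by blast
    have "s = g x" using gS[OF x(1) p(1) x(2)] p(2) by simp
    thus "s \<in> g ` elts a" using x(1) by blast
  next
    fix s assume "s \<in> g ` elts a"
    then obtain x where x: "x \<in> elts a" "s = g x" by blast
    have "\<not> type_le a (f x)" using cut_less[OF ab f(1)[OF x(1)] x(1) f(2)[OF x(1)]] .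
    hence "P s" unfolding P_def g_def x(2) using f(1)[OF x(1)] by blast
    moreover have "s \<in> elts type_chain" using elts_type_chain f(1)[OF x(1)] x(2) by (simp add: g_def)
    ultimately show "s \<in> elts C" using C by blast
  qed
  have "inj_on g (elts a)"
  proof (rule inj_onI)
    fix x y assume xy: "x \<in> elts a" "y \<in> elts a" "g x = g y"
    hence "g x \<sqsubseteq> g y" "g y \<sqsubseteq> g x" by (auto simp: subset_rel_def)
    hence "x \<sqsubseteq> y" "y \<sqsubseteq> x" using gle xy(1,2) by blast+
    thus "x = y" using sub_antisym[OF elts_M[OF xy(1)] elts_M[OF xy(2)]] by blast
  qed
  hence bij: "bij_betw g (elts a) (elts C)" using im by (simp add: bij_betw_def)
  have udC: "ud_chain C" using ud_chain_sub[OF udX C(1) CX] .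
  have "sharp (\<lambda>e. e 0 \<in> elts a \<and> e (Suc 0) \<in> elts C)
      (\<lambda>e. \<exists>p\<in>elts b. cut a (e 0) p \<and> e (Suc 0) = lower p)"
    unfolding cut_def
    by (intro sharp_bex sharp_conj sharp_ball sharp_iff sharp_not eq_lower_at type_le_at max_iso_at le_in[OF aW] simple_var simple_const b_M aM)
       (use b_W aW CX in \<open>auto simp: subset_rel_def\<close>)
  then obtain F where F: "definable F" "\<And>e. envM e \<Longrightarrow> e 0 \<in> elts a \<and> e (Suc 0) \<in> elts C \<Longrightarrow>
      F e = truth (\<exists>p\<in>elts b. cut a (e 0) p \<and> e (Suc 0) = lower p)"
    unfolding sharp_def by blast
  have "sharp_rel a C (\<lambda>x y. y = g x)" unfolding sharp_rel_def
  proof (rule sharpI[OF F(1)])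
    fix e assume e: "envM e" "e 0 \<in> elts a \<and> e (Suc 0) \<in> elts C"
    have "(\<exists>p\<in>elts b. cut a (e 0) p \<and> e (Suc 0) = lower p) \<longleftrightarrow> e (Suc 0) = g (e 0)"
      using gS ex e(2) by metis
    thus "F e = truth (e (Suc 0) = g (e 0))" using F(2)[OF e] by simp
  qed
  hence "order_iso a C" unfolding order_iso_iff using ud udC bij gle by blast
  moreover have "initial_segment C type_chain" unfolding initial_segment_def
  proof (intro conjI ballI impI C(1) CX)
    fix s s' assume s: "s \<in> elts C" and s': "s' \<in> elts type_chain" "s' \<sqsubseteq> s"
    obtain p where p: "p \<in> elts b" "s = lower p" "\<not> type_le a p" using s C unfolding P_def by blast
    obtain q where q: "q \<in> elts b" "s' = lower q" using s' elts_type_chain by blast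
    have "type_le q p" using lower_sub[OF q(1) p(1)] s'(2) p q by simp
    hence "\<not> type_le a q" using class_trans[OF ab q(1) p(1)] p(3) by blast
    thus "s' \<in> elts C" using C s'(1) q unfolding P_def by blast
  qed
  moreover have "lower a \<notin> elts C"
  proof
    assume "lower a \<in> elts C"
    then obtain p where p: "p \<in> elts b" "lower a = lower p" "\<not> type_le a p" using C unfolding P_def by blast
    thus False using lower_eq[OF ab p(1)] by blast
  qed
  moreover have "lower a \<in> elts type_chain" using elts_type_chain ab by blast
  ultimately show ?thesis by blast
qed

end

section \<open>Ordinals and their discreteness\<close>

context mse_model
begin

text \<open>Combines \<open>approx_chains\<close> with \<open>near_type_le\<close>. The tolerance \<open>h\<close> is
taken from the room between \<open>r\<close> and \<open>u\<close>, or \<open>2 * u\<close> if the metric is no ultrametric.\<close>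
lemma dominating_chain:
  assumes r: "r \<le> 1" and u: "0 < u" and ur: "(if ultrametric then u else 2 * u) < r"
  shows "\<exists>X. wo_chain X \<and> discrete u X \<and>
     (\<forall>a. wo_chain a \<and> discrete r a \<longrightarrow> (\<exists>C. initial_segment C X \<and> order_iso a C \<and> elts C \<noteq> elts X))"
proof -
  \<comment> \<open>ten tolerances suffice: one for the loss in \<open>approx_chains\<close>, nine for the distortion of a pairing at distance \<open>u + 4 * h\<close>\<close>
  define h where "h = (r - (if ultrametric then u else 2 * u)) / 10"
  have h: "0 < h" "10 * h = r - (if ultrametric then u else 2 * u)" using ur by (auto simp: h_def)
  have h2: "3 * h \<le> 1" "4 * h \<le> r" "h \<le> r" "u + 5 * h \<le> r" "0 < r" using h u r ur by (auto split: if_splits)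
  interpret mse_tolerance M d E h by unfold_locales (use h h2 in auto)
  obtain b where b: "b \<in> M" "\<And>a. wo_chain a \<Longrightarrow> discrete r a \<Longrightarrow> a \<in> elts b"
      "\<And>p. p \<in> elts b \<Longrightarrow> wo_pre (r - h) p"
    using approx_chains[OF h2(5) r] by blast
  have bW: "elts b \<subseteq> W" using b(3) wo_pre_mono[of "r - h" _ "3 * h"] h2 by auto
  have H: "excess y y' < r - h"
    if "x \<in> M" "x' \<in> M" "y \<in> M" "y' \<in> M" "d x y < u + 4 * h" "d x' y' < u + 4 * h" "excess x x' < h" for x x' y y'
  proof -
    have 1: "excess y x < u + 4 * h" "excess x' y' < u + 4 * h"
      using that excess_le_d[of y x] excess_le_d[of x' y'] commute[of y x] by auto
    show ?thesis
    proof (cases ultrametric)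
      case True
      have "excess y y' \<le> max (excess y x) (max (excess x x') (excess x' y'))"
        using excess_ultra[OF True, of y y' x] excess_ultra[OF True, of x y' x'] by linarith
      thus ?thesis using 1 that(7) h u True by simp
    next
      case False
      thus ?thesis using excess_triangle[of y y' x] excess_triangle[of x y' x'] 1 that(7) h by simp
    qed
  qed
  interpret order_type_family M d E h b u
  proof unfold_locales
    show "u \<le> 1" using h2 h r by simp
    fix p q assume pq: "p \<in> elts b" "q \<in> elts b" "d p q < u"
    show "type_le p q"
      by (rule near_type_le[OF b(3)[OF pq(1)] b(3)[OF pq(2)] _ pq(3), of "u + 4 * h"]) (use h2 h r H in auto)
  qed (use b bW u in auto)
  show ?thesis using type_chain_wo type_chain_discrete type_chain_dominates[OF _ _ h2(3) b(2)] by blast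
qed

definition separations :: "'a set \<Rightarrow> real set" where
  "separations \<alpha> = {r. 0 < r \<and> r \<le> 1 \<and> (\<exists>x. wo_chain x \<and> discrete r x \<and> otp x = \<alpha>)}"

lemma sep_eq: "sep \<alpha> = Sup (separations \<alpha>)"
  by (simp add: sep_def separations_def)

lemma separations_bdd: "bdd_above (separations \<alpha>)"
  by (rule bdd_aboveI[of _ 1]) (simp add: separations_def)

lemma le_sep: "wo_chain x \<Longrightarrow> discrete r x \<Longrightarrow> 0 < r \<Longrightarrow> r \<le> 1 \<Longrightarrow> r \<le> sep (otp x)"
  unfolding sep_eq by (rule cSup_upper[OF _ separations_bdd]) (auto simp: separations_def)

lemma separations_nonempty: assumes "\<alpha> \<in> Ord" shows "separations \<alpha> \<noteq> {}"
proof -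
  obtain a where a: "wo_chain a" "\<alpha> = otp a" using assms by (auto simp: Ord_def)
  obtain r where r: "0 < r" "discrete r a" using a(1) unfolding wo_chain_def ud_chain_def uniformly_discrete_def by blast
  have "min r 1 \<in> separations \<alpha>" using r a discrete_mono[OF r(2), of "min r 1"] by (auto simp: separations_def)
  thus ?thesis by blast
qed

lemma sep_range: assumes "\<alpha> \<in> Ord" shows "0 < sep \<alpha>" "sep \<alpha> \<le> 1"
proof -
  obtain r where r: "r \<in> separations \<alpha>" using separations_nonempty[OF assms] by blast
  hence "r \<le> sep \<alpha>" unfolding sep_eq using separations_bdd by (rule cSup_upper)
  thus "0 < sep \<alpha>" using r by (simp add: separations_def)
  show "sep \<alpha> \<le> 1" unfolding sep_eq by (rule cSup_least) (use r in \<open>auto simp: separations_def\<close>)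
qed

lemma less_sepD:
  assumes "\<alpha> \<in> Ord" "r < sep \<alpha>" shows "\<exists>x. wo_chain x \<and> discrete r x \<and> otp x = \<alpha>"
proof -
  obtain r' where "r' \<in> separations \<alpha>" "r < r'" using assms less_cSupE[OF _ separations_nonempty] unfolding sep_eq by blast
  thus ?thesis unfolding separations_def using discrete_mono[of r' _ r] by force
qed

lemma wo_ud: "wo_chain a \<Longrightarrow> ud_chain a"
  by (simp add: wo_chain_def)

text \<open>An initial segment of a discrete chain is at least as discrete as the chain.\<close>
lemma sep_antimono:
  assumes \<alpha>: "\<alpha> \<in> Ord" and \<gamma>: "\<gamma> \<in> Ord" and le: "ord_le \<alpha> \<gamma>" shows "sep \<gamma> \<le> sep \<alpha>"
proof -
  obtain a where a: "wo_chain a" "otp a = \<alpha>" using \<alpha> by (auto simp: Ord_def)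
  have "separations \<gamma> \<subseteq> separations \<alpha>"
  proof
    fix r assume r: "r \<in> separations \<gamma>"
    then obtain x where x: "wo_chain x" "discrete r x" "otp x = \<gamma>" by (auto simp: separations_def)
    obtain c where c: "initial_segment c x" "order_iso a c" using le a x unfolding ord_le_def by blast
    have cx: "c \<in> M" "c \<sqsubseteq> x" using c(1) by (auto simp: initial_segment_def)
    have woc: "wo_chain c" using wo_chain_sub[OF x(1) cx] .
    have "otp c = \<alpha>" using otp_eq_iff[OF wo_ud[OF a(1)] wo_ud[OF woc]] c(2) a(2) by simp
    thus "r \<in> separations \<alpha>" using r woc discrete_sub[OF x(2) cx(2)] by (auto simp: separations_def)
  qed
  thus ?thesis unfolding sep_eq by (rule cSup_subset_mono[OF separations_nonempty[OF \<gamma>] separations_bdd])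
qed

text \<open>The bound \<open>sep \<alpha> < r\<close> comes for free: otherwise \<open>\<alpha>\<close> would be among the ordinals
strictly below \<open>\<alpha>\<close>.\<close>
lemma dominating_ordinal:
  assumes r: "0 < r" "r \<le> 1" and u: "u < (if ultrametric then r else r / 2)"
  shows "\<exists>\<alpha>\<in>Ord. u \<le> sep \<alpha> \<and> sep \<alpha> < r \<and> (\<forall>\<beta>\<in>Ord. r \<le> sep \<beta> \<longrightarrow> ord_less \<beta> \<alpha>)"
proof -
  define t where "t = (if ultrametric then r else r / 2)"
  \<comment> \<open>a positive discreteness is needed even if \<open>u\<close> is not positive\<close>
  define v where "v = max u (t / 2)"
  have v: "0 < v" "v < t" "u \<le> v" using u r by (auto simp: v_def t_def)
  define k where "k = (if ultrametric then v else 2 * v)"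
  have k: "k < r" "0 < k" "v \<le> k" using v by (auto simp: k_def t_def split: if_splits)
  define r' where "r' = (k + r) / 2"
  have r': "k < r'" "r' < r" using k by (auto simp: r'_def)
  obtain X where X: "wo_chain X" "discrete v X"
    "\<And>a. wo_chain a \<Longrightarrow> discrete r' a \<Longrightarrow> \<exists>C. initial_segment C X \<and> order_iso a C \<and> elts C \<noteq> elts X"
    using dominating_chain[of r' v] r' r v k_def by force
  have XO: "otp X \<in> Ord" using X(1) by (auto simp: Ord_def)
  have dom: "ord_less \<beta> (otp X)" if \<beta>: "\<beta> \<in> Ord" "r \<le> sep \<beta>" for \<beta>
  proof -
    obtain a where a: "wo_chain a" "discrete r' a" "otp a = \<beta>" using less_sepD[OF \<beta>(1), of r'] r' \<beta>(2) by force
    obtain C where C: "initial_segment C X" "order_iso a C" "elts C \<noteq> elts X" using X(3)[OF a(1,2)] by blast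
    have "ord_le \<beta> (otp X)" unfolding ord_le_def
    proof (intro allI impI)
      fix a' X' assume aX: "wo_chain a' \<and> otp a' = \<beta> \<and> wo_chain X' \<and> otp X' = otp X"
      have 1: "order_iso a' a" using otp_eq_iff[of a' a] aX a wo_ud by simp
      have 2: "order_iso X X'" using otp_eq_iff[of X X'] aX X(1) wo_ud by simp
      obtain C' where "initial_segment C' X'" "order_iso C C'" using initial_segment_transport[OF 2 C(1)] by blast
      thus "\<exists>c. initial_segment c X' \<and> order_iso a' c" using order_iso_trans[OF order_iso_trans[OF 1 C(2)]] by blast
    qed
    moreover have "\<beta> \<noteq> otp X"
    proof
      assume "\<beta> = otp X"
      hence "order_iso X a" using otp_eq_iff[of X a] a X(1) wo_ud by simp
      hence "elts X \<subseteq> elts C" using no_proper_segment[OF X(1) C(1)] order_iso_trans C(2) by blast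
      moreover have "elts C \<subseteq> elts X" using C(1) by (simp add: initial_segment_def subset_rel_def)
      ultimately show False using C(3) by blast
    qed
    ultimately show ?thesis by (simp add: ord_less_def)
  qed
  have "v \<le> sep (otp X)" by (rule le_sep[OF X(1,2)]) (use v k r in auto)
  moreover have "sep (otp X) < r" using dom[OF XO] by (force simp: ord_less_def)
  ultimately show ?thesis using XO dom v(3) by (intro bexI[of _ "otp X"]) auto
qed

lemma sep_dense:
  assumes u: ultrametric shows "{0<..1} \<subseteq> closure (sep ` Ord)"
proof
  fix v :: real assume v: "v \<in> {0<..1}"
  show "v \<in> closure (sep ` Ord)"
    unfolding closure_approachable
  proof (intro allI impI)
    fix \<epsilon> :: real assume \<epsilon>: "0 < \<epsilon>"
    obtain \<alpha> where "\<alpha> \<in> Ord" "v - \<epsilon> / 2 \<le> sep \<alpha>" "sep \<alpha> < v"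
      using dominating_ordinal[of v "v - \<epsilon> / 2"] v \<epsilon> u by auto
    thus "\<exists>y\<in>sep ` Ord. dist y v < \<epsilon>" using \<epsilon> by (intro bexI[of _ "sep \<alpha>"]) (auto simp: dist_real_def)
  qed
qed

text \<open>Ordinals \<open>\<gamma>\<close> with \<open>sep \<gamma>\<close> closer to 1 than \<open>sep \<alpha>\<close> cannot lie above \<open>\<alpha>\<close>.\<close>
lemma no_least_ordinal:
  assumes u: ultrametric
  shows "\<not> (\<exists>\<alpha>\<in>Ord. sep \<alpha> < 1 \<and> (\<forall>\<beta>\<in>Ord. sep \<beta> < 1 \<longrightarrow> ord_le \<alpha> \<beta>))"
proof
  assume "\<exists>\<alpha>\<in>Ord. sep \<alpha> < 1 \<and> (\<forall>\<beta>\<in>Ord. sep \<beta> < 1 \<longrightarrow> ord_le \<alpha> \<beta>)"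
  then obtain \<alpha> where \<alpha>: "\<alpha> \<in> Ord" "sep \<alpha> < 1" "\<And>\<beta>. \<beta> \<in> Ord \<Longrightarrow> sep \<beta> < 1 \<Longrightarrow> ord_le \<alpha> \<beta>" by blast
  obtain \<gamma> where \<gamma>: "\<gamma> \<in> Ord" "(sep \<alpha> + 1) / 2 \<le> sep \<gamma>" "sep \<gamma> < 1"
    using dominating_ordinal[of 1 "(sep \<alpha> + 1) / 2"] u \<alpha>(2) by auto
  have "sep \<gamma> \<le> sep \<alpha>" by (rule sep_antimono[OF \<alpha>(1) \<gamma>(1) \<alpha>(3)[OF \<gamma>(1,3)]])
  thus False using \<gamma>(2) \<alpha>(2) by (simp add: field_simps)
qed

end

theorem theorem4p10:
  fixes M :: "'a set" and d :: "'a \<Rightarrow> 'a \<Rightarrow> real" and E :: "('a \<times> 'a) set"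
  assumes "mse_model M d E"
  shows "(\<forall>r \<in> set_structure.sep M d E ` set_structure.Ord M d E.
            \<forall>u < (if set_structure.ultrametric M d then r else r / 2).
              \<exists>\<alpha> \<in> set_structure.Ord M d E.
                u \<le> set_structure.sep M d E \<alpha> \<and> set_structure.sep M d E \<alpha> < r \<and>
                (\<forall>\<beta> \<in> set_structure.Ord M d E.
                   r \<le> set_structure.sep M d E \<beta> \<longrightarrow> set_structure.ord_less M d E \<beta> \<alpha>))
       \<and> (set_structure.ultrametric M d \<longrightarrow>
            {0<..1} \<subseteq> closure (set_structure.sep M d E ` set_structure.Ord M d E) \<and>
            \<not> (\<exists>\<alpha> \<in> set_structure.Ord M d E. set_structure.sep M d E \<alpha> < 1 \<and>
                 (\<forall>\<beta> \<in> set_structure.Ord M d E.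
                    set_structure.sep M d E \<beta> < 1 \<longrightarrow> set_structure.ord_le M d E \<alpha> \<beta>)))"
proof -
  interpret mse_model M d E by (rule assms)
  show ?thesis
  proof (intro conjI ballI allI impI)
    fix r u assume "r \<in> sep ` Ord" and u: "u < (if ultrametric then r else r / 2)"
    hence r: "0 < r" "r \<le> 1" using sep_range by auto
    show "\<exists>\<alpha>\<in>Ord. u \<le> sep \<alpha> \<and> sep \<alpha> < r \<and> (\<forall>\<beta>\<in>Ord. r \<le> sep \<beta> \<longrightarrow> ord_less \<beta> \<alpha>)"
      by (rule dominating_ordinal[OF r u])
  qed (use sep_dense no_least_ordinal in auto)
qed

end
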